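(* Let $b$ be a point of the sphere at infinity $S_\infty$ of the hyperbolic space $\mathbb{H}^n$, and fix a half-space model of $\mathbb{H}^n$ associated to $b$ (i.e. in which $b$ is the point at infinity), with height coordinate $x>0$. Let $\Sigma$ be a minimal $k$-dimensional submanifold of $\mathbb{H}^n$ such that, in the compactification of $\mathbb{H}^n$ as the unit ball, the closure of $\Sigma$ does not contain $b$; in the half-space model this means that $\Sigma$ has a maximal height $x_{\max}<+\infty$. Let $a$ be any number in $(0,x_{\max}^{-1}]$, and let $A(t)$ be the $k$-volume of the region $\Sigma_t=\{p\in\Sigma: x(p)\ge \frac1t\}$ of $\Sigma$. Then the function $$\frac{A(t)}{Q_0(a,t)},\qquad Q_0(a,t)=\int_a^t s^{k-2}\,ds+\frac{1}{k}a^{k-1},$$ is increasing in $t$.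
   Context: $\mathbb{H}^n$ is the hyperbolic space of constant sectional curvature $-1$; in the half-space model its metric is $x^{-2}(dx^2+dy_1^2+\dots+dy_{n-1}^2)$ on $\{x>0\}$. Minimal means vanishing mean curvature. "Increasing" is in the weak sense (nondecreasing).
   Formalization: Σ is assumed to be a nonempty smooth embedded submanifold without boundary and closed in hyperbolic space; without closedness the claim fails, e.g. for a short open geodesic arc around the top of a half-circle, where A(t) is eventually constant while Q_0 keeps growing. *)

theory Defs
  imports "HOL-Analysis.Analysis"
begin

section \<open>The half-space model of hyperbolic space\<close>

text \<open>
  Points of the half-space model of \<open>H^n\<close> are pairs \<open>(x, y)\<close> with height \<open>x > 0\<close> and
  \<open>y\<close> in a Euclidean space \<open>'y\<close>, so \<open>n = DIM('y) + 1\<close>, and the distinguished ideal point \<open>b\<close>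
  is the point at infinity.
\<close>

definition half_space :: "(real \<times> 'y::euclidean_space) set" where
  "half_space = {p. 0 < fst p}"

text \<open>The metric \<open>x^{-2} (dx^2 + dy^2)\<close>, as a bilinear form at \<open>p\<close>.\<close>

definition hyp_metric ::
    "real \<times> 'y::euclidean_space \<Rightarrow> real \<times> 'y \<Rightarrow> real \<times> 'y \<Rightarrow> real" where
  "hyp_metric p v w = (v \<bullet> w) / (fst p)\<^sup>2"

text \<open>
  The Levi-Civita connection of \<open>hyp_metric\<close> is \<open>D + christoffel\<close>, with \<open>D\<close> the flat
  derivative; see \<open>christoffel_koszul\<close> below.
\<close>

definition christoffel ::
    "real \<times> 'y::euclidean_space \<Rightarrow> real \<times> 'y \<Rightarrow> real \<times> 'y \<Rightarrow> real \<times> 'y" where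
  "christoffel p v w =
     - (1 / fst p) *\<^sub>R (fst v *\<^sub>R w + fst w *\<^sub>R v - (v \<bullet> w) *\<^sub>R (1, 0))"

lemma hyp_metric_has_derivative:
  fixes p w z :: "real \<times> 'y::euclidean_space"
  assumes "p \<in> half_space"
  shows "((\<lambda>p. hyp_metric p w z) has_derivative
          (\<lambda>v. - 2 * (w \<bullet> z) * fst v / (fst p)^3)) (at p)"
proof -
  have x: "fst p \<noteq> 0" using assms by (auto simp: half_space_def)
  have "((\<lambda>x. (w \<bullet> z) / x\<^sup>2) has_real_derivative - 2 * (w \<bullet> z) / (fst p)^3) (at (fst p))"
  proof -
    have "((\<lambda>x::real. x\<^sup>2) has_real_derivative 2 * fst p) (at (fst p))"
      using DERIV_power[OF DERIV_ident, where n = 2 and x = "fst p"] by simp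
    from DERIV_divide[OF DERIV_const[of "w \<bullet> z"] this] x show ?thesis
      by (simp add: power2_eq_square power3_eq_cube mult_ac)
  qed
  then have "((\<lambda>x. (w \<bullet> z) / x\<^sup>2) has_derivative (*) (- 2 * (w \<bullet> z) / (fst p)^3)) (at (fst p))"
    by (simp add: has_field_derivative_def)
  from has_derivative_compose[OF has_derivative_fst[OF has_derivative_ident] this]
  show ?thesis
    by (simp add: hyp_metric_def)
qed

lemma christoffel_sym: "christoffel p v w = christoffel p w v"
  by (simp add: christoffel_def inner_commute add.commute)

lemma christoffel_koszul:
  fixes p v w z :: "real \<times> 'y::euclidean_space"
  assumes p: "p \<in> half_space"
  shows "2 * hyp_metric p (christoffel p v w) z =
           frechet_derivative (\<lambda>p. hyp_metric p w z) (at p) v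
         + frechet_derivative (\<lambda>p. hyp_metric p v z) (at p) w
         - frechet_derivative (\<lambda>p. hyp_metric p v w) (at p) z"
proof -
  have F: "frechet_derivative (\<lambda>p. hyp_metric p a b) (at p) =
             (\<lambda>v. - 2 * (a \<bullet> b) * fst v / (fst p)^3)" for a b :: "real \<times> 'y"
    using frechet_derivative_at[OF hyp_metric_has_derivative[OF p, of a b]] by simp
  define x where "x = fst p"
  have x: "x \<noteq> 0" using p by (auto simp: half_space_def x_def)
  have e: "((1::real, 0::'y) \<bullet> z) = fst z"
    by (cases z) simp
  have "2 * hyp_metric p (christoffel p v w) z =
      2 * (- (1 / x) * (fst v * (w \<bullet> z) + fst w * (v \<bullet> z) - (v \<bullet> w) * fst z)) / x\<^sup>2"
    unfolding hyp_metric_def christoffel_def x_def[symmetric]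
    by (simp only: inner_diff_left inner_add_left inner_scaleR_left e)
  also have "\<dots> = - 2 * (w \<bullet> z) * fst v / x^3 + - 2 * (v \<bullet> z) * fst w / x^3
      - (- 2 * (v \<bullet> w) * fst z / x^3)"
    by (simp add: divide_inverse power2_eq_square power3_eq_cube algebra_simps)
  finally show ?thesis unfolding F x_def .
qed

section \<open>The compactification as the unit ball\<close>

text \<open>
  Inversion in the sphere of radius \<open>sqrt 2\<close> about \<open>ideal_point\<close>. It is an isometry of
  \<open>half_space\<close> onto the Poincare ball model and sends the point at infinity of the half-space
  model to \<open>ideal_point\<close>. Closures in the compactification are closures in the closed unit ball.
\<close>

definition ideal_point :: "real \<times> 'y::euclidean_space" where
  "ideal_point = (- 1, 0)"

definition to_ball :: "real \<times> 'y::euclidean_space \<Rightarrow> real \<times> 'y" where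
  "to_ball p = ideal_point + (2 / (norm (p - ideal_point))\<^sup>2) *\<^sub>R (p - ideal_point)"

lemma norm_to_ball:
  assumes "p \<in> half_space"
  shows "(norm (to_ball p))\<^sup>2 = 1 - 4 * fst p / (norm (p - ideal_point))\<^sup>2"
proof -
  define q where "q = p - ideal_point"
  define N where "N = q \<bullet> q"
  have "fst q \<noteq> 0" using assms by (auto simp: q_def ideal_point_def half_space_def)
  then have "q \<noteq> 0" by auto
  then have N: "N \<noteq> 0" by (simp add: N_def)
  have 1: "ideal_point \<bullet> q = - (fst p + 1)"
    by (cases p) (simp add: q_def ideal_point_def)
  have 2: "ideal_point \<bullet> (ideal_point :: real \<times> 'a) = 1"
    by (simp add: ideal_point_def)
  have 3: "q \<bullet> q = N"
    by (simp add: N_def)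
  have "(norm (to_ball p))\<^sup>2 = (ideal_point + (2 / N) *\<^sub>R q) \<bullet> (ideal_point + (2 / N) *\<^sub>R q)"
    by (simp add: to_ball_def q_def N_def power2_norm_eq_inner)
  also have "\<dots> = 1 - 4 * (fst p + 1) / N + (2 / N) * (2 / N) * N"
    by (simp add: inner_add_left inner_add_right 1 2 3 inner_commute[of q ideal_point] divide_inverse algebra_simps)
  also have "\<dots> = 1 - 4 * fst p / N"
    using N by (simp add: field_simps)
  finally show ?thesis by (simp add: N_def q_def power2_norm_eq_inner)
qed

lemma to_ball_tendsto_ideal_point:
  "(to_ball \<longlongrightarrow> (ideal_point :: real \<times> 'y::euclidean_space)) at_infinity"
proof -
  let ?c = "ideal_point :: real \<times> 'y"
  have "norm (to_ball p - ?c) = 2 * inverse (norm (p - ?c))" for p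
    by (cases "p = ?c") (simp_all add: to_ball_def power2_eq_square divide_inverse)
  moreover have "filterlim (\<lambda>p. norm (p - ?c)) at_top at_infinity"
    using tendsto_add_filterlim_at_infinity[OF tendsto_const[of "- ?c"] filterlim_ident]
    by (simp add: filterlim_at_infinity_imp_norm_at_top add.commute)
  then have "((\<lambda>p. 2 * inverse (norm (p - ?c))) \<longlongrightarrow> 2 * 0) at_infinity"
    by (intro tendsto_intros tendsto_inverse_0_at_top)
  ultimately have "((\<lambda>p. norm (to_ball p - ?c)) \<longlongrightarrow> 0) at_infinity"
    by simp
  then show ?thesis
    by (simp add: tendsto_norm_zero_iff LIM_zero_iff)
qed

section \<open>Smooth submanifolds\<close>

text \<open>\<open>C^m\<close> maps on an open set, by iterating directional derivatives.\<close>

primrec Ck_on ::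
    "nat \<Rightarrow> 'a::euclidean_space set \<Rightarrow> ('a \<Rightarrow> 'b::euclidean_space) \<Rightarrow> bool" where
  "Ck_on 0 S f \<longleftrightarrow> continuous_on S f"
| "Ck_on (Suc m) S f \<longleftrightarrow>
     (\<forall>x\<in>S. f differentiable (at x)) \<and> (\<forall>v. Ck_on m S (\<lambda>x. frechet_derivative f (at x) v))"

definition smooth_on :: "'a::euclidean_space set \<Rightarrow> ('a \<Rightarrow> 'b::euclidean_space) \<Rightarrow> bool" where
  "smooth_on S f \<longleftrightarrow> (\<forall>m. Ck_on m S f)"

text \<open>
  Local parametrizations by open subsets of \<open>\<real>^k\<close>; the dimension is \<open>k = CARD('k)\<close>.
\<close>

definition local_param ::
    "'a::euclidean_space set \<Rightarrow> (real ^ 'k) set \<Rightarrow> (real ^ 'k \<Rightarrow> 'a) \<Rightarrow> bool" where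
  "local_param \<Sigma> U \<phi> \<longleftrightarrow>
     open U \<and> smooth_on U \<phi> \<and> (\<forall>u\<in>U. inj (frechet_derivative \<phi> (at u))) \<and>
     openin (top_of_set \<Sigma>) (\<phi> ` U) \<and> (\<exists>\<psi>. homeomorphism U (\<phi> ` U) \<phi> \<psi>)"

text \<open>
  Submanifolds of \<open>H^n\<close> have no boundary inside \<open>H^n\<close> and are closed in \<open>H^n\<close> (that is,
  properly embedded), so that they can only end at the sphere at infinity.
\<close>

definition hyp_submanifold :: "'k::finite itself \<Rightarrow> (real \<times> 'y::euclidean_space) set \<Rightarrow> bool" where
  "hyp_submanifold _ \<Sigma> \<longleftrightarrow>
     \<Sigma> \<subseteq> half_space \<and> closedin (top_of_set half_space) \<Sigma> \<and>
     (\<forall>p\<in>\<Sigma>. \<exists>U (\<phi> :: real ^ 'k \<Rightarrow> real \<times> 'y). local_param \<Sigma> U \<phi> \<and> p \<in> \<phi> ` U)"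

section \<open>Mean curvature and volume\<close>

definition partial :: "'k \<Rightarrow> (real ^ 'k::finite \<Rightarrow> 'a::euclidean_space) \<Rightarrow> real ^ 'k \<Rightarrow> 'a" where
  "partial i \<phi> u = frechet_derivative \<phi> (at u) (axis i 1)"

definition gram ::
    "(real ^ 'k::finite \<Rightarrow> real \<times> 'y::euclidean_space) \<Rightarrow> real ^ 'k \<Rightarrow> real ^ 'k ^ 'k" where
  "gram \<phi> u = (\<chi> i j. hyp_metric (\<phi> u) (partial i \<phi> u) (partial j \<phi> u))"

definition normal_part ::
    "(real ^ 'k::finite \<Rightarrow> real \<times> 'y::euclidean_space) \<Rightarrow> real ^ 'k \<Rightarrow> real \<times> 'y \<Rightarrow> real \<times> 'y" where
  "normal_part \<phi> u v = v - (\<Sum>i\<in>UNIV. \<Sum>j\<in>UNIV.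
     (matrix_inv (gram \<phi> u) $ i $ j * hyp_metric (\<phi> u) v (partial j \<phi> u)) *\<^sub>R partial i \<phi> u)"

text \<open>
  The normal part of the ambient covariant derivative of the \<open>j\<close>-th coordinate field along
  the \<open>i\<close>-th one.
\<close>

definition second_fundamental_form ::
    "(real ^ 'k::finite \<Rightarrow> real \<times> 'y::euclidean_space) \<Rightarrow> real ^ 'k \<Rightarrow> 'k \<Rightarrow> 'k \<Rightarrow> real \<times> 'y" where
  "second_fundamental_form \<phi> u i j =
     normal_part \<phi> u (partial i (partial j \<phi>) u + christoffel (\<phi> u) (partial i \<phi> u) (partial j \<phi> u))"

definition mean_curvature ::
    "(real ^ 'k::finite \<Rightarrow> real \<times> 'y::euclidean_space) \<Rightarrow> real ^ 'k \<Rightarrow> real \<times> 'y" where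
  "mean_curvature \<phi> u =
     (\<Sum>i\<in>UNIV. \<Sum>j\<in>UNIV. matrix_inv (gram \<phi> u) $ i $ j *\<^sub>R second_fundamental_form \<phi> u i j)"

definition minimal_submanifold ::
    "'k::finite itself \<Rightarrow> (real \<times> 'y::euclidean_space) set \<Rightarrow> bool" where
  "minimal_submanifold T \<Sigma> \<longleftrightarrow>
     hyp_submanifold T \<Sigma> \<and>
     (\<forall>U (\<phi> :: real ^ 'k \<Rightarrow> real \<times> 'y). local_param \<Sigma> U \<phi> \<longrightarrow> (\<forall>u\<in>U. mean_curvature \<phi> u = 0))"

text \<open>
  The \<open>k\<close>-volume of a Borel subset \<open>B\<close> of \<open>\<Sigma>\<close>, glued from the volume density \<open>sqrt (det gram)\<close>
  in local parametrizations: supremum of the total volume over countable families of disjoint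
  pieces of \<open>B\<close>, each the image of a Borel set under a local parametrization. As \<open>\<Sigma>\<close> is
  covered by countably many parametrizations, the supremum is attained by a partition of \<open>B\<close>.
\<close>

definition hyp_volume ::
    "'k::finite itself \<Rightarrow> (real \<times> 'y::euclidean_space) set \<Rightarrow> (real \<times> 'y) set \<Rightarrow> ennreal" where
  "hyp_volume _ \<Sigma> B =
     Sup {(\<Sum>i. \<integral>\<^sup>+ u\<in>W i. ennreal (sqrt (det (gram (\<phi> i) u))) \<partial>lborel)
          | (U :: nat \<Rightarrow> (real ^ 'k) set) (\<phi> :: nat \<Rightarrow> real ^ 'k \<Rightarrow> real \<times> 'y) W.
            (\<forall>i. local_param \<Sigma> (U i) (\<phi> i) \<and> W i \<in> sets borel \<and> W i \<subseteq> U i \<and> \<phi> i ` W i \<subseteq> B) \<and>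
            disjoint_family (\<lambda>i. \<phi> i ` W i)}"

definition max_height :: "(real \<times> 'y::euclidean_space) set \<Rightarrow> real" where
  "max_height \<Sigma> = Sup (fst ` \<Sigma>)"

text \<open>
  The integral is oriented, and \<open>s\<close> has the integer exponent \<open>k - 2\<close>, which is \<open>-1\<close> for \<open>k = 1\<close>.
\<close>

definition Q0 :: "nat \<Rightarrow> real \<Rightarrow> real \<Rightarrow> real" where
  "Q0 k a t = (LBINT s=a..t. s powi (int k - 2)) + 1 / real k * a ^ (k - 1)"

end

(*
  The function f = 1/x satisfies Hess f = f g on H^n, so Delta f = k f on a minimal Sigma, while
  |grad f| <= f. Testing with theta(f) for a nonincreasing theta vanishing beyond some level gives
      int (k s theta(s) + s^2 theta'(s)) dmu(s) <= 0,
  where mu is the push-forward under f of the k-volume of Sigma, supported in [a, infinity).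
  Here k s theta + s^2 theta' = s^(2-k) (s^k theta)', so the choice of s^k theta as the
  antiderivative of s^(k-2) (1_{s <= t1}/Q0(t1) - 1_{s <= t2}/Q0(t2)) with value 0 at t2 turns the
  inequality into A(t1)/Q0(t1) <= A(t2)/Q0(t2). This theta is nonincreasing because
  k Q0(a,s) >= s^(k-1). The indicators are replaced by continuous cut-offs of width e, and e -> 0.
*)
theory Submission
  imports Defs
begin

section \<open>Determinants and inverse matrices along curves\<close>

text \<open>\<open>Hess f\<close> never appears: only the height component of \<open>H = 0\<close>
  is used, and in a chart it becomes a formula for the Laplacian of the height, hence of
  \<open>1/x\<close>. The obstacle is globalisation. The volume is a supremum over families of chart
  pieces, so before anything can be integrated it has to be identified with a measure
  \<open>\<nu>\<close> on a compact piece \<open>K\<close> of \<Sigma>; this needs differentiable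
  transition maps and the change of variables. Integration by parts is then local and glued by a C^1
  partition of unity. The ideal point enters through compactness: if \<open>b\<close> is not in the
  closure, \<Sigma> is bounded, so \<open>K = {x \<ge> 1/t2}\<close> is compact, and a function of
  \<open>1/x\<close> vanishing from \<open>t2\<close> on is supported in \<open>K\<close>. The
  constant \<open>a^(k-1)/k\<close> in \<open>Q0\<close> gives equality in
  \<open>k Q0(a,s) \<ge> s^(k-1)\<close> at \<open>s = a\<close>; beyond \<open>a\<close> the left
  side grows at rate \<open>k s^(k-2)\<close>, the right side only at \<open>(k-1) s^(k-2)\<close>.
  The push-forward \<open>mu\<close> is never formed: the integrands are compared pointwise on
  \<open>K\<close>.\<close>

lemma matrix_add_rdistrib:
  fixes A B :: "'a::semiring_1^'n^'m"
  shows "(A + B) ** C = A ** C + B ** C"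
  by (simp add: vec_eq_iff matrix_matrix_mult_def sum.distrib distrib_right)

text \<open>Row \<open>r\<close> of \<open>B ** A\<close> is the combination of the rows of
  \<open>A\<close> with coefficients \<open>B $ r $ k\<close>; every term with
  \<open>k \<noteq> r\<close> has a repeated row and vanishes.\<close>

lemma det_row_replace_mult:
  fixes A B :: "real^'n^'n"
  shows "det (\<chi> i. if i = r then (B ** A) $ r else A $ i) = B $ r $ r * det A"
proof -
  have row: "(B ** A) $ r = (\<Sum>k\<in>UNIV. B $ r $ k *s A $ k)"
    by (simp add: vec_eq_iff matrix_matrix_mult_def)
  have k: "det (\<chi> i. if i = r then A $ k else A $ i) = (if k = r then det A else 0)" for k
  proof (cases "k = r")
    case True
    then have "(\<chi> i. if i = r then A $ k else A $ i) = A" by (simp add: vec_eq_iff)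
    with True show ?thesis by simp
  next
    case False
    have "det (\<chi> i. if i = r then A $ k else A $ i) = 0"
      by (rule det_identical_rows[OF False]) (use False in \<open>simp add: row_def vec_eq_iff\<close>)
    with False show ?thesis by simp
  qed
  have "det (\<chi> i. if i = r then (B ** A) $ r else A $ i) =
        (\<Sum>k\<in>UNIV. det (\<chi> i. if i = r then B $ r $ k *s A $ k else A $ i))"
    unfolding row by (rule det_linear_row_sum) simp
  also have "\<dots> = (\<Sum>k\<in>UNIV. B $ r $ k * (if k = r then det A else 0))"
    by (simp only: det_row_mul k)
  also have "\<dots> = B $ r $ r * det A" by (simp add: if_distrib cong: if_cong)
  finally show ?thesis .
qed

text \<open>Isolates the factor of row \<open>r\<close> in the Leibniz formula, so that the product
  rule for \<open>det\<close> reads as a sum of determinants with one row differentiated.\<close>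

lemma det_row_replace:
  fixes A :: "real^'n^'n" and v :: "real^'n"
  shows "det (\<chi> i. if i = r then v else A $ i) =
         (\<Sum>p | p permutes (UNIV::'n set). of_int (sign p) * (v $ p r * (\<Prod>i\<in>UNIV - {r}. A $ i $ p i)))"
  unfolding det_def
proof (rule sum.cong)
  fix p
  show "of_int (sign p) * (\<Prod>i\<in>UNIV. (\<chi> i. if i = r then v else A $ i) $ i $ p i) =
        of_int (sign p) * (v $ p r * (\<Prod>i\<in>UNIV - {r}. A $ i $ p i))"
    by (subst prod.remove[of UNIV r]) auto
qed simp

text \<open>Kept apart from Jacobi's formula because it asks for no inverse: the Cramer numerators
  differentiated below may be singular.\<close>

lemma has_real_derivative_det_expansion:
  fixes A :: "real \<Rightarrow> real^'n^'n"
  assumes "\<And>i j. ((\<lambda>t. A t $ i $ j) has_real_derivative A' i j) (at t)"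
  shows "((\<lambda>t. det (A t)) has_real_derivative
    (\<Sum>p | p permutes (UNIV::'n set). of_int (sign p) *
       (\<Sum>r\<in>UNIV. A' r (p r) * (\<Prod>i\<in>UNIV - {r}. A t $ i $ p i)))) (at t)"
proof -
  have prod: "((\<lambda>t. \<Prod>i\<in>UNIV. A t $ i $ p i) has_real_derivative
      (\<Sum>r\<in>UNIV. A' r (p r) * (\<Prod>i\<in>UNIV - {r}. A t $ i $ p i))) (at t)" for p
    by (rule has_field_derivative_prod) (rule assms)
  show ?thesis
    unfolding det_def by (intro DERIV_sum DERIV_cmult prod)
qed

text \<open>Jacobi's formula. Writing \<open>A' = (A' ** Ai) ** A t\<close> turns each determinant
  with a differentiated row into a diagonal entry of \<open>A' ** Ai\<close> times
  \<open>det (A t)\<close>.\<close>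

lemma has_real_derivative_det:
  fixes A :: "real \<Rightarrow> real^'n^'n" and A' :: "real^'n^'n"
  assumes "\<And>i j. ((\<lambda>t. A t $ i $ j) has_real_derivative A' $ i $ j) (at t)"
    and inv: "Ai ** A t = mat 1"
  shows "((\<lambda>t. det (A t)) has_real_derivative
           det (A t) * (\<Sum>i\<in>UNIV. \<Sum>j\<in>UNIV. A' $ i $ j * Ai $ j $ i)) (at t)"
proof -
  let ?P = "{p. p permutes (UNIV::'n set)}"
  have "((\<lambda>t. det (A t)) has_real_derivative
      (\<Sum>p\<in>?P. of_int (sign p) * (\<Sum>r\<in>UNIV. A' $ r $ p r * (\<Prod>i\<in>UNIV - {r}. A t $ i $ p i)))) (at t)"
    by (rule has_real_derivative_det_expansion) (rule assms)
  also have "(\<Sum>p\<in>?P. of_int (sign p) * (\<Sum>r\<in>UNIV. A' $ r $ p r * (\<Prod>i\<in>UNIV - {r}. A t $ i $ p i)))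
      = (\<Sum>r\<in>UNIV. det (\<chi> i. if i = r then A' $ r else A t $ i))"
    unfolding det_row_replace by (subst sum.swap) (simp add: sum_distrib_left)
  also have "\<dots> = (\<Sum>r\<in>UNIV. (A' ** Ai) $ r $ r * det (A t))"
  proof (rule sum.cong)
    fix r
    have "A' = (A' ** Ai) ** A t"
      by (simp add: matrix_mul_assoc[symmetric] inv)
    then have eq: "A' $ r = ((A' ** Ai) ** A t) $ r" by simp
    show "det (\<chi> i. if i = r then A' $ r else A t $ i) = (A' ** Ai) $ r $ r * det (A t)"
      by (subst eq) (rule det_row_replace_mult)
  qed simp
  also have "\<dots> = det (A t) * (\<Sum>i\<in>UNIV. \<Sum>j\<in>UNIV. A' $ i $ j * Ai $ j $ i)"
    by (simp add: matrix_matrix_mult_def sum_distrib_left mult.commute)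
  finally show ?thesis .
qed

text \<open>Makes the entries of the inverse rational functions of the entries of \<open>A\<close>;
  continuity and differentiability of \<open>matrix_inv\<close> are read off from this.\<close>

lemma matrix_inv_cramer:
  fixes A :: "real^'n^'n"
  assumes "det A \<noteq> 0"
  shows "matrix_inv A $ i $ j = det (\<chi> a b. if b = i then axis j 1 $ a else A $ a $ b) / det A"
proof -
  have "invertible A" using assms by (simp add: invertible_det_nz)
  then have I: "A ** matrix_inv A = mat 1"
    unfolding invertible_def matrix_inv_def by (rule someI2_ex) simp
  have "A *v (matrix_inv A *v axis j 1) = axis j 1"
    by (simp add: matrix_vector_mul_assoc I)
  then have "matrix_inv A *v axis j 1 = (\<chi> k. det (\<chi> a b. if b = k then axis j 1 $ a else A $ a $ b) / det A)"
    using cramer[OF assms] by blast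
  then show ?thesis
    by (metis (lifting) column_def matrix_vector_mult_basis vec_lambda_beta)
qed

lemma continuous_on_det [continuous_intros]:
  fixes A :: "'a::topological_space \<Rightarrow> real^'n^'n"
  assumes "\<And>i j. continuous_on S (\<lambda>t. A t $ i $ j)"
  shows "continuous_on S (\<lambda>t. det (A t))"
  unfolding det_def by (intro continuous_intros assms)

lemma continuous_on_matrix_inv:
  fixes A :: "'a::topological_space \<Rightarrow> real^'n^'n"
  assumes "\<And>i j. continuous_on S (\<lambda>t. A t $ i $ j)" and nz: "\<And>t. t \<in> S \<Longrightarrow> det (A t) \<noteq> 0"
  shows "continuous_on S (\<lambda>t. matrix_inv (A t) $ i $ j)"
proof -
  have "continuous_on S (\<lambda>t. (if b = i then axis j 1 $ a else A t $ a $ b))" for a b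
    using assms(1) by (cases "b = i") auto
  then have "continuous_on S (\<lambda>t. det (\<chi> a b. if b = i then axis j 1 $ a else A t $ a $ b) / det (A t))"
    by (intro continuous_intros assms) (auto simp: nz)
  then show ?thesis
    by (rule continuous_on_eq) (simp add: matrix_inv_cramer nz)
qed

text \<open>Cramer's rule yields only that some derivative exists. Its value comes from
  differentiating \<open>matrix_inv (A s) ** A s = mat 1\<close>, which holds for all
  \<open>s\<close> near \<open>t\<close> because the determinant stays nonzero there.\<close>

lemma has_real_derivative_matrix_inv:
  fixes A :: "real \<Rightarrow> real^'n^'n" and A' :: "real^'n^'n"
  assumes A: "\<And>i j. ((\<lambda>t. A t $ i $ j) has_real_derivative A' $ i $ j) (at t)"
    and nz: "det (A t) \<noteq> 0"
  shows "((\<lambda>t. matrix_inv (A t) $ i $ j) has_real_derivative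
           - (matrix_inv (A t) ** A' ** matrix_inv (A t)) $ i $ j) (at t)"
proof -
  let ?I = "\<lambda>t. matrix_inv (A t)"
  have "isCont (\<lambda>t. det (A t)) t"
    by (rule DERIV_isCont, rule has_real_derivative_det_expansion, rule A)
  then have ev: "\<forall>\<^sub>F s in nhds t. det (A s) \<noteq> 0"
    using nz by (simp add: isCont_def eventually_nhds_conv_at tendsto_imp_eventually_ne)
  have I: "A s ** ?I s = mat 1" "?I s ** A s = mat 1" if "det (A s) \<noteq> 0" for s
    using that unfolding invertible_det_nz[symmetric] invertible_def matrix_inv_def
    by (metis (mono_tags, lifting) someI_ex)+
  have diff: "\<exists>D. ((\<lambda>t. ?I t $ i $ j) has_real_derivative D) (at t)" for i j
  proof -
    have d: "(\<lambda>t. det (A t)) differentiable at t"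
      using has_real_derivative_det[OF A I(2)[OF nz]] unfolding real_differentiable_def by blast
    have D: "((\<lambda>t. (\<chi> a b. if b = i then axis j 1 $ a else A t $ a $ b) $ a $ b)
        has_real_derivative (if b = i then 0 else A' $ a $ b)) (at t)" for a b
      using A[of a b] by (cases "b = i") auto
    have "(\<lambda>t. det (\<chi> a b. if b = i then axis j 1 $ a else A t $ a $ b)) differentiable at t"
      unfolding real_differentiable_def
      using has_real_derivative_det_expansion[OF D] by blast
    with d have "(\<lambda>t. det (\<chi> a b. if b = i then axis j 1 $ a else A t $ a $ b) / det (A t)) differentiable at t"
      using nz by (intro differentiable_divide) auto
    then obtain D where D: "((\<lambda>t. det (\<chi> a b. if b = i then axis j 1 $ a else A t $ a $ b) / det (A t))
        has_real_derivative D) (at t)"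
      unfolding real_differentiable_def by blast
    have ev': "\<forall>\<^sub>F t in nhds t. ?I t $ i $ j =
        det (\<chi> a b. if b = i then axis j 1 $ a else A t $ a $ b) / det (A t)"
      using ev by eventually_elim (simp add: matrix_inv_cramer)
    from D show ?thesis
      unfolding DERIV_cong_ev[OF refl ev' refl, symmetric] by blast
  qed
  then obtain D0 where D0: "\<And>i j. ((\<lambda>t. ?I t $ i $ j) has_real_derivative D0 i j) (at t)" by metis
  define D where "D = (\<chi> i j. D0 i j)"
  have D: "((\<lambda>t. ?I t $ i $ j) has_real_derivative D $ i $ j) (at t)" for i j
    using D0 by (simp add: D_def)
  have "D ** A t + ?I t ** A' = 0"
  proof -
    have "(D ** A t + ?I t ** A') $ i $ j = 0" for i j
    proof -
      have "((\<lambda>t. (?I t ** A t) $ i $ j) has_real_derivative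
          (\<Sum>k\<in>UNIV. D $ i $ k * A t $ k $ j + A' $ k $ j * ?I t $ i $ k)) (at t)"
        unfolding matrix_matrix_mult_def
        by (simp, intro DERIV_sum DERIV_mult D A)
      moreover have "((\<lambda>t. (?I t ** A t) $ i $ j) has_real_derivative 0) (at t)"
      proof -
        have "\<forall>\<^sub>F t in nhds t. (?I t ** A t) $ i $ j = mat 1 $ i $ j"
          using ev by eventually_elim (simp add: I)
        from DERIV_cong_ev[OF refl this refl] show ?thesis by simp
      qed
      ultimately have "(\<Sum>k\<in>UNIV. D $ i $ k * A t $ k $ j + A' $ k $ j * ?I t $ i $ k) = 0"
        by (rule DERIV_unique)
      then show ?thesis by (simp add: matrix_matrix_mult_def sum.distrib mult.commute)
    qed
    then show ?thesis by (simp add: vec_eq_iff)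
  qed
  then have "(D ** A t + ?I t ** A') ** ?I t = 0" by simp
  then have "D + ?I t ** A' ** ?I t = 0"
    by (simp add: matrix_add_rdistrib matrix_mul_assoc[symmetric] I[OF nz])
  then have "D = - (?I t ** A' ** ?I t)" by (simp add: eq_neg_iff_add_eq_0)
  with D[of i j] show ?thesis by simp
qed

text \<open>Along the segment from \<open>mat 1\<close> to \<open>A\<close> the quadratic form stays
  positive, so no matrix on it is singular and the determinant cannot change sign.\<close>

lemma det_pos_if_pos_def:
  fixes A :: "real^'n^'n"
  assumes pos: "\<And>v. v \<noteq> 0 \<Longrightarrow> 0 < v \<bullet> (A *v v)"
  shows "0 < det A"
proof (rule ccontr)
  assume "\<not> 0 < det A"
  define M where "M t = t *\<^sub>R A + (1 - t) *\<^sub>R mat 1" for t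
  have "continuous_on {0..1} (\<lambda>t. det (M t))"
    unfolding M_def by (intro continuous_intros)
  moreover have "det (M 0) = 1" "det (M 1) = det A" by (simp_all add: M_def)
  ultimately obtain t where t: "0 \<le> t" "t \<le> 1" "det (M t) = 0"
    using IVT2'[of "\<lambda>t. det (M t)" 1 0 0] \<open>\<not> 0 < det A\<close> by force
  then have "\<not> invertible (M t)" by (simp add: invertible_det_nz)
  then obtain v where v: "v \<noteq> 0" "M t *v v = 0"
    unfolding invertible_left_inverse matrix_left_invertible_ker by blast
  have "v \<bullet> (M t *v v) = t * (v \<bullet> (A *v v)) + (1 - t) * (v \<bullet> v)"
    by (simp add: M_def matrix_vector_mult_add_rdistrib inner_add_right
        scaleR_matrix_vector_assoc[symmetric])
  moreover have "0 < t * (v \<bullet> (A *v v)) + (1 - t) * (v \<bullet> v)"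
  proof (cases "t = 0")
    case False
    then have "0 < t * (v \<bullet> (A *v v))" using pos[OF v(1)] t by simp
    moreover have "0 \<le> (1 - t) * (v \<bullet> v)" using t by simp
    ultimately show ?thesis by simp
  qed (use v in simp)
  ultimately show False using v by simp
qed

section \<open>Mixed partial derivatives and integrals of directional derivatives\<close>

text \<open>Two mean values: in direction \<open>a\<close> for the difference of \<open>f\<close>
  and its translate by \<open>h b\<close>, then in direction \<open>b\<close> for \<open>fa\<close>.
  The second difference on the left is symmetric in \<open>a\<close> and \<open>b\<close>, which
  gives the symmetry of mixed derivatives below.\<close>

lemma second_difference_mean_value:
  fixes f :: "'a::real_normed_vector \<Rightarrow> real"
  assumes "0 < h"
    and S: "\<And>s t. 0 \<le> s \<Longrightarrow> s \<le> h \<Longrightarrow> 0 \<le> t \<Longrightarrow> t \<le> h \<Longrightarrow> u + s *\<^sub>R a + t *\<^sub>R b \<in> S"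
    and fa: "\<And>x. x \<in> S \<Longrightarrow> ((\<lambda>t. f (x + t *\<^sub>R a)) has_real_derivative fa x) (at 0)"
    and fab: "\<And>x. x \<in> S \<Longrightarrow> ((\<lambda>t. fa (x + t *\<^sub>R b)) has_real_derivative fab x) (at 0)"
  shows "\<exists>s t. 0 < s \<and> s < h \<and> 0 < t \<and> t < h \<and>
    f (u + h *\<^sub>R a + h *\<^sub>R b) - f (u + h *\<^sub>R a) - f (u + h *\<^sub>R b) + f u
      = h * h * fab (u + s *\<^sub>R a + t *\<^sub>R b)"
proof -
  have shift: "((\<lambda>t. g (x + t *\<^sub>R v)) has_real_derivative D) (at s)"
    if "((\<lambda>t. g ((x + s *\<^sub>R v) + t *\<^sub>R v)) has_real_derivative D) (at 0)" for g :: "'a \<Rightarrow> real" and x v s D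
    using DERIV_shift[of "\<lambda>t. g (x + t *\<^sub>R v)" D 0 s] that by (simp add: algebra_simps)
  let ?g = "\<lambda>s. f ((u + h *\<^sub>R b) + s *\<^sub>R a) - f (u + s *\<^sub>R a)"
  have "(?g has_real_derivative fa (u + s *\<^sub>R a + h *\<^sub>R b) - fa (u + s *\<^sub>R a)) (at s)"
    if "0 \<le> s" "s \<le> h" for s
  proof (rule DERIV_diff)
    have "u + h *\<^sub>R b + s *\<^sub>R a = u + s *\<^sub>R a + h *\<^sub>R b" by simp
    then show "((\<lambda>s. f ((u + h *\<^sub>R b) + s *\<^sub>R a)) has_real_derivative fa (u + s *\<^sub>R a + h *\<^sub>R b)) (at s)"
      using fa[OF S[OF that, of h]] \<open>0 < h\<close> by (intro shift[of f "u + h *\<^sub>R b" s a]) (simp only: less_imp_le order_refl)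
    show "((\<lambda>s. f (u + s *\<^sub>R a)) has_real_derivative fa (u + s *\<^sub>R a)) (at s)"
      using fa[OF S[OF that, of 0]] \<open>0 < h\<close> by (intro shift[of f u s a]) simp
  qed
  from MVT2[OF \<open>0 < h\<close> this] obtain s where s: "0 < s" "s < h"
    "?g h - ?g 0 = h * (fa (u + s *\<^sub>R a + h *\<^sub>R b) - fa (u + s *\<^sub>R a))" by auto
  have "((\<lambda>t. fa ((u + s *\<^sub>R a) + t *\<^sub>R b)) has_real_derivative fab (u + s *\<^sub>R a + t *\<^sub>R b)) (at t)"
    if "0 \<le> t" "t \<le> h" for t
    using fab[OF S[OF _ _ that, of s]] s by (intro shift[of fa "u + s *\<^sub>R a" t b]) simp
  from MVT2[OF \<open>0 < h\<close> this] obtain t where t: "0 < t" "t < h"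
    "fa (u + s *\<^sub>R a + h *\<^sub>R b) - fa (u + s *\<^sub>R a) = h * fab (u + s *\<^sub>R a + t *\<^sub>R b)" by auto
  show ?thesis
    using s t by (intro exI[of _ s] exI[of _ t]) (simp add: algebra_simps)
qed

text \<open>Schwarz's theorem: both orders of the second difference agree, so the value of
  \<open>fab\<close> at one point of a small parallelogram at \<open>u\<close> equals the value of
  \<open>fba\<close> at another.\<close>

lemma mixed_partial_derivatives_eq:
  fixes f :: "'a::real_normed_vector \<Rightarrow> real"
  assumes "open S" "u \<in> S"
    and fa: "\<And>x. x \<in> S \<Longrightarrow> ((\<lambda>t. f (x + t *\<^sub>R a)) has_real_derivative fa x) (at 0)"
    and fb: "\<And>x. x \<in> S \<Longrightarrow> ((\<lambda>t. f (x + t *\<^sub>R b)) has_real_derivative fb x) (at 0)"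
    and fab: "\<And>x. x \<in> S \<Longrightarrow> ((\<lambda>t. fa (x + t *\<^sub>R b)) has_real_derivative fab x) (at 0)"
    and fba: "\<And>x. x \<in> S \<Longrightarrow> ((\<lambda>t. fb (x + t *\<^sub>R a)) has_real_derivative fba x) (at 0)"
    and cont: "continuous_on S fab" "continuous_on S fba"
  shows "fab u = fba u"
proof -
  have "dist (fab u) (fba u) < e" if "e > 0" for e
  proof -
    have "isCont fab u" "isCont fba u"
      using cont \<open>open S\<close> \<open>u \<in> S\<close> by (auto simp: continuous_on_eq_continuous_at)
    moreover have "e / 2 > 0" using that by simp
    ultimately obtain d1 d2 where d1: "d1 > 0" "\<And>z. dist z u < d1 \<Longrightarrow> dist (fab z) (fab u) < e / 2"
      and d2: "d2 > 0" "\<And>z. dist z u < d2 \<Longrightarrow> dist (fba z) (fba u) < e / 2"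
      unfolding continuous_at_eps_delta by blast
    obtain d3 where d3: "d3 > 0" "\<And>z. dist z u < d3 \<Longrightarrow> z \<in> S"
      using \<open>open S\<close> \<open>u \<in> S\<close> unfolding open_dist by blast
    define d where "d = min d1 (min d2 d3)"
    have d: "d > 0"
      "\<And>z. dist z u < d \<Longrightarrow> dist (fab z) (fab u) < e / 2 \<and> dist (fba z) (fba u) < e / 2 \<and> z \<in> S"
      using d1 d2 d3 by (auto simp: d_def)
    \<comment> \<open>Keeps every \<open>u + s a + t b\<close> with steps up to \<open>h\<close>
      within distance \<open>d\<close> of \<open>u\<close>; the \<open>1\<close> keeps the
      denominator positive.\<close>
    define h where "h = d / (2 * (norm a + norm b + 1))"
    have den: "norm a + norm b + 1 > 0" by (smt (verit) norm_ge_zero)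
    then have h: "0 < h" using \<open>d > 0\<close> by (simp add: h_def)
    have near: "dist (u + s *\<^sub>R a + t *\<^sub>R b) u < d" if "0 \<le> s" "s \<le> h" "0 \<le> t" "t \<le> h" for s t
    proof -
      have "dist (u + s *\<^sub>R a + t *\<^sub>R b) u \<le> s * norm a + t * norm b"
        using norm_triangle_ineq[of "s *\<^sub>R a" "t *\<^sub>R b"] that by (simp add: dist_norm add.assoc)
      also have "\<dots> \<le> h * norm a + h * norm b"
        using that by (intro add_mono mult_right_mono) auto
      also have "\<dots> < h * (2 * (norm a + norm b + 1))"
        using h den mult_pos_pos[OF h den] by (simp add: algebra_simps)
      also have "\<dots> = d" using den by (simp add: h_def)
      finally show ?thesis .
    qed
    have near': "dist (u + t *\<^sub>R b + s *\<^sub>R a) u < d" if "0 \<le> t" "t \<le> h" "0 \<le> s" "s \<le> h" for s t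
      using near[of s t] that by (simp add: add_ac)
    obtain s t where st: "0 < s" "s < h" "0 < t" "t < h"
      "f (u + h *\<^sub>R a + h *\<^sub>R b) - f (u + h *\<^sub>R a) - f (u + h *\<^sub>R b) + f u = h * h * fab (u + s *\<^sub>R a + t *\<^sub>R b)"
      using second_difference_mean_value[of h u a b S f fa fab] h fa fab near d(2) by blast
    obtain t' s' where st': "0 < s'" "s' < h" "0 < t'" "t' < h"
      "f (u + h *\<^sub>R b + h *\<^sub>R a) - f (u + h *\<^sub>R b) - f (u + h *\<^sub>R a) + f u = h * h * fba (u + t' *\<^sub>R b + s' *\<^sub>R a)"
      using second_difference_mean_value[of h u b a S f fb fba] h fb fba near' d(2) by blast
    have "h * h * fab (u + s *\<^sub>R a + t *\<^sub>R b) = h * h * fba (u + t' *\<^sub>R b + s' *\<^sub>R a)"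
    proof -
      have "u + h *\<^sub>R b + h *\<^sub>R a = u + h *\<^sub>R a + h *\<^sub>R b" by simp
      from st'(5)[unfolded this] st(5) show ?thesis by linarith
    qed
    then have "fab (u + s *\<^sub>R a + t *\<^sub>R b) = fba (u + t' *\<^sub>R b + s' *\<^sub>R a)" using h by simp
    moreover have "dist (fab (u + s *\<^sub>R a + t *\<^sub>R b)) (fab u) < e / 2"
      using d(2)[OF near[of s t]] st by simp
    moreover have "dist (fba (u + t' *\<^sub>R b + s' *\<^sub>R a)) (fba u) < e / 2"
      using d(2)[OF near'[of t' s']] st' by simp
    ultimately show ?thesis
      by (metis dist_commute dist_triangle_half_l)
  qed
  then show ?thesis by (metis dist_self dist_pos_lt less_irrefl)
qed

section \<open>Vanishing of integrals of compactly supported derivatives\<close>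

lemma lborel_integral_translation:
  fixes f :: "'a::euclidean_space \<Rightarrow> real"
  assumes "f \<in> borel_measurable borel"
  shows "(\<integral>u. f (u + c) \<partial>lborel) = (\<integral>u. f u \<partial>lborel)"
proof -
  have "(\<integral>u. f u \<partial>lborel) = (\<integral>u. f u \<partial>distr lborel borel ((+) c))"
    by (simp add: lborel_distr_plus)
  also have "\<dots> = (\<integral>u. f (c + u) \<partial>lborel)"
    using assms by (subst integral_distr) auto
  finally show ?thesis by (simp add: add.commute)
qed

lemma lborel_integrable_translation:
  fixes f :: "'a::euclidean_space \<Rightarrow> real"
  assumes "integrable lborel f"
  shows "integrable lborel (\<lambda>u. f (u + c))"
proof -
  have "integrable (distr lborel borel ((+) c)) f"
    using assms by (simp add: lborel_distr_plus)
  then have "integrable lborel (\<lambda>u. f (c + u))"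
    using assms by (subst (asm) integrable_distr_eq) auto
  then show ?thesis by (simp add: add.commute)
qed

lemma continuous_compact_support_integrable:
  fixes f :: "'a::euclidean_space \<Rightarrow> real"
  assumes "continuous_on UNIV f" "compact C" "\<And>u. u \<notin> C \<Longrightarrow> f u = 0"
  shows "integrable lborel f"
proof -
  have "set_integrable lborel C f"
    by (unfold set_integrable_def, rule borel_integrable_compact) (auto intro: assms continuous_on_subset[OF assms(1)])
  moreover have "(\<lambda>u. indicator C u *\<^sub>R f u) = f"
    using assms(3) by (fastforce simp: indicator_def)
  ultimately show ?thesis by (simp add: set_integrable_def)
qed

text \<open>Difference quotients of \<open>X\<close> integrate to 0 by translation invariance, and
  dominated convergence carries this over to the derivative.\<close>

lemma integral_directional_derivative_eq_0:
  fixes X D :: "'a::euclidean_space \<Rightarrow> real"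
  assumes C: "compact C" "\<And>u. u \<notin> C \<Longrightarrow> X u = 0" "\<And>u. u \<notin> C \<Longrightarrow> D u = 0"
    and X: "continuous_on UNIV X" and D: "continuous_on UNIV D"
    and deriv: "\<And>u. ((\<lambda>t. X (u + t *\<^sub>R c)) has_real_derivative D u) (at 0)"
  shows "(\<integral>u. D u \<partial>lborel) = 0"
proof -
  define s where "s n = 1 / real (Suc n)" for n
  have s: "0 < s n" "s n \<le> 1" for n by (simp_all add: s_def)
  have s0: "s \<longlonglongrightarrow> 0" unfolding s_def by (rule LIMSEQ_Suc[OF lim_1_over_n])
  define F where "F n u = (X (u + s n *\<^sub>R c) - X u) / s n" for n u
  have intX: "integrable lborel X" by (rule continuous_compact_support_integrable[OF X C(1,2)])
  have meas: "X \<in> borel_measurable borel" "D \<in> borel_measurable borel"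
    using X D by (auto intro: borel_measurable_continuous_onI)
  have F0: "(\<integral>u. F n u \<partial>lborel) = 0" for n
    unfolding F_def using intX lborel_integrable_translation[OF intX, of "s n *\<^sub>R c"]
    by (simp add: lborel_integral_translation meas)
  \<comment> \<open>The union of the translates \<open>C - t c\<close> with
    \<open>0 \<le> t \<le> 1\<close>: a compact set containing the supports of all difference
    quotients of step at most 1. The mean value theorem bounds them there by a bound for
    \<open>D\<close>.\<close>
  define C' where "C' = (\<lambda>p. fst p - snd p *\<^sub>R c) ` (C \<times> {0..1::real})"
  have C': "compact C'" unfolding C'_def
    by (intro compact_continuous_image continuous_intros compact_Times C(1)) auto
  have inC': "u \<in> C'" if "u + t *\<^sub>R c \<in> C" "0 \<le> t" "t \<le> 1" for u t
    unfolding C'_def using that by (intro image_eqI[of _ _ "(u + t *\<^sub>R c, t)"]) auto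
  obtain B where B: "\<And>u. \<bar>D u\<bar> \<le> B"
  proof -
    have "bounded (D ` C)" using C(1) D by (intro compact_imp_bounded compact_continuous_image) (auto intro: continuous_on_subset)
    then obtain B where "\<And>u. u \<in> C \<Longrightarrow> \<bar>D u\<bar> \<le> B" unfolding bounded_iff by auto
    then have "\<bar>D u\<bar> \<le> max B 0" for u using C(3)[of u] by (cases "u \<in> C") (auto simp: le_max_iff_disj)
    then show ?thesis by (rule that)
  qed
  have deriv': "((\<lambda>t. X (u + t *\<^sub>R c)) has_real_derivative D (u + r *\<^sub>R c)) (at r)" for u r
    using DERIV_shift[of "\<lambda>t. X (u + t *\<^sub>R c)" "D (u + r *\<^sub>R c)" 0 r] deriv[of "u + r *\<^sub>R c"]
    by (simp add: algebra_simps)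
  have bound: "norm (F n u) \<le> B * indicator C' u" for n u
  proof (cases "u \<in> C'")
    case True
    obtain z where "X (u + s n *\<^sub>R c) - X (u + 0 *\<^sub>R c) = (s n - 0) * D (u + z *\<^sub>R c)"
      using MVT2[OF s(1)[of n] deriv'] by metis
    then have "F n u = D (u + z *\<^sub>R c)" using s(1)[of n] by (simp add: F_def)
    then show ?thesis using True B by simp
  next
    case False
    then have "u \<notin> C" "u + s n *\<^sub>R c \<notin> C"
      using inC'[of u 0] inC'[of u "s n"] s[of n] by auto
    then show ?thesis using C(2) False by (simp add: F_def)
  qed
  have lim: "(\<lambda>n. F n u) \<longlonglongrightarrow> D u" for u
  proof -
    have "(\<lambda>h. (X (u + h *\<^sub>R c) - X u) / h) \<midarrow>0\<rightarrow> D u"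
      using deriv[of u] by (simp add: DERIV_def)
    moreover have "filterlim s (at 0) sequentially"
      unfolding filterlim_at using s0 s(1) by (auto intro!: always_eventually simp: less_imp_neq[symmetric])
    ultimately show ?thesis
      unfolding F_def by (rule filterlim_compose)
  qed
  have "(\<lambda>n. \<integral>u. F n u \<partial>lborel) \<longlonglongrightarrow> (\<integral>u. D u \<partial>lborel)"
  proof (rule integral_dominated_convergence[where w = "\<lambda>u. B * indicator C' u"])
    show "integrable lborel (\<lambda>u. B * indicator C' u)"
      using emeasure_compact_finite[OF C'] borel_compact[OF C'] by (intro integrable_mult_right integrable_real_indicator) auto
  qed (use meas lim bound in \<open>auto simp: F_def\<close>)
  then show ?thesis using F0 by (simp add: LIMSEQ_const_iff)
qed

section \<open>Index algebra for the Laplacian of the height\<close>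

lemma sum3_rotate: "(\<Sum>i\<in>A. \<Sum>j\<in>A. \<Sum>k\<in>A. f i j k) = (\<Sum>k\<in>A. \<Sum>i\<in>A. \<Sum>j\<in>A. f i j k)"
proof -
  have "(\<Sum>i\<in>A. \<Sum>j\<in>A. \<Sum>k\<in>A. f i j k) = (\<Sum>i\<in>A. \<Sum>k\<in>A. \<Sum>j\<in>A. f i j k)"
    by (intro sum.cong refl sum.swap)
  also have "\<dots> = (\<Sum>k\<in>A. \<Sum>i\<in>A. \<Sum>j\<in>A. f i j k)" by (rule sum.swap)
  finally show ?thesis .
qed

text \<open>In the application \<open>G\<close> is the Gram matrix, \<open>\<Gamma> a b c\<close> is
  the product of the second derivative in directions \<open>a\<close>, \<open>b\<close> with the
  \<open>c\<close>-th tangent vector, divided by \<open>x^2\<close>, and \<open>h\<close>,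
  \<open>hh\<close> are derivatives of the height, so that \<open>T\<close> is its gradient. The
  left-hand side is the divergence of \<open>T\<close>, with contributions of the density, of the
  inverse Gram matrix and of \<open>h\<close>. In the factor \<open>k - 2\<close>, the
  \<open>k\<close> is the trace of \<open>Gi ** G\<close> in the density term and the
  \<open>2\<close> comes from the inverse; both arise from differentiating \<open>x^-2\<close> in
  the metric.\<close>

lemma divergence_identity:
  fixes G Gi :: "real^'k^'k" and \<Gamma> :: "'k \<Rightarrow> 'k \<Rightarrow> 'k \<Rightarrow> real"
  assumes inv: "Gi ** G = mat 1"
    and symGi: "\<And>i j. Gi $ i $ j = Gi $ j $ i"
    and sym\<Gamma>: "\<And>a b c. \<Gamma> a b c = \<Gamma> b a c"
    and dG: "\<And>c i j. dG c i j = \<Gamma> c i j + \<Gamma> c j i - 2 * (h c / x) * G $ i $ j"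
    and symG: "\<And>i j. G $ i $ j = G $ j $ i"
    and T: "\<And>c. T c = (\<Sum>j\<in>UNIV. Gi $ c $ j * h j)"
    and H: "(\<Sum>i\<in>UNIV. \<Sum>j\<in>UNIV. Gi $ i $ j * (hh i j - (\<Sum>b\<in>UNIV. \<Gamma> i j b * T b))) = Z"
  shows "(\<Sum>c\<in>UNIV. (1/2) * (\<Sum>i\<in>UNIV. \<Sum>j\<in>UNIV. dG c i j * Gi $ j $ i) * T c +
           (\<Sum>j\<in>UNIV. - (\<Sum>a\<in>UNIV. \<Sum>b\<in>UNIV. Gi $ c $ a * dG c a b * Gi $ b $ j) * h j + Gi $ c $ j * hh c j))
       = Z - (real CARD('k) - 2) * (\<Sum>c\<in>UNIV. h c * T c) / x"
proof -
  have inv': "(\<Sum>j\<in>UNIV. Gi $ i $ j * G $ j $ l) = (if i = l then 1 else 0)" for i l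
    using arg_cong[OF inv, of "\<lambda>M. M $ i $ l"] by (simp add: matrix_matrix_mult_def mat_def)
  have tr: "(\<Sum>i\<in>UNIV. \<Sum>j\<in>UNIV. G $ i $ j * Gi $ j $ i) = real CARD('k)"
    by (subst sum.swap) (simp add: inv' mult.commute[of "G $ _ $ _"])
  have tr\<Gamma>: "(\<Sum>i\<in>UNIV. \<Sum>j\<in>UNIV. \<Gamma> c j i * Gi $ j $ i) = (\<Sum>i\<in>UNIV. \<Sum>j\<in>UNIV. Gi $ i $ j * \<Gamma> c i j)" for c
    by (subst sum.swap) (simp add: mult.commute)
  have tr\<Gamma>': "(\<Sum>i\<in>UNIV. \<Sum>j\<in>UNIV. \<Gamma> c i j * Gi $ j $ i) = (\<Sum>i\<in>UNIV. \<Sum>j\<in>UNIV. Gi $ i $ j * \<Gamma> c i j)" for c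
    by (intro sum.cong refl) (metis mult.commute symGi)
  have trd: "(\<Sum>i\<in>UNIV. \<Sum>j\<in>UNIV. dG c i j * Gi $ j $ i)
      = 2 * (\<Sum>i\<in>UNIV. \<Sum>j\<in>UNIV. Gi $ i $ j * \<Gamma> c i j) - 2 * (h c / x) * real CARD('k)" for c
  proof -
    have "(\<Sum>i\<in>UNIV. \<Sum>j\<in>UNIV. dG c i j * Gi $ j $ i)
        = (\<Sum>i\<in>UNIV. \<Sum>j\<in>UNIV. \<Gamma> c i j * Gi $ j $ i) + (\<Sum>i\<in>UNIV. \<Sum>j\<in>UNIV. \<Gamma> c j i * Gi $ j $ i)
          - 2 * (h c / x) * (\<Sum>i\<in>UNIV. \<Sum>j\<in>UNIV. G $ i $ j * Gi $ j $ i)"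
      unfolding dG by (simp add: sum_distrib_left sum.distrib sum_subtractf algebra_simps)
    then show ?thesis by (simp add: tr tr\<Gamma> tr\<Gamma>')
  qed
  have mid: "(\<Sum>j\<in>UNIV. (\<Sum>a\<in>UNIV. \<Sum>b\<in>UNIV. Gi $ c $ a * dG c a b * Gi $ b $ j) * h j)
      = (\<Sum>a\<in>UNIV. \<Sum>b\<in>UNIV. Gi $ c $ a * \<Gamma> c a b * T b) + (\<Sum>a\<in>UNIV. \<Sum>b\<in>UNIV. Gi $ c $ a * \<Gamma> c b a * T b)
        - 2 * h c * T c / x" for c
  proof -
    have "(\<Sum>j\<in>UNIV. (\<Sum>a\<in>UNIV. \<Sum>b\<in>UNIV. Gi $ c $ a * dG c a b * Gi $ b $ j) * h j)
        = (\<Sum>j\<in>UNIV. \<Sum>a\<in>UNIV. \<Sum>b\<in>UNIV. Gi $ c $ a * dG c a b * (Gi $ b $ j * h j))"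
      by (simp add: sum_distrib_right mult.assoc)
    also have "\<dots> = (\<Sum>a\<in>UNIV. \<Sum>b\<in>UNIV. \<Sum>j\<in>UNIV. Gi $ c $ a * dG c a b * (Gi $ b $ j * h j))"
      by (rule sum3_rotate[symmetric])
    also have "\<dots> = (\<Sum>a\<in>UNIV. \<Sum>b\<in>UNIV. Gi $ c $ a * dG c a b * T b)"
      by (simp add: T sum_distrib_left)
    also have "\<dots> = (\<Sum>a\<in>UNIV. \<Sum>b\<in>UNIV. Gi $ c $ a * \<Gamma> c a b * T b) + (\<Sum>a\<in>UNIV. \<Sum>b\<in>UNIV. Gi $ c $ a * \<Gamma> c b a * T b)
        - 2 * (h c / x) * (\<Sum>a\<in>UNIV. \<Sum>b\<in>UNIV. Gi $ c $ a * G $ a $ b * T b)"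
      unfolding dG by (simp add: sum_distrib_left sum.distrib sum_subtractf algebra_simps)
    also have "(\<Sum>a\<in>UNIV. \<Sum>b\<in>UNIV. Gi $ c $ a * G $ a $ b * T b) = T c"
      by (subst sum.swap) (simp add: sum_distrib_right[symmetric] inv' if_distrib[of "\<lambda>z. z * _"] cong: if_cong)
    finally show ?thesis by simp
  qed
  \<comment> \<open>The density term cancels one of the two \<Gamma>-sums produced by the inverse
    Gram matrix. Here the symmetry of second derivatives is used.\<close>
  have cancel: "(\<Sum>c\<in>UNIV. \<Sum>a\<in>UNIV. \<Sum>b\<in>UNIV. Gi $ c $ a * \<Gamma> c b a * T b)
      = (\<Sum>c\<in>UNIV. (\<Sum>i\<in>UNIV. \<Sum>j\<in>UNIV. Gi $ i $ j * \<Gamma> c i j) * T c)"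
    by (subst sum3_rotate) (simp add: sum_distrib_right sym\<Gamma>[of _ _ ])
  have "(\<Sum>c\<in>UNIV. (1/2) * (\<Sum>i\<in>UNIV. \<Sum>j\<in>UNIV. dG c i j * Gi $ j $ i) * T c +
           (\<Sum>j\<in>UNIV. - (\<Sum>a\<in>UNIV. \<Sum>b\<in>UNIV. Gi $ c $ a * dG c a b * Gi $ b $ j) * h j + Gi $ c $ j * hh c j))
     = (\<Sum>c\<in>UNIV. (\<Sum>i\<in>UNIV. \<Sum>j\<in>UNIV. Gi $ i $ j * \<Gamma> c i j) * T c - real CARD('k) * (h c * T c / x)
         - (\<Sum>a\<in>UNIV. \<Sum>b\<in>UNIV. Gi $ c $ a * \<Gamma> c a b * T b) - (\<Sum>a\<in>UNIV. \<Sum>b\<in>UNIV. Gi $ c $ a * \<Gamma> c b a * T b)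
         + 2 * (h c * T c / x) + (\<Sum>j\<in>UNIV. Gi $ c $ j * hh c j))"
  proof (rule sum.cong[OF refl])
    fix c
    have eq: "(\<Sum>j\<in>UNIV. - (\<Sum>a\<in>UNIV. \<Sum>b\<in>UNIV. Gi $ c $ a * dG c a b * Gi $ b $ j) * h j + Gi $ c $ j * hh c j)
        = (\<Sum>j\<in>UNIV. Gi $ c $ j * hh c j)
          - (\<Sum>j\<in>UNIV. (\<Sum>a\<in>UNIV. \<Sum>b\<in>UNIV. Gi $ c $ a * dG c a b * Gi $ b $ j) * h j)"
      by (simp add: sum_subtractf)
    show "(1/2) * (\<Sum>i\<in>UNIV. \<Sum>j\<in>UNIV. dG c i j * Gi $ j $ i) * T c +
           (\<Sum>j\<in>UNIV. - (\<Sum>a\<in>UNIV. \<Sum>b\<in>UNIV. Gi $ c $ a * dG c a b * Gi $ b $ j) * h j + Gi $ c $ j * hh c j)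
     = (\<Sum>i\<in>UNIV. \<Sum>j\<in>UNIV. Gi $ i $ j * \<Gamma> c i j) * T c - real CARD('k) * (h c * T c / x)
         - (\<Sum>a\<in>UNIV. \<Sum>b\<in>UNIV. Gi $ c $ a * \<Gamma> c a b * T b) - (\<Sum>a\<in>UNIV. \<Sum>b\<in>UNIV. Gi $ c $ a * \<Gamma> c b a * T b)
         + 2 * (h c * T c / x) + (\<Sum>j\<in>UNIV. Gi $ c $ j * hh c j)"
      unfolding eq trd mid by (simp add: field_simps)
  qed
  also have "\<dots> = (\<Sum>i\<in>UNIV. \<Sum>j\<in>UNIV. Gi $ i $ j * (hh i j - (\<Sum>b\<in>UNIV. \<Gamma> i j b * T b)))
      - (real CARD('k) - 2) * (\<Sum>c\<in>UNIV. h c * T c / x)"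
  proof -
    have "(\<Sum>i\<in>UNIV. \<Sum>j\<in>UNIV. Gi $ i $ j * (hh i j - (\<Sum>b\<in>UNIV. \<Gamma> i j b * T b)))
        = (\<Sum>c\<in>UNIV. \<Sum>j\<in>UNIV. Gi $ c $ j * hh c j)
          - (\<Sum>c\<in>UNIV. \<Sum>a\<in>UNIV. \<Sum>b\<in>UNIV. Gi $ c $ a * \<Gamma> c a b * T b)"
      by (simp add: sum_subtractf right_diff_distrib sum_distrib_left mult.assoc)
    moreover have "(\<Sum>c\<in>UNIV. real CARD('k) * (h c * T c / x)) = real CARD('k) * (\<Sum>c\<in>UNIV. h c * T c / x)"
      "(\<Sum>c\<in>UNIV. 2 * (h c * T c / x)) = 2 * (\<Sum>c\<in>UNIV. h c * T c / x)"
      by (simp_all only: sum_distrib_left)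
    ultimately show ?thesis
      unfolding sum.distrib sum_subtractf cancel by (simp only: left_diff_distrib)
  qed
  finally show ?thesis unfolding H by (simp add: sum_divide_distrib[symmetric])
qed

section \<open>Geometry of a local parametrization\<close>

lemma has_real_derivative_along_line:
  fixes f :: "'a::real_normed_vector \<Rightarrow> real"
  assumes "(f has_derivative f') (at u)"
  shows "((\<lambda>t. f (u + t *\<^sub>R v)) has_real_derivative f' v) (at 0)"
proof -
  have "((\<lambda>t. u + t *\<^sub>R v) has_derivative (\<lambda>t. t *\<^sub>R v)) (at 0)"
    by (auto intro!: derivative_eq_intros)
  then have "((\<lambda>t. f (u + t *\<^sub>R v)) has_derivative (\<lambda>t. f' (t *\<^sub>R v))) (at 0)"
    using has_derivative_compose[of "\<lambda>t. u + t *\<^sub>R v" _ 0 UNIV f f'] assms by simp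
  moreover have "f' (t *\<^sub>R v) = t * f' v" for t
    using has_derivative_bounded_linear[OF assms] by (simp add: linear_simps)
  ultimately show ?thesis
    by (simp add: has_field_derivative_def mult.commute[of "f' v", abs_def])
qed

text \<open>The hyperbolic gradient of the height on the submanifold, divided by \<open>x\<^sup>2\<close>.\<close>

definition vertical_tangent ::
    "(real ^ 'k::finite \<Rightarrow> real \<times> 'y::euclidean_space) \<Rightarrow> real ^ 'k \<Rightarrow> real \<times> 'y" where
  "vertical_tangent \<phi> u = (1, 0) - normal_part \<phi> u (1, 0)"

text \<open>The infinitesimal content of \<open>local_param\<close>, on which the computations up to
  the divergence theorem in one chart rest; the embedding into \<Sigma> is added in
  \<open>chart\<close>.\<close>

locale immersion =
  fixes U :: "(real ^ 'k::finite) set" and \<phi> :: "real ^ 'k \<Rightarrow> real \<times> 'y::euclidean_space"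
  assumes open_U: "open U"
    and smooth: "smooth_on U \<phi>"
    and inj_deriv: "\<And>u. u \<in> U \<Longrightarrow> inj (frechet_derivative \<phi> (at u))"
    and half: "\<phi> ` U \<subseteq> half_space"
begin

lemma Ck_param: "Ck_on m U \<phi>"
  using smooth by (simp add: smooth_on_def)

lemma Ck_partial: "Ck_on m U (partial i \<phi>)"
proof -
  have "Ck_on m U (\<lambda>x. frechet_derivative \<phi> (at x) (axis i 1))"
    using Ck_param[of "Suc m"] by simp
  then show ?thesis by (simp add: partial_def[abs_def])
qed

lemma Ck_partial2: "Ck_on m U (partial j (partial i \<phi>))"
proof -
  have "Ck_on m U (\<lambda>x. frechet_derivative (partial i \<phi>) (at x) (axis j 1))"
    using Ck_partial[of "Suc m" i] by simp
  then show ?thesis by (simp add: partial_def[of j "partial i \<phi>", abs_def])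
qed

lemma continuous_param: "continuous_on U \<phi>"
  and continuous_partial: "continuous_on U (partial i \<phi>)"
  and continuous_partial2: "continuous_on U (partial j (partial i \<phi>))"
  using Ck_param[of 0] Ck_partial[of 0] Ck_partial2[of 0] by simp_all

lemma param_derivative: "u \<in> U \<Longrightarrow> (\<phi> has_derivative frechet_derivative \<phi> (at u)) (at u)"
  using Ck_param[of 1] frechet_derivative_works by auto

lemma partial_derivative: "u \<in> U \<Longrightarrow>
    (partial i \<phi> has_derivative frechet_derivative (partial i \<phi>) (at u)) (at u)"
  using Ck_partial[of 1 i] frechet_derivative_works by auto

lemma frechet_derivative_expand:
  assumes "u \<in> U"
  shows "frechet_derivative \<phi> (at u) v = (\<Sum>i\<in>UNIV. v $ i *\<^sub>R partial i \<phi> u)"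
proof -
  interpret bounded_linear "frechet_derivative \<phi> (at u)"
    using has_derivative_bounded_linear[OF param_derivative[OF assms]] .
  have "v = (\<Sum>i\<in>UNIV. v $ i *\<^sub>R axis i 1)"
    by (simp add: vec_eq_iff axis_def if_distrib cong: if_cong)
  then have "frechet_derivative \<phi> (at u) v = frechet_derivative \<phi> (at u) (\<Sum>i\<in>UNIV. v $ i *\<^sub>R axis i 1)"
    by simp
  then show ?thesis by (simp add: sum scaleR partial_def)
qed

lemma partial_commute:
  assumes "u \<in> U"
  shows "partial j (partial i \<phi>) u = partial i (partial j \<phi>) u"
proof (rule euclidean_eqI)
  fix b :: "real \<times> 'y" assume "b \<in> Basis"
  have *: "((\<lambda>t. f (x + t *\<^sub>R v) \<bullet> b) has_real_derivative frechet_derivative f (at x) v \<bullet> b) (at 0)"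
    if "(f has_derivative frechet_derivative f (at x)) (at x)" for f :: "real ^ 'k \<Rightarrow> real \<times> 'y" and x v
    using has_real_derivative_along_line[OF has_derivative_inner_left[OF that, of b], of v] by simp
  show "partial j (partial i \<phi>) u \<bullet> b = partial i (partial j \<phi>) u \<bullet> b"
  proof (rule mixed_partial_derivatives_eq[OF open_U assms, where f = "\<lambda>u. \<phi> u \<bullet> b"
        and a = "axis i 1" and b = "axis j 1"
        and fa = "\<lambda>u. partial i \<phi> u \<bullet> b" and fb = "\<lambda>u. partial j \<phi> u \<bullet> b"])
    fix x assume x: "x \<in> U"
    show "((\<lambda>t. \<phi> (x + t *\<^sub>R axis i 1) \<bullet> b) has_real_derivative partial i \<phi> x \<bullet> b) (at 0)" for i
      using *[OF param_derivative[OF x]] by (simp add: partial_def)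
    then show "((\<lambda>t. \<phi> (x + t *\<^sub>R axis j 1) \<bullet> b) has_real_derivative partial j \<phi> x \<bullet> b) (at 0)" .
    show "((\<lambda>t. partial i \<phi> (x + t *\<^sub>R axis j 1) \<bullet> b) has_real_derivative partial j (partial i \<phi>) x \<bullet> b) (at 0)" for i j
      using *[OF partial_derivative[OF x]] by (simp add: partial_def[of j "partial i \<phi>"])
    then show "((\<lambda>t. partial j \<phi> (x + t *\<^sub>R axis i 1) \<bullet> b) has_real_derivative partial i (partial j \<phi>) x \<bullet> b) (at 0)" .
  qed (intro continuous_intros continuous_partial2)+
qed

lemma height_pos: "u \<in> U \<Longrightarrow> 0 < fst (\<phi> u)"
  using half by (auto simp: half_space_def)

lemma gram_nth: "gram \<phi> u $ i $ j = (partial i \<phi> u \<bullet> partial j \<phi> u) / (fst (\<phi> u))\<^sup>2"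
  by (simp add: gram_def hyp_metric_def)

lemma gram_sym: "gram \<phi> u $ i $ j = gram \<phi> u $ j $ i"
  by (simp add: gram_nth inner_commute)

text \<open>Identifies the Gram form with the pulled-back norm, so that injectivity of the
  differential becomes positive definiteness.\<close>

lemma gram_quadratic:
  assumes "u \<in> U"
  shows "v \<bullet> (gram \<phi> u *v v) = (norm (frechet_derivative \<phi> (at u) v))\<^sup>2 / (fst (\<phi> u))\<^sup>2"
  by (simp add: frechet_derivative_expand[OF assms] power2_norm_eq_inner inner_sum_left inner_sum_right
      inner_vec_def matrix_vector_mult_def gram_nth sum_divide_distrib sum_distrib_left mult_ac)
    (intro sum.cong refl, simp add: inner_commute)

lemma det_gram_pos:
  assumes "u \<in> U"
  shows "0 < det (gram \<phi> u)"
proof (rule det_pos_if_pos_def)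
  fix v :: "real ^ 'k" assume "v \<noteq> 0"
  then have "frechet_derivative \<phi> (at u) v \<noteq> 0"
    using inj_deriv[OF assms] has_derivative_bounded_linear[OF param_derivative[OF assms]]
    by (metis injD linear_simps(3))
  then show "0 < v \<bullet> (gram \<phi> u *v v)"
    using height_pos[OF assms] by (simp add: gram_quadratic[OF assms])
qed

lemma gram_inverse:
  assumes "u \<in> U"
  shows "matrix_inv (gram \<phi> u) ** gram \<phi> u = mat 1" "gram \<phi> u ** matrix_inv (gram \<phi> u) = mat 1"
proof -
  have "invertible (gram \<phi> u)" using det_gram_pos[OF assms] by (simp add: invertible_det_nz)
  then show "matrix_inv (gram \<phi> u) ** gram \<phi> u = mat 1" "gram \<phi> u ** matrix_inv (gram \<phi> u) = mat 1"
    unfolding invertible_def matrix_inv_def by (metis (mono_tags, lifting) someI_ex)+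
qed

lemma gram_inverse_sym:
  assumes "u \<in> U"
  shows "matrix_inv (gram \<phi> u) $ i $ j = matrix_inv (gram \<phi> u) $ j $ i"
proof -
  let ?G = "gram \<phi> u" and ?I = "matrix_inv (gram \<phi> u)"
  have tG: "transpose ?G = ?G" by (simp add: vec_eq_iff transpose_def gram_sym)
  have "transpose ?I ** ?G = transpose (?G ** ?I)" by (simp add: matrix_transpose_mul tG)
  then have "transpose ?I ** ?G = mat 1" by (simp add: gram_inverse[OF assms] transpose_mat)
  then have "(transpose ?I ** ?G) ** ?I = ?I" by simp
  then have "transpose ?I = ?I" by (simp add: matrix_mul_assoc[symmetric] gram_inverse[OF assms])
  from arg_cong[OF this, of "\<lambda>M. M $ j $ i"] show ?thesis by (simp add: transpose_def)
qed

lemma continuous_height: "continuous_on U (\<lambda>u. fst (\<phi> u))"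
  by (intro continuous_intros continuous_param)

lemma continuous_gram: "continuous_on U (\<lambda>u. gram \<phi> u $ i $ j)"
  unfolding gram_nth
  by (intro continuous_intros continuous_partial continuous_height) (use height_pos in force)

lemma continuous_gram_inv: "continuous_on U (\<lambda>u. matrix_inv (gram \<phi> u) $ i $ j)"
  by (intro continuous_on_matrix_inv continuous_gram) (use det_gram_pos in force)

lemma continuous_density: "continuous_on U (\<lambda>u. sqrt (det (gram \<phi> u)))"
  by (intro continuous_intros continuous_on_det continuous_gram)

text \<open>Components of the gradient of the height with respect to the induced hyperbolic
  metric.\<close>

definition tcoord :: "'k \<Rightarrow> real ^ 'k \<Rightarrow> real" where
  "tcoord c u = (\<Sum>j\<in>UNIV. matrix_inv (gram \<phi> u) $ c $ j * fst (partial j \<phi> u))"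

lemma continuous_tcoord: "continuous_on U (tcoord c)"
  unfolding tcoord_def by (intro continuous_intros continuous_gram_inv continuous_partial)

lemma fst_normal_part:
  assumes "u \<in> U"
  shows "fst (normal_part \<phi> u v) = fst v - (\<Sum>b\<in>UNIV. hyp_metric (\<phi> u) v (partial b \<phi> u) * tcoord b u)"
proof -
  have "fst (normal_part \<phi> u v) = fst v - (\<Sum>i\<in>UNIV. \<Sum>j\<in>UNIV.
     (matrix_inv (gram \<phi> u) $ i $ j * hyp_metric (\<phi> u) v (partial j \<phi> u)) * fst (partial i \<phi> u))"
    by (simp add: normal_part_def fst_sum)
  also have "(\<Sum>i\<in>UNIV. \<Sum>j\<in>UNIV.
     (matrix_inv (gram \<phi> u) $ i $ j * hyp_metric (\<phi> u) v (partial j \<phi> u)) * fst (partial i \<phi> u))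
     = (\<Sum>b\<in>UNIV. hyp_metric (\<phi> u) v (partial b \<phi> u) * tcoord b u)"
    unfolding tcoord_def sum_distrib_left
    by (subst sum.swap) (intro sum.cong refl, simp add: gram_inverse_sym[OF assms] mult_ac)
  finally show ?thesis .
qed

lemma vertical_tangent_eq:
  assumes "u \<in> U"
  shows "vertical_tangent \<phi> u = (\<Sum>c\<in>UNIV. (tcoord c u / (fst (\<phi> u))\<^sup>2) *\<^sub>R partial c \<phi> u)"
proof -
  have "(1, 0) \<bullet> (w :: real \<times> 'y) = fst w" for w by (cases w) simp
  then show ?thesis
    by (simp add: vertical_tangent_def normal_part_def tcoord_def hyp_metric_def
        scaleR_sum_left[symmetric] sum_divide_distrib)
qed

lemma continuous_vertical_tangent: "continuous_on U (vertical_tangent \<phi>)"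
proof -
  have "continuous_on U (\<lambda>u. \<Sum>c\<in>UNIV. (tcoord c u / (fst (\<phi> u))\<^sup>2) *\<^sub>R partial c \<phi> u)"
    by (intro continuous_intros continuous_tcoord continuous_partial continuous_height) (use height_pos in force)
  then show ?thesis
    by (rule continuous_on_eq) (simp add: vertical_tangent_eq)
qed

lemma gram_tcoord:
  assumes "u \<in> U"
  shows "(\<Sum>b\<in>UNIV. gram \<phi> u $ j $ b * tcoord b u) = fst (partial j \<phi> u)"
proof -
  have inv: "(\<Sum>b\<in>UNIV. gram \<phi> u $ j $ b * matrix_inv (gram \<phi> u) $ b $ l) = (if j = l then 1 else 0)" for l
    using arg_cong[OF gram_inverse(2)[OF assms], of "\<lambda>M. M $ j $ l"] by (simp add: matrix_matrix_mult_def mat_def)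
  have "(\<Sum>b\<in>UNIV. gram \<phi> u $ j $ b * tcoord b u)
      = (\<Sum>l\<in>UNIV. (\<Sum>b\<in>UNIV. gram \<phi> u $ j $ b * matrix_inv (gram \<phi> u) $ b $ l) * fst (partial l \<phi> u))"
    unfolding tcoord_def sum_distrib_left sum_distrib_right by (subst sum.swap) (simp add: mult.assoc)
  then show ?thesis by (simp add: inv if_distrib[of "\<lambda>z. z * _"] cong: if_cong)
qed

text \<open>The metric is conformal to the flat one, so both have the same tangential projection:
  \<open>vertical_tangent\<close> is the tangent vector with the same Euclidean products as
  \<open>(1, 0)\<close> against all tangent vectors.\<close>

lemma vertical_tangent_inner:
  assumes "u \<in> U"
  shows "vertical_tangent \<phi> u \<bullet> partial j \<phi> u = fst (partial j \<phi> u)"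
proof -
  have "vertical_tangent \<phi> u \<bullet> partial j \<phi> u = (\<Sum>c\<in>UNIV. gram \<phi> u $ j $ c * tcoord c u)"
    unfolding vertical_tangent_eq[OF assms] inner_sum_left
    by (intro sum.cong refl) (simp add: gram_nth inner_commute)
  then show ?thesis by (simp add: gram_tcoord[OF assms])
qed

text \<open>The height component of \<open>H = 0\<close>; the right-hand side comes from the Christoffel terms.\<close>

lemma minimal_height_identity:
  assumes u: "u \<in> U" and H: "mean_curvature \<phi> u = 0"
  defines "x \<equiv> fst (\<phi> u)"
  shows "(\<Sum>i\<in>UNIV. \<Sum>j\<in>UNIV. matrix_inv (gram \<phi> u) $ i $ j *
      (fst (partial i (partial j \<phi>) u) -
       (\<Sum>b\<in>UNIV. (partial i (partial j \<phi>) u \<bullet> partial b \<phi> u) / x\<^sup>2 * tcoord b u)))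
    = - real CARD('k) * (x - (\<Sum>c\<in>UNIV. fst (partial c \<phi> u) * tcoord c u) / x)"
    (is "(\<Sum>i\<in>UNIV. \<Sum>j\<in>UNIV. ?I i j * ?N i j) = _")
proof -
  let ?e = "\<lambda>i. partial i \<phi> u" and ?G = "\<lambda>i j. gram \<phi> u $ i $ j"
  define P where "P = (\<Sum>c\<in>UNIV. fst (?e c) * tcoord c u)"
  have x: "x > 0" using height_pos[OF u] by (simp add: x_def)
  have N1: "fst (normal_part \<phi> u (v + w)) = fst (normal_part \<phi> u v) + fst (normal_part \<phi> u w)" for v w
    by (simp add: fst_normal_part[OF u] hyp_metric_def inner_add_left add_divide_distrib distrib_right sum.distrib)
  have e: "(r, 0) \<bullet> (w :: real \<times> 'y) = r * fst w" for r w by (cases w) simp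
  \<comment> \<open>Two of the three Christoffel terms are tangent and are projected away. What
    remains is a multiple of the Gram matrix, whose trace against the inverse is the
    dimension.\<close>
  have N2: "fst (normal_part \<phi> u (christoffel (\<phi> u) (?e i) (?e j))) = ?G i j * (x - P / x)" for i j
  proof -
    have G: "?e i \<bullet> ?e j = x\<^sup>2 * ?G i j" for i j using x by (simp add: gram_nth x_def)
    have 1: "hyp_metric (\<phi> u) (christoffel (\<phi> u) (?e i) (?e j)) (?e b)
        = - (fst (?e i) * ?G j b + fst (?e j) * ?G i b) / x + ?G i j * fst (?e b) / x" for b
      using x
      by (simp add: hyp_metric_def christoffel_def inner_diff_left inner_add_left e G x_def[symmetric]
          field_simps power2_eq_square)
    have 2: "fst (christoffel (\<phi> u) (?e i) (?e j)) = - 2 * fst (?e i) * fst (?e j) / x + x * ?G i j"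
      using x by (simp add: christoffel_def G x_def[symmetric] field_simps power2_eq_square)
    have "(\<Sum>b\<in>UNIV. (- (fst (?e i) * ?G j b + fst (?e j) * ?G i b) / x + ?G i j * fst (?e b) / x) * tcoord b u)
       = - (fst (?e i) * (\<Sum>b\<in>UNIV. ?G j b * tcoord b u) + fst (?e j) * (\<Sum>b\<in>UNIV. ?G i b * tcoord b u)) / x
         + ?G i j * P / x"
      unfolding P_def sum_distrib_left sum_divide_distrib sum.distrib[symmetric] sum_negf[symmetric]
      by (intro sum.cong refl) (simp add: field_simps)
    then show ?thesis
      unfolding fst_normal_part[OF u] 1 2 gram_tcoord[OF u] using x by (simp add: field_simps)
  qed
  have "0 = fst (mean_curvature \<phi> u)" by (simp add: H)
  also have "\<dots> = (\<Sum>i\<in>UNIV. \<Sum>j\<in>UNIV. ?I i j * (?N i j + ?G i j * (x - P / x)))"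
    by (simp add: mean_curvature_def second_fundamental_form_def fst_sum N1 N2)
       (simp add: fst_normal_part[OF u] hyp_metric_def x_def[symmetric])
  also have "\<dots> = (\<Sum>i\<in>UNIV. \<Sum>j\<in>UNIV. ?I i j * ?N i j) + (\<Sum>i\<in>UNIV. \<Sum>j\<in>UNIV. ?I i j * ?G i j) * (x - P / x)"
    by (simp add: distrib_left sum.distrib sum_distrib_right mult.assoc)
  also have "(\<Sum>i\<in>UNIV. \<Sum>j\<in>UNIV. ?I i j * ?G i j) = real CARD('k)"
  proof -
    have "(\<Sum>j\<in>UNIV. ?I i j * ?G j i) = 1" for i
      using arg_cong[OF gram_inverse(1)[OF u], of "\<lambda>M. M $ i $ i"] by (simp add: matrix_matrix_mult_def mat_def)
    moreover have "(\<Sum>j\<in>UNIV. ?I i j * ?G i j) = (\<Sum>j\<in>UNIV. ?I i j * ?G j i)" for i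
      by (intro sum.cong refl arg_cong2[where f = "(*)"] gram_sym)
    ultimately show ?thesis by simp
  qed
  finally show ?thesis by (simp add: P_def)
qed

end

text \<open>The set \<open>U\<close> and the complement of \<open>C\<close> are open and cover the
  space, and the extended function is continuous on each.\<close>

lemma continuous_on_zero_extension:
  fixes f :: "'a::t2_space \<Rightarrow> real"
  assumes "open U" "compact C" "C \<subseteq> U" "continuous_on U f" "\<And>u. u \<in> U - C \<Longrightarrow> f u = 0"
  shows "continuous_on UNIV (\<lambda>u. indicator U u * f u)"
proof -
  have "continuous_on U (\<lambda>u. indicator U u * f u)"
    by (rule continuous_on_eq[OF assms(4)]) simp
  moreover have "continuous_on (- C) (\<lambda>u. indicator U u * f u)"
    by (rule continuous_on_eq[of _ "\<lambda>_. 0"]) (use assms(5) in \<open>auto simp: indicator_def\<close>)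
  moreover have "open (- C)" using assms(2) by (simp add: compact_imp_closed open_Compl)
  ultimately have "continuous_on (U \<union> - C) (\<lambda>u. indicator U u * f u)"
    using assms(1) by (intro continuous_on_open_Un)
  moreover have "U \<union> - C = UNIV" using assms(3) by auto
  ultimately show ?thesis by simp
qed

text \<open>Expanding \<open>v p\<close> in the basis reduces the claim to finitely many fixed
  directions, the form in which continuity of derivatives is recorded in the sequel.\<close>

lemma continuous_on_linear_family:
  fixes \<omega>' :: "'p::topological_space \<Rightarrow> 'a::euclidean_space \<Rightarrow> real"
  assumes "\<And>b. continuous_on S (\<lambda>p. \<omega>' p b)" "continuous_on S v"
    and "\<And>p. p \<in> S \<Longrightarrow> linear (\<omega>' p)"
  shows "continuous_on S (\<lambda>p. \<omega>' p (v p))"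
proof -
  have "continuous_on S (\<lambda>p. \<Sum>b\<in>Basis. (v p \<bullet> b) * \<omega>' p b)"
    by (intro continuous_intros assms)
  then show ?thesis
  proof (rule continuous_on_eq)
    fix p assume "p \<in> S"
    then interpret linear "\<omega>' p" by (rule assms(3))
    show "(\<Sum>b\<in>Basis. (v p \<bullet> b) * \<omega>' p b) = \<omega>' p (v p)"
      by (subst (2) euclidean_representation[of "v p", symmetric]) (simp add: sum scale)
  qed
qed

section \<open>Derivatives along coordinate lines and the Laplacian of the height\<close>

context immersion
begin

definition gram_deriv :: "'k \<Rightarrow> real ^ 'k \<Rightarrow> real ^ 'k ^ 'k" where
  "gram_deriv c u = (\<chi> i j.
     (partial c (partial i \<phi>) u \<bullet> partial j \<phi> u + partial i \<phi> u \<bullet> partial c (partial j \<phi>) u) / (fst (\<phi> u))\<^sup>2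
     - 2 * (fst (partial c \<phi> u) / fst (\<phi> u)) * gram \<phi> u $ i $ j)"

lemma line_height: "u \<in> U \<Longrightarrow>
    ((\<lambda>t. fst (\<phi> (u + t *\<^sub>R axis c 1))) has_real_derivative fst (partial c \<phi> u)) (at 0)"
  using has_real_derivative_along_line[OF has_derivative_fst[OF param_derivative]]
  by (simp add: partial_def)

lemma line_fst_partial: "u \<in> U \<Longrightarrow>
    ((\<lambda>t. fst (partial j \<phi> (u + t *\<^sub>R axis c 1))) has_real_derivative fst (partial c (partial j \<phi>) u)) (at 0)"
  using has_real_derivative_along_line[OF has_derivative_fst[OF partial_derivative]]
  by (simp add: partial_def[of c "partial j \<phi>"])

lemma line_gram:
  assumes "u \<in> U"
  shows "((\<lambda>t. gram \<phi> (u + t *\<^sub>R axis c 1) $ i $ j) has_real_derivative gram_deriv c u $ i $ j) (at 0)"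
proof -
  have 1: "((\<lambda>t. partial i \<phi> (u + t *\<^sub>R axis c 1) \<bullet> partial j \<phi> (u + t *\<^sub>R axis c 1)) has_real_derivative
      (partial i \<phi> u \<bullet> partial c (partial j \<phi>) u + partial c (partial i \<phi>) u \<bullet> partial j \<phi> u)) (at 0)"
    using has_real_derivative_along_line[OF has_derivative_inner[OF partial_derivative[OF assms, of i] partial_derivative[OF assms, of j]], of "axis c 1"]
    by (simp add: partial_def[of c "partial _ \<phi>"])
  have x: "fst (\<phi> u) \<noteq> 0" using height_pos[OF assms] by simp
  have 2: "((\<lambda>t. (fst (\<phi> (u + t *\<^sub>R axis c 1)))\<^sup>2) has_real_derivative 2 * fst (\<phi> u) * fst (partial c \<phi> u)) (at 0)"
    using DERIV_power[OF line_height[OF assms], where n = 2] by (simp add: mult_ac)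
  show ?thesis
    unfolding gram_nth
    by (rule DERIV_cong[OF DERIV_divide[OF 1 2]])
      (use x in \<open>simp_all add: gram_deriv_def gram_nth field_simps power2_eq_square\<close>)
qed

definition density :: "real ^ 'k \<Rightarrow> real" where
  "density u = sqrt (det (gram \<phi> u))"

lemma line_density:
  assumes "u \<in> U"
  shows "((\<lambda>t. density (u + t *\<^sub>R axis c 1)) has_real_derivative
    density u * (1/2 * (\<Sum>i\<in>UNIV. \<Sum>j\<in>UNIV. gram_deriv c u $ i $ j * matrix_inv (gram \<phi> u) $ j $ i))) (at 0)"
proof -
  let ?tr = "\<Sum>i\<in>UNIV. \<Sum>j\<in>UNIV. gram_deriv c u $ i $ j * matrix_inv (gram \<phi> u) $ j $ i"
  have 1: "((\<lambda>t. det (gram \<phi> (u + t *\<^sub>R axis c 1))) has_real_derivative det (gram \<phi> u) * ?tr) (at 0)"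
    using has_real_derivative_det[of "\<lambda>t. gram \<phi> (u + t *\<^sub>R axis c 1)" "gram_deriv c u" 0 "matrix_inv (gram \<phi> u)"]
      line_gram[OF assms] gram_inverse[OF assms] by simp
  have pos: "det (gram \<phi> u) > 0" by (rule det_gram_pos[OF assms])
  have "((\<lambda>t. sqrt (det (gram \<phi> (u + t *\<^sub>R axis c 1)))) has_real_derivative
      (inverse (sqrt (det (gram \<phi> u))) / 2) * (det (gram \<phi> u) * ?tr)) (at 0)"
  proof -
    have "DERIV sqrt (det (gram \<phi> (u + 0 *\<^sub>R axis c 1))) :> inverse (sqrt (det (gram \<phi> u))) / 2"
      using DERIV_real_sqrt[OF pos] by simp
    from DERIV_chain2[OF this 1] show ?thesis .
  qed
  moreover have "(inverse (sqrt (det (gram \<phi> u))) / 2) * (det (gram \<phi> u) * ?tr)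
      = density u * (1/2 * ?tr)"
  proof -
    have "inverse (sqrt (det (gram \<phi> u))) * det (gram \<phi> u) = density u"
      using real_div_sqrt[of "det (gram \<phi> u)"] pos by (simp add: density_def divide_inverse mult.commute)
    moreover have "(inverse (sqrt (det (gram \<phi> u))) / 2) * (det (gram \<phi> u) * ?tr)
        = (inverse (sqrt (det (gram \<phi> u))) * det (gram \<phi> u)) * (1/2 * ?tr)"
      by simp
    ultimately show ?thesis by (simp only:)
  qed
  ultimately show ?thesis unfolding density_def by (simp only:)
qed

definition tcoord_deriv :: "'k \<Rightarrow> real ^ 'k \<Rightarrow> real" where
  "tcoord_deriv c u = (\<Sum>j\<in>UNIV.
     - (\<Sum>a\<in>UNIV. \<Sum>b\<in>UNIV. matrix_inv (gram \<phi> u) $ c $ a * gram_deriv c u $ a $ b * matrix_inv (gram \<phi> u) $ b $ j)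
        * fst (partial j \<phi> u)
     + matrix_inv (gram \<phi> u) $ c $ j * fst (partial c (partial j \<phi>) u))"

lemma line_tcoord:
  assumes "u \<in> U"
  shows "((\<lambda>t. tcoord c (u + t *\<^sub>R axis c 1)) has_real_derivative tcoord_deriv c u) (at 0)"
proof -
  have "((\<lambda>t. matrix_inv (gram \<phi> (u + t *\<^sub>R axis c 1)) $ c $ j) has_real_derivative
     - (\<Sum>a\<in>UNIV. \<Sum>b\<in>UNIV. matrix_inv (gram \<phi> u) $ c $ a * gram_deriv c u $ a $ b * matrix_inv (gram \<phi> u) $ b $ j)) (at 0)" for j
  proof -
    have "(matrix_inv (gram \<phi> u) ** gram_deriv c u ** matrix_inv (gram \<phi> u)) $ c $ j
      = (\<Sum>a\<in>UNIV. \<Sum>b\<in>UNIV. matrix_inv (gram \<phi> u) $ c $ a * gram_deriv c u $ a $ b * matrix_inv (gram \<phi> u) $ b $ j)"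
      by (subst sum.swap) (simp add: matrix_matrix_mult_def sum_distrib_right)
    moreover have "det (gram \<phi> u) \<noteq> 0" using det_gram_pos[OF assms] by simp
    ultimately show ?thesis
      using has_real_derivative_matrix_inv[of "\<lambda>t. gram \<phi> (u + t *\<^sub>R axis c 1)" "gram_deriv c u" 0 c j]
        line_gram[OF assms] by simp
  qed
  then show ?thesis
    unfolding tcoord_def tcoord_deriv_def
    by (intro DERIV_sum DERIV_cong[OF DERIV_mult[OF _ line_fst_partial[OF assms]]]) auto
qed

text \<open>The left-hand side is the divergence of the gradient of \<open>x\<close>, so this reads
  \<open>Delta x = - k x + 2 |grad x|^2 / x\<close> on a minimal submanifold. It is equivalent to
  \<open>Delta (1/x) = k / x\<close>.\<close>

lemma tcoord_divergence:
  assumes u: "u \<in> U" and H: "mean_curvature \<phi> u = 0"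
  shows "(\<Sum>c\<in>UNIV. (1/2) * (\<Sum>i\<in>UNIV. \<Sum>j\<in>UNIV. gram_deriv c u $ i $ j * matrix_inv (gram \<phi> u) $ j $ i) * tcoord c u
          + tcoord_deriv c u)
      = - real CARD('k) * fst (\<phi> u) + 2 * (\<Sum>c\<in>UNIV. fst (partial c \<phi> u) * tcoord c u) / fst (\<phi> u)"
proof -
  let ?\<Gamma> = "\<lambda>a b c. (partial a (partial b \<phi>) u \<bullet> partial c \<phi> u) / (fst (\<phi> u))\<^sup>2"
  define x where "x = fst (\<phi> u)"
  have x: "x > 0" using height_pos[OF u] by (simp add: x_def)
  have sym\<Gamma>: "?\<Gamma> a b c = ?\<Gamma> b a c" for a b c
    by (simp only: partial_commute[OF u, of a b])
  have dG: "gram_deriv c u $ i $ j = ?\<Gamma> c i j + ?\<Gamma> c j i - 2 * (fst (partial c \<phi> u) / fst (\<phi> u)) * gram \<phi> u $ i $ j" for c i j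
    by (simp add: gram_deriv_def inner_commute[of "partial i \<phi> u" "partial c (partial j \<phi>) u"] add_divide_distrib)
  show ?thesis
    unfolding tcoord_deriv_def
      divergence_identity[where \<Gamma> = ?\<Gamma>, OF gram_inverse(1)[OF u] gram_inverse_sym[OF u] sym\<Gamma> dG gram_sym tcoord_def
        minimal_height_identity[OF u H]]
    unfolding x_def[symmetric] using x by (simp add: field_simps)
qed

end

context immersion
begin

lemma density_pos: "u \<in> U \<Longrightarrow> 0 < density u"
  using det_gram_pos by (simp add: density_def)

lemma continuous_on_density: "continuous_on U density"
  using continuous_density by (simp add: density_def[abs_def])

lemma continuous_gram_deriv: "continuous_on U (\<lambda>u. gram_deriv c u $ i $ j)"
  unfolding gram_deriv_def vec_lambda_beta
  by (intro continuous_intros continuous_gram continuous_partial2 continuous_partial continuous_height)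
    (use height_pos in force)+

lemma continuous_tcoord_deriv: "continuous_on U (tcoord_deriv c)"
  unfolding tcoord_deriv_def[abs_def]
  by (intro continuous_intros continuous_gram_inv continuous_gram_deriv continuous_partial2 continuous_partial)

text \<open>The divergence theorem in one chart, for the field \<open>\<omega> \<nabla>(1/x)\<close>.\<close>

lemma integral_divergence:
  fixes \<omega> :: "real \<times> 'y \<Rightarrow> real"
  assumes H: "\<And>u. u \<in> U \<Longrightarrow> mean_curvature \<phi> u = 0"
    and \<omega>: "\<And>p. p \<in> \<phi> ` U \<Longrightarrow> (\<omega> has_derivative \<omega>' p) (at p)"
    and cont: "\<And>v. continuous_on (\<phi> ` U) (\<lambda>p. \<omega>' p v)"
    and C: "compact C" "C \<subseteq> U"
    and supp: "\<And>u. u \<in> U - C \<Longrightarrow> \<omega> (\<phi> u) = 0" "\<And>u v. u \<in> U - C \<Longrightarrow> \<omega>' (\<phi> u) v = 0"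
  shows "(\<integral>u. indicator U u * (density u *
      (- real CARD('k) * \<omega> (\<phi> u) / fst (\<phi> u) + \<omega>' (\<phi> u) (vertical_tangent \<phi> u))) \<partial>lborel) = 0"
proof -
  \<comment> \<open>The density times the components of \<open>- \<omega> \<nabla>(1/x)\<close>. The
    sign makes the divergence equal to \<open>- k \<omega> / x\<close> plus the derivative of
    \<open>\<omega>\<close> along \<open>vertical_tangent\<close>.\<close>
  define flux where "flux c u = density u * tcoord c u * \<omega> (\<phi> u) / (fst (\<phi> u))\<^sup>2" for c u
  define A where "A c u = 1/2 * (\<Sum>i\<in>UNIV. \<Sum>j\<in>UNIV. gram_deriv c u $ i $ j * matrix_inv (gram \<phi> u) $ j $ i)" for c u
  define dflux where "dflux c u = density u *
     ((A c u * tcoord c u + tcoord_deriv c u) * \<omega> (\<phi> u) / (fst (\<phi> u))\<^sup>2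
      + tcoord c u * \<omega>' (\<phi> u) (partial c \<phi> u) / (fst (\<phi> u))\<^sup>2
      - 2 * (fst (partial c \<phi> u) * tcoord c u) * \<omega> (\<phi> u) / (fst (\<phi> u))^3)" for c u
  have x: "fst (\<phi> u) > 0" if "u \<in> U" for u using height_pos[OF that] .
  have lin: "linear (\<omega>' (\<phi> u))" if "u \<in> U" for u
    using has_derivative_linear[OF \<omega>] that by blast
  have line_\<omega>: "((\<lambda>t. \<omega> (\<phi> (u + t *\<^sub>R axis c 1))) has_real_derivative \<omega>' (\<phi> u) (partial c \<phi> u)) (at 0)"
    if "u \<in> U" for u c
    using has_real_derivative_along_line[OF has_derivative_compose[OF param_derivative[OF that] \<omega>], of "axis c 1"] that
    by (simp add: partial_def)
  have cont_\<omega>: "continuous_on U (\<lambda>u. \<omega> (\<phi> u))"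
    by (intro continuous_on_compose2[OF _ continuous_param subset_refl] continuous_at_imp_continuous_on ballI
        has_derivative_continuous[OF \<omega>])
  have cont_\<omega>': "continuous_on U (\<lambda>u. \<omega>' (\<phi> u) (v u))" if "continuous_on U v" for v
    by (rule continuous_on_linear_family[OF _ that lin])
       (rule continuous_on_compose2[OF cont continuous_param subset_refl])
  have line_flux: "((\<lambda>t. flux c (u + t *\<^sub>R axis c 1)) has_real_derivative dflux c u) (at 0)" if u: "u \<in> U" for c u
  proof -
    have x2: "((\<lambda>t. (fst (\<phi> (u + t *\<^sub>R axis c 1)))\<^sup>2) has_real_derivative 2 * fst (\<phi> u) * fst (partial c \<phi> u)) (at 0)"
      using DERIV_power[OF line_height[OF u], where n = 2] by (simp add: mult_ac)
    show ?thesis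
      unfolding flux_def
      by (rule DERIV_cong[OF DERIV_divide[OF DERIV_mult[OF DERIV_mult[OF line_density[OF u] line_tcoord[OF u]] line_\<omega>[OF u]] x2]])
        (use x[OF u] in \<open>simp_all add: dflux_def A_def field_simps power2_eq_square power3_eq_cube\<close>)
  qed
  have cont_flux: "continuous_on U (flux c)" for c
    unfolding flux_def
    by (intro continuous_intros continuous_on_density continuous_tcoord cont_\<omega> continuous_height) (use x in force)
  have cont_A: "continuous_on U (A c)" for c
    unfolding A_def[abs_def] by (intro continuous_intros continuous_gram_deriv continuous_gram_inv)
  have cont_x: "continuous_on U (\<lambda>u. 1 / (fst (\<phi> u)) ^ n)" for n
    by (intro continuous_intros continuous_height) (use x in force)
  have cont_dflux: "continuous_on U (dflux c)" for c
  proof -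
    have "dflux c = (\<lambda>u. density u *
       ((A c u * tcoord c u + tcoord_deriv c u) * \<omega> (\<phi> u) * (1 / fst (\<phi> u) ^ 2)
        + tcoord c u * \<omega>' (\<phi> u) (partial c \<phi> u) * (1 / fst (\<phi> u) ^ 2)
        - 2 * (fst (partial c \<phi> u) * tcoord c u) * \<omega> (\<phi> u) * (1 / fst (\<phi> u) ^ 3)))"
      by (simp add: dflux_def[abs_def])
    moreover have "continuous_on U \<dots>"
      by (intro continuous_on_mult continuous_on_add continuous_on_diff continuous_on_const continuous_on_fst
          continuous_on_density continuous_tcoord cont_\<omega> cont_\<omega>'[OF continuous_partial] continuous_partial
          continuous_tcoord_deriv cont_A cont_x)
    ultimately show ?thesis by simp
  qed
  have zero: "flux c u = 0" "dflux c u = 0" if "u \<in> U - C" for c u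
    using supp[OF that] by (simp_all add: flux_def dflux_def)
  have int_dflux: "(\<integral>u. indicator U u * dflux c u \<partial>lborel) = 0" for c
  proof (rule integral_directional_derivative_eq_0[where C = C and X = "\<lambda>u. indicator U u * flux c u" and c = "axis c 1"])
    show "indicator U u * flux c u = 0" "indicator U u * dflux c u = 0" if "u \<notin> C" for u
      using zero[of u c] that by (auto simp: indicator_def)
    show "continuous_on UNIV (\<lambda>u. indicator U u * flux c u)" "continuous_on UNIV (\<lambda>u. indicator U u * dflux c u)"
      using zero by (auto intro!: continuous_on_zero_extension[OF open_U C] cont_flux cont_dflux)
    show "((\<lambda>t. indicator U (u + t *\<^sub>R axis c 1) * flux c (u + t *\<^sub>R axis c 1)) has_real_derivative indicator U u * dflux c u) (at 0)" for u
    proof -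
      have tends: "((\<lambda>t. u + t *\<^sub>R axis c 1) \<longlongrightarrow> u) (nhds (0::real))"
      proof -
        have "isCont (\<lambda>t. u + t *\<^sub>R axis c 1) (0::real)" by (intro continuous_intros)
        then show ?thesis
          using tendsto_at_iff_tendsto_nhds[of "\<lambda>t. u + t *\<^sub>R axis c 1" "0::real"] by (simp add: isCont_def)
      qed
      show ?thesis
      proof (cases "u \<in> U")
        case True
        have "\<forall>\<^sub>F t in nhds (0::real). u + t *\<^sub>R axis c 1 \<in> U"
          using topological_tendstoD[OF tends open_U True] .
        then have "\<forall>\<^sub>F t in nhds (0::real). indicator U (u + t *\<^sub>R axis c 1) * flux c (u + t *\<^sub>R axis c 1) = flux c (u + t *\<^sub>R axis c 1)"
          by eventually_elim simp
        from DERIV_cong_ev[OF refl this refl] line_flux[OF True, of c] True show ?thesis by simp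
      next
        case False
        have "open (- C)" "u \<in> - C" using C False by (auto intro: compact_imp_closed)
        then have "\<forall>\<^sub>F t in nhds (0::real). u + t *\<^sub>R axis c 1 \<in> - C"
          using topological_tendstoD[OF tends] by blast
        then have "\<forall>\<^sub>F t in nhds (0::real). indicator U (u + t *\<^sub>R axis c 1) * flux c (u + t *\<^sub>R axis c 1) = 0"
          by eventually_elim (use zero in \<open>auto simp: indicator_def\<close>)
        from DERIV_cong_ev[OF refl this refl] False show ?thesis by simp
      qed
    qed
  qed (rule C)
  have "integrable lborel (\<lambda>u. indicator U u * dflux c u)" for c
    by (rule continuous_compact_support_integrable[OF continuous_on_zero_extension[OF open_U C cont_dflux] C(1)])
      (use zero in \<open>auto simp: indicator_def\<close>)
  then have "(\<integral>u. (\<Sum>c\<in>UNIV. indicator U u * dflux c u) \<partial>lborel)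
      = (\<Sum>c\<in>UNIV. \<integral>u. indicator U u * dflux c u \<partial>lborel)"
    by (rule Bochner_Integration.integral_sum)
  then have "(\<integral>u. (\<Sum>c\<in>UNIV. indicator U u * dflux c u) \<partial>lborel) = 0"
    by (simp only: int_dflux sum.neutral_const)
  moreover have "(\<Sum>c\<in>UNIV. indicator U u * dflux c u) = indicator U u * (density u *
      (- real CARD('k) * \<omega> (\<phi> u) / fst (\<phi> u) + \<omega>' (\<phi> u) (vertical_tangent \<phi> u)))" for u
  proof (cases "u \<in> U")
    case u: True
    let ?x = "fst (\<phi> u)" and ?P = "\<Sum>c\<in>UNIV. fst (partial c \<phi> u) * tcoord c u"
    interpret linear "\<omega>' (\<phi> u)" by (rule lin[OF u])
    have vt: "\<omega>' (\<phi> u) (vertical_tangent \<phi> u) = (\<Sum>c\<in>UNIV. tcoord c u * \<omega>' (\<phi> u) (partial c \<phi> u) / ?x\<^sup>2)"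
      by (simp add: vertical_tangent_eq[OF u] sum scale)
    have "(\<Sum>c\<in>UNIV. (A c u * tcoord c u + tcoord_deriv c u) * \<omega> (\<phi> u) / ?x\<^sup>2
         + tcoord c u * \<omega>' (\<phi> u) (partial c \<phi> u) / ?x\<^sup>2
         - 2 * (fst (partial c \<phi> u) * tcoord c u) * \<omega> (\<phi> u) / ?x^3)
       = (\<Sum>c\<in>UNIV. A c u * tcoord c u + tcoord_deriv c u) * \<omega> (\<phi> u) / ?x\<^sup>2
         + \<omega>' (\<phi> u) (vertical_tangent \<phi> u) - 2 * ?P * \<omega> (\<phi> u) / ?x^3"
      unfolding vt by (simp add: sum.distrib sum_subtractf sum_distrib_left sum_distrib_right sum_divide_distrib
          distrib_right add_divide_distrib)
    also have "(\<Sum>c\<in>UNIV. A c u * tcoord c u + tcoord_deriv c u) = - real CARD('k) * ?x + 2 * ?P / ?x"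
      unfolding A_def by (rule tcoord_divergence[OF u H[OF u]])
    \<comment> \<open>The terms in \<open>?P\<close>, the squared norm of the gradient of
      \<open>x\<close>, cancel: this is the gain of working with \<open>1/x\<close> instead of
      \<open>x\<close>.\<close>
    also have "(- real CARD('k) * ?x + 2 * ?P / ?x) * \<omega> (\<phi> u) / ?x\<^sup>2
         + \<omega>' (\<phi> u) (vertical_tangent \<phi> u) - 2 * ?P * \<omega> (\<phi> u) / ?x^3
       = - real CARD('k) * \<omega> (\<phi> u) / ?x + \<omega>' (\<phi> u) (vertical_tangent \<phi> u)"
      using x[OF u] by (simp add: field_simps power2_eq_square power3_eq_cube)
    finally show ?thesis
      using u unfolding dflux_def sum_distrib_left[symmetric] by simp
  qed simp
  ultimately show ?thesis by simp
qed

end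

section \<open>Change of variables and transition maps\<close>

text \<open>\<open>has_measure_differentiable_image\<close>, from which the sort
  \<open>wellorder\<close> is inherited, is applied to images of finite measure: the parts of
  \<open>S\<close> mapped into the ball of radius \<open>n\<close> increase to \<open>S\<close>, and
  both sides converge monotonically.\<close>

lemma nn_integral_Jacobian_eq_image:
  fixes g :: "real ^ 'k::{finite,wellorder} \<Rightarrow> real ^ 'k::_"
  assumes S: "S \<in> sets borel"
    and deriv: "\<And>u. u \<in> S \<Longrightarrow> (g has_derivative g' u) (at u within S)"
    and inj: "inj_on g S"
    and gm: "g \<in> borel_measurable (restrict_space borel S)"
    and img: "\<And>A. A \<in> sets borel \<Longrightarrow> A \<subseteq> S \<Longrightarrow> g ` A \<in> sets borel"
    and d: "(\<lambda>u. indicator S u * \<bar>det (matrix (g' u))\<bar>) \<in> borel_measurable borel"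
  shows "(\<integral>\<^sup>+u. ennreal (indicator S u * \<bar>det (matrix (g' u))\<bar>) \<partial>lborel) = emeasure lborel (g ` S)"
proof -
  define M where "M = density lborel (\<lambda>u. ennreal (indicator S u * \<bar>det (matrix (g' u))\<bar>))"
  define S' where "S' n = S \<inter> g -` ball 0 (real n)" for n
  have S': "S' n \<in> sets borel" for n
    using measurable_sets[OF gm, of "ball 0 (real n)"] S
    by (simp add: S'_def space_restrict_space sets_restrict_space_iff Int_commute)
  have S'S: "S' n \<subseteq> S" for n by (auto simp: S'_def)
  have gS': "g ` S' n \<in> sets borel" for n using img[OF S' S'S] .
  have eq: "emeasure M (S' n) = emeasure lborel (g ` S' n)" for n
  proof -
    have bdd: "bounded (g ` S' n)" by (rule bounded_subset[OF bounded_ball[of 0 "real n"]]) (auto simp: S'_def)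
    have lm: "g ` S' n \<in> lmeasurable"
      using gS' bdd by (intro bounded_set_imp_lmeasurable) (auto intro: lborelD)
    have "(g has_derivative g' u) (at u within S' n)" if "u \<in> S' n" for u
      using has_derivative_subset[OF deriv S'S] that S'S by blast
    then have "((\<lambda>u. \<bar>det (matrix (g' u))\<bar>) has_integral measure lebesgue (g ` S' n)) (S' n)"
      using has_measure_differentiable_image[of "S' n" g g' "measure lebesgue (g ` S' n)"] lm S' S'S
        inj_on_subset[OF inj S'S] by (auto intro: lborelD)
    then have "(\<integral>\<^sup>+u. ennreal (indicator (S' n) u * \<bar>det (matrix (g' u))\<bar>) \<partial>lborel) = ennreal (measure lebesgue (g ` S' n))"
      by (intro nn_integral_has_integral_lebesgue) auto
    moreover have "ennreal (measure lebesgue (g ` S' n)) = emeasure lborel (g ` S' n)"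
      using emeasure_bounded_finite[OF bdd] gS'[of n]
      by (simp add: emeasure_eq_ennreal_measure measure_completion)
    moreover have "emeasure M (S' n) = (\<integral>\<^sup>+u. ennreal (indicator (S' n) u * \<bar>det (matrix (g' u))\<bar>) \<partial>lborel)"
      unfolding M_def using S' d S'S[of n]
      by (subst emeasure_density) (auto intro!: nn_integral_cong simp: indicator_def)
    ultimately show ?thesis by simp
  qed
  have incr: "incseq S'" by (auto simp: incseq_def S'_def)
  have UN: "(\<Union>n. S' n) = S"
  proof (intro equalityI subsetI)
    fix u assume "u \<in> S"
    moreover obtain n where "norm (g u) < real n" using reals_Archimedean2 by blast
    ultimately show "u \<in> (\<Union>n. S' n)" by (auto simp: S'_def)
  qed (auto simp: S'_def)
  have "emeasure M S = (SUP n. emeasure M (S' n))"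
    using SUP_emeasure_incseq[of S' M] S' incr UN by (simp add: M_def image_subset_iff)
  also have "\<dots> = (SUP n. emeasure lborel (g ` S' n))" by (simp add: eq)
  also have "\<dots> = emeasure lborel (\<Union>n. g ` S' n)"
    using gS' incr by (intro SUP_emeasure_incseq) (auto simp: incseq_def image_subset_iff, blast)
  also have "(\<Union>n. g ` S' n) = g ` S" using UN by blast
  also have "emeasure M S = (\<integral>\<^sup>+u. ennreal (indicator S u * \<bar>det (matrix (g' u))\<bar>) \<partial>lborel)"
    unfolding M_def using S d
    by (subst emeasure_density) (auto intro!: nn_integral_cong simp: indicator_def)
  finally show ?thesis .
qed

text \<open>The previous identity for all Borel subsets says that \<open>g\<close> pushes Lebesgue
  measure weighted by the Jacobian to Lebesgue measure on the image; \<open>h\<close> is then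
  integrated against both. \<open>g0\<close> extends \<open>g\<close> by 0 to a Borel map on the
  whole space.\<close>

lemma nn_integral_change_of_variables:
  fixes g :: "real ^ 'k::{finite,wellorder} \<Rightarrow> real ^ 'k::_" and h :: "real ^ 'k::_ \<Rightarrow> ennreal"
  assumes S: "S \<in> sets borel"
    and deriv: "\<And>u. u \<in> S \<Longrightarrow> (g has_derivative g' u) (at u within S)"
    and inj: "inj_on g S"
    and gm: "g \<in> borel_measurable (restrict_space borel S)"
    and img: "\<And>A. A \<in> sets borel \<Longrightarrow> A \<subseteq> S \<Longrightarrow> g ` A \<in> sets borel"
    and d: "(\<lambda>u. indicator S u * \<bar>det (matrix (g' u))\<bar>) \<in> borel_measurable borel"
    and h: "h \<in> borel_measurable borel"
  shows "(\<integral>\<^sup>+u. ennreal (indicator S u * \<bar>det (matrix (g' u))\<bar>) * h (g u) \<partial>lborel)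
       = (\<integral>\<^sup>+v. indicator (g ` S) v * h v \<partial>lborel)"
proof -
  define g0 where "g0 u = (if u \<in> S then g u else 0)" for u
  have g0: "g0 \<in> borel_measurable borel"
    using gm S unfolding g0_def by (simp add: measurable_restrict_space_iff)
  let ?D = "\<lambda>u. ennreal (indicator S u * \<bar>det (matrix (g' u))\<bar>)"
  have D: "?D \<in> borel_measurable borel" using d by simp
  have gS: "g ` S \<in> sets borel" by (rule img[OF S subset_refl])
  have "distr (density lborel ?D) borel g0 = density lborel (indicator (g ` S))"
  proof (rule measure_eqI)
    fix A assume "A \<in> sets (distr (density lborel ?D) borel g0)"
    then have A: "A \<in> sets borel" by simp
    define S' where "S' = S \<inter> g -` A"
    have S': "S' \<in> sets borel"
      using measurable_sets[OF gm A] S by (simp add: S'_def space_restrict_space sets_restrict_space_iff Int_commute)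
    have S'S: "S' \<subseteq> S" by (auto simp: S'_def)
    have "(\<lambda>u. indicator S' u * (indicator S u * \<bar>det (matrix (g' u))\<bar>)) \<in> borel_measurable borel"
      using S' d by measurable
    moreover have "(\<lambda>u. indicator S' u * (indicator S u * \<bar>det (matrix (g' u))\<bar>)) = (\<lambda>u. indicator S' u * \<bar>det (matrix (g' u))\<bar>)"
      using S'S by (auto simp: indicator_def fun_eq_iff)
    ultimately have d': "(\<lambda>u. indicator S' u * \<bar>det (matrix (g' u))\<bar>) \<in> borel_measurable borel" by simp
    have "emeasure (distr (density lborel ?D) borel g0) A = emeasure (density lborel ?D) (g0 -` A)"
      using A g0 by (subst emeasure_distr) (auto simp: measurable_def)
    also have "\<dots> = (\<integral>\<^sup>+u. ?D u * indicator (g0 -` A) u \<partial>lborel)"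
      using D measurable_sets[OF g0 A] by (subst emeasure_density) auto
    also have "\<dots> = (\<integral>\<^sup>+u. ennreal (indicator S' u * \<bar>det (matrix (g' u))\<bar>) \<partial>lborel)"
      by (intro nn_integral_cong) (auto simp: indicator_def g0_def S'_def)
    also have "\<dots> = emeasure lborel (g ` S')"
      by (rule nn_integral_Jacobian_eq_image[OF S' _ inj_on_subset[OF inj S'S] _ _ d'])
         (use S'S img has_derivative_subset[OF deriv S'S] gm in
           \<open>auto intro: measurable_restrict_mono\<close>)
    also have "g ` S' = g ` S \<inter> A" by (auto simp: S'_def)
    also have "emeasure lborel (g ` S \<inter> A) = emeasure (density lborel (indicator (g ` S))) A"
      using A gS by (simp add: emeasure_restricted)
    finally show "emeasure (distr (density lborel ?D) borel g0) A = emeasure (density lborel (indicator (g ` S))) A" .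
  qed simp
  then have "(\<integral>\<^sup>+v. h v \<partial>distr (density lborel ?D) borel g0) = (\<integral>\<^sup>+v. h v \<partial>density lborel (indicator (g ` S)))"
    by simp
  moreover have "(\<integral>\<^sup>+v. h v \<partial>distr (density lborel ?D) borel g0) = (\<integral>\<^sup>+u. ?D u * h (g0 u) \<partial>lborel)"
    using h g0 D by (simp add: nn_integral_distr nn_integral_density)
  moreover have "(\<integral>\<^sup>+u. ?D u * h (g0 u) \<partial>lborel) = (\<integral>\<^sup>+u. ?D u * h (g u) \<partial>lborel)"
    by (intro nn_integral_cong) (auto simp: g0_def indicator_def)
  moreover have "(\<integral>\<^sup>+v. h v \<partial>density lborel (indicator (g ` S))) = (\<integral>\<^sup>+v. indicator (g ` S) v * h v \<partial>lborel)"
    using h gS by (simp add: nn_integral_density)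
  ultimately show ?thesis by simp
qed

text \<open>A transition map is a priori only continuous. With a linear left inverse
  \<open>\<Lambda>\<close> of \<open>D2\<close>, its derivative should be
  \<open>\<Lambda> \<circ> D1\<close>. Injectivity of \<open>D2\<close> first yields a Lipschitz
  bound for \<open>\<tau>\<close> at \<open>u\<close>, and this bound turns the remainder of
  \<open>h\<close> into a remainder in \<open>w - u\<close>.\<close>

lemma has_derivative_transition:
  fixes f :: "'a::real_normed_vector \<Rightarrow> 'c::euclidean_space"
    and h :: "'b::euclidean_space \<Rightarrow> 'c"
  assumes d1: "(f has_derivative D1) (at u)"
    and d2: "(h has_derivative D2) (at (\<tau> u))" and "inj D2"
    and cont: "isCont \<tau> u"
    and ev: "\<forall>\<^sub>F w in nhds u. h (\<tau> w) = f w"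
  shows "\<exists>\<tau>'. (\<tau> has_derivative \<tau>') (at u) \<and> D2 \<circ> \<tau>' = D1"
proof -
  have lin: "linear D2" "bounded_linear D1" using d2 d1 has_derivative_linear has_derivative_bounded_linear by blast+
  obtain \<Lambda> where \<Lambda>: "linear \<Lambda>" "\<Lambda> \<circ> D2 = id"
    using linear_injective_left_inverse[OF lin(1) \<open>inj D2\<close>] by blast
  then have \<Lambda>D: "\<Lambda> (D2 v) = v" for v by (metis comp_apply id_apply)
  obtain K where K: "K > 0" "\<And>z. norm (\<Lambda> z) \<le> norm z * K"
    using bounded_linear.pos_bounded[OF linear_conv_bounded_linear[THEN iffD1, OF \<Lambda>(1)]] by blast
  obtain B where B: "B > 0" "\<And>z. norm (D1 z) \<le> norm z * B"
    using bounded_linear.pos_bounded[OF lin(2)] by blast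
  have at_u: "h (\<tau> u) = f u" using eventually_nhds_x_imp_x[OF ev] .
  have R1: "\<forall>\<^sub>F w in nhds u. norm (f w - f u - D1 (w - u)) \<le> e * norm (w - u)" if "e > 0" for e
    using d1 that unfolding has_derivative_at_alt eventually_nhds_metric by (metis dist_norm)
  have R2: "\<forall>\<^sub>F w in nhds u. norm (f w - f u - D2 (\<tau> w - \<tau> u)) \<le> e * norm (\<tau> w - \<tau> u)" if "e > 0" for e
  proof -
    have "\<forall>\<^sub>F v in nhds (\<tau> u). norm (h v - h (\<tau> u) - D2 (v - \<tau> u)) \<le> e * norm (v - \<tau> u)"
      using d2 that unfolding has_derivative_at_alt eventually_nhds_metric by (metis dist_norm)
    moreover have "filterlim \<tau> (nhds (\<tau> u)) (nhds u)"
      using cont by (simp add: isCont_def tendsto_at_iff_tendsto_nhds)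
    ultimately have "\<forall>\<^sub>F w in nhds u. norm (h (\<tau> w) - h (\<tau> u) - D2 (\<tau> w - \<tau> u)) \<le> e * norm (\<tau> w - \<tau> u)"
      by (rule eventually_compose_filterlim)
    with ev show ?thesis by eventually_elim (simp add: at_u)
  qed
  \<comment> \<open>\<open>K\<close> bounds \<open>\<Lambda>\<close> and \<open>B + 1\<close> bounds
    the difference quotient of \<open>f\<close>. The factor 2 appears because the remainder of
    \<open>h\<close>, taken with constant \<open>1 / (2 * K)\<close>, contributes half of the norm
    of \<open>\<tau> w - \<tau> u\<close>, which is absorbed on the left.\<close>
  define M where "M = 2 * K * (B + 1)"
  have M: "M > 0" using K B by (simp add: M_def)
  have lip: "\<forall>\<^sub>F w in nhds u. norm (\<tau> w - \<tau> u) \<le> M * norm (w - u)"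
    using R1[of 1, simplified] R2[of "1 / (2 * K)", simplified, OF K(1)]
  proof eventually_elim
    fix w assume 1: "norm (f w - f u - D1 (w - u)) \<le> norm (w - u)"
      and 2: "norm (f w - f u - D2 (\<tau> w - \<tau> u)) \<le> norm (\<tau> w - \<tau> u) / (2 * K)"
    have a: "norm (f w - f u) \<le> (B + 1) * norm (w - u)"
      using norm_triangle_sub[of "f w - f u" "D1 (w - u)"] 1 B(2)[of "w - u"] by (simp add: algebra_simps)
    have b: "norm (D2 (\<tau> w - \<tau> u)) \<le> norm (f w - f u) + norm (\<tau> w - \<tau> u) / (2 * K)"
      using norm_triangle_sub[of "D2 (\<tau> w - \<tau> u)" "f w - f u"] 2 by (simp add: norm_minus_commute)
    have "norm (\<tau> w - \<tau> u) \<le> norm (D2 (\<tau> w - \<tau> u)) * K" using K(2)[of "D2 (\<tau> w - \<tau> u)"] by (simp add: \<Lambda>D)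
    also have "\<dots> \<le> ((B + 1) * norm (w - u) + norm (\<tau> w - \<tau> u) / (2 * K)) * K"
      using a b K(1) by (intro mult_right_mono) auto
    also have "\<dots> = K * (B + 1) * norm (w - u) + norm (\<tau> w - \<tau> u) / 2"
      using K(1) by (simp add: field_simps)
    finally show "norm (\<tau> w - \<tau> u) \<le> M * norm (w - u)" by (simp add: M_def)
  qed
  have "(\<tau> has_derivative (\<lambda>z. \<Lambda> (D1 z))) (at u)"
    unfolding has_derivative_at_alt
  proof (intro conjI allI impI)
    show "bounded_linear (\<lambda>z. \<Lambda> (D1 z))"
      using bounded_linear_compose[OF linear_conv_bounded_linear[THEN iffD1, OF \<Lambda>(1)] lin(2)] .
    fix e :: real assume e: "e > 0"
    have "\<forall>\<^sub>F w in nhds u. norm (\<tau> w - \<tau> u - \<Lambda> (D1 (w - u))) \<le> e * norm (w - u)"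
    proof -
      \<comment> \<open>After multiplication by \<open>K\<close> each of the two remainders
        contributes \<open>e / 2\<close>; dividing by \<open>M\<close> compensates the Lipschitz
        constant.\<close>
      have "e / (2 * K) > 0" "e / (2 * K * M) > 0" using e K(1) M by simp_all
      from R1[OF this(1)] R2[OF this(2)] lip show ?thesis
      proof eventually_elim
        fix w
        assume 1: "norm (f w - f u - D1 (w - u)) \<le> e / (2 * K) * norm (w - u)"
          and 2: "norm (f w - f u - D2 (\<tau> w - \<tau> u)) \<le> e / (2 * K * M) * norm (\<tau> w - \<tau> u)"
          and 3: "norm (\<tau> w - \<tau> u) \<le> M * norm (w - u)"
        have "e / (2 * K * M) * norm (\<tau> w - \<tau> u) \<le> e / (2 * K * M) * (M * norm (w - u))"
          using 3 e K(1) M by (intro mult_left_mono) auto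
        also have "\<dots> = e / (2 * K) * norm (w - u)" using M by simp
        finally have rem: "norm (f w - f u - D2 (\<tau> w - \<tau> u)) \<le> e / (2 * K) * norm (w - u)" using 2 by linarith
        have "\<tau> w - \<tau> u - \<Lambda> (D1 (w - u)) = \<Lambda> (D2 (\<tau> w - \<tau> u) - D1 (w - u))"
          by (simp add: linear_diff[OF \<Lambda>(1)] \<Lambda>D)
        then have "norm (\<tau> w - \<tau> u - \<Lambda> (D1 (w - u))) \<le> norm (D2 (\<tau> w - \<tau> u) - D1 (w - u)) * K"
          using K(2) by simp
        also have "D2 (\<tau> w - \<tau> u) - D1 (w - u) = (f w - f u - D1 (w - u)) - (f w - f u - D2 (\<tau> w - \<tau> u))" by simp
        also have "norm \<dots> \<le> e / (2 * K) * norm (w - u) + e / (2 * K) * norm (w - u)"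
          by (rule order_trans[OF norm_triangle_ineq4 add_mono[OF 1 rem]])
        finally show "norm (\<tau> w - \<tau> u - \<Lambda> (D1 (w - u))) \<le> e * norm (w - u)"
          using K(1) by (simp add: mult_right_mono field_simps)
      qed
    qed
    then show "\<exists>d>0. \<forall>w. norm (w - u) < d \<longrightarrow> norm (\<tau> w - \<tau> u - \<Lambda> (D1 (w - u))) \<le> e * norm (w - u)"
      unfolding eventually_nhds_metric dist_norm by blast
  qed
  then obtain \<tau>' where \<tau>': "(\<tau> has_derivative \<tau>') (at u)" by blast
  have "((\<lambda>w. h (\<tau> w)) has_derivative (\<lambda>z. D2 (\<tau>' z))) (at u)"
    by (rule has_derivative_compose[OF \<tau>' d2])
  then have "(f has_derivative (\<lambda>z. D2 (\<tau>' z))) (at u)"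
    by (rule has_derivative_transform_eventually) (use ev at_u in \<open>auto simp: eventually_nhds_conv_at\<close>)
  then have "(\<lambda>z. D2 (\<tau>' z)) = D1" using d1 has_derivative_unique by blast
  with \<tau>' show ?thesis by (auto simp: comp_def)
qed

section \<open>Charts of the submanifold\<close>

locale chart =
  fixes \<Sigma> :: "(real \<times> 'y::euclidean_space) set"
    and U :: "(real ^ 'k::{finite,wellorder}) set" and \<phi> :: "real ^ 'k::_ \<Rightarrow> real \<times> 'y"
  assumes param: "local_param \<Sigma> U \<phi>" and half_space: "\<Sigma> \<subseteq> half_space"
begin

lemma image_openin: "openin (top_of_set \<Sigma>) (\<phi> ` U)"
  using param by (simp add: local_param_def)

lemma image_subset: "\<phi> ` U \<subseteq> \<Sigma>"
  using openin_imp_subset[OF image_openin] .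

sublocale immersion U \<phi>
  using param half_space image_subset by unfold_locales (auto simp: local_param_def)

definition coord :: "real \<times> 'y \<Rightarrow> (real, 'k) vec" where
  "coord = (SOME \<psi>. homeomorphism U (\<phi> ` U) \<phi> \<psi>)"

lemma homeo: "homeomorphism U (\<phi> ` U) \<phi> coord"
proof -
  have "\<exists>\<psi>. homeomorphism U (\<phi> ` U) \<phi> \<psi>" using param by (simp add: local_param_def)
  then show ?thesis unfolding coord_def by (rule someI_ex)
qed

lemma coord_param [simp]: "u \<in> U \<Longrightarrow> coord (\<phi> u) = u"
  and param_coord [simp]: "p \<in> \<phi> ` U \<Longrightarrow> \<phi> (coord p) = p"
  and coord_in: "p \<in> \<phi> ` U \<Longrightarrow> coord p \<in> U"
  and continuous_coord: "continuous_on (\<phi> ` U) coord"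
  using homeomorphism_apply1[OF homeo] homeomorphism_apply2[OF homeo] homeomorphism_image2[OF homeo]
    homeomorphism_cont2[OF homeo] by blast+

lemma inj_on_param: "inj_on \<phi> U"
  by (rule inj_on_inverseI[of U coord]) simp

lemma coord_image_eq:
  assumes "A \<subseteq> \<phi> ` U"
  shows "coord ` A = U \<inter> \<phi> -` A"
proof (intro equalityI subsetI)
  fix u assume "u \<in> coord ` A"
  with assms show "u \<in> U \<inter> \<phi> -` A" using coord_in by auto
next
  fix u assume "u \<in> U \<inter> \<phi> -` A"
  then have "u = coord (\<phi> u)" "\<phi> u \<in> A" by auto
  then show "u \<in> coord ` A" by (rule image_eqI)
qed

text \<open>The image is the preimage of \<open>W\<close> under the continuous inverse
  \<open>coord\<close>, which lives on a Borel set.\<close>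

lemma image_borel:
  assumes "\<Sigma> \<in> sets borel" "W \<in> sets borel" "W \<subseteq> U"
  shows "\<phi> ` W \<in> sets borel"
proof -
  obtain T where T: "open T" "\<phi> ` U = \<Sigma> \<inter> T" using image_openin by (auto simp: openin_open)
  then have im: "\<phi> ` U \<in> sets borel" using assms(1) by auto
  have "coord \<in> borel_measurable (restrict_space borel (\<phi> ` U))"
    by (rule borel_measurable_continuous_on_restrict[OF continuous_coord])
  from measurable_sets[OF this assms(2)] im have "coord -` W \<inter> \<phi> ` U \<in> sets borel"
    by (simp add: space_restrict_space sets_restrict_space_iff)
  moreover have "coord -` W \<inter> \<phi> ` U = \<phi> ` W" using assms(3) by auto
  ultimately show ?thesis by simp
qed

lemma preimage_borel:
  assumes "A \<in> sets borel"
  shows "U \<inter> \<phi> -` A \<in> sets borel"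
proof -
  have "\<phi> \<in> borel_measurable (restrict_space borel U)"
    by (rule borel_measurable_continuous_on_restrict[OF continuous_param])
  from measurable_sets[OF this assms] open_U show ?thesis
    by (simp add: space_restrict_space sets_restrict_space_iff Int_commute)
qed

lemma density_borel: "(\<lambda>u. indicator U u * density u) \<in> borel_measurable borel"
  using borel_measurable_continuous_on_restrict[OF continuous_on_density] open_U
  by (simp add: borel_measurable_restrict_space_iff)

lemma tangent_space_linear: "u \<in> U \<Longrightarrow> linear (frechet_derivative \<phi> (at u))"
  using has_derivative_linear[OF param_derivative] .

lemma vertical_tangent_in:
  assumes "u \<in> U"
  shows "vertical_tangent \<phi> u \<in> range (frechet_derivative \<phi> (at u))"
proof (rule range_eqI)
  show "vertical_tangent \<phi> u = frechet_derivative \<phi> (at u) (\<chi> c. tcoord c u / (fst (\<phi> u))\<^sup>2)"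
    by (simp add: vertical_tangent_eq[OF assms] frechet_derivative_expand[OF assms])
qed

lemma vertical_tangent_orthogonal:
  "u \<in> U \<Longrightarrow> vertical_tangent \<phi> u \<bullet> frechet_derivative \<phi> (at u) v = fst (frechet_derivative \<phi> (at u) v)"
  by (simp add: frechet_derivative_expand inner_sum_right vertical_tangent_inner fst_sum)

lemma vertical_tangent_norm:
  assumes "u \<in> U"
  shows "fst (vertical_tangent \<phi> u) = (norm (vertical_tangent \<phi> u))\<^sup>2"
proof -
  obtain v where "vertical_tangent \<phi> u = frechet_derivative \<phi> (at u) v"
    using vertical_tangent_in[OF assms] by blast
  with vertical_tangent_orthogonal[OF assms, of v] show ?thesis by (simp add: power2_norm_eq_inner)
qed

text \<open>The upper bound is \<open>|grad (1/x)| \<le> 1/x\<close> in disguise, since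
  \<open>|grad (1/x)|^2\<close> equals \<open>fst (vertical_tangent \<phi> u) / x^2\<close>. The
  height of the projection of \<open>(1, 0)\<close> is its squared norm, hence at most 1.\<close>

lemma vertical_tangent_bounds:
  assumes "u \<in> U"
  shows "0 \<le> fst (vertical_tangent \<phi> u)" "fst (vertical_tangent \<phi> u) \<le> 1"
proof -
  let ?t = "vertical_tangent \<phi> u"
  show nonneg: "0 \<le> fst ?t" using vertical_tangent_norm[OF assms] by simp
  have "\<bar>fst ?t\<bar> \<le> norm ?t" using norm_fst_le[of "fst ?t" "snd ?t"] by simp
  then have "(fst ?t)\<^sup>2 \<le> fst ?t"
    using vertical_tangent_norm[OF assms] power_mono[of "\<bar>fst ?t\<bar>" "norm ?t" 2] by simp
  then show "fst ?t \<le> 1"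
  proof (rule_tac ccontr)
    assume "(fst ?t)\<^sup>2 \<le> fst ?t" "\<not> fst ?t \<le> 1"
    moreover from this have "fst ?t * 1 < fst ?t * fst ?t" by (intro mult_strict_left_mono) auto
    ultimately show False unfolding power2_eq_square by linarith
  qed
qed

end

section \<open>Transition maps and independence of the chart\<close>

locale two_charts = c1: chart \<Sigma> U1 \<phi>1 + c2: chart \<Sigma> U2 \<phi>2
  for \<Sigma> :: "(real \<times> 'y::euclidean_space) set"
    and U1 U2 :: "(real ^ 'k::{finite,wellorder}) set" and \<phi>1 \<phi>2 :: "real ^ 'k::_ \<Rightarrow> real \<times> 'y"
begin

definition trans :: "(real, 'k) vec \<Rightarrow> (real, 'k) vec" where
  "trans u = c2.coord (\<phi>1 u)"

lemma overlap_open: "open (U1 \<inter> \<phi>1 -` (\<phi>2 ` U2))"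
proof -
  obtain T where T: "open T" "\<phi>2 ` U2 = \<Sigma> \<inter> T" using c2.image_openin by (auto simp: openin_open)
  have "U1 \<inter> \<phi>1 -` (\<phi>2 ` U2) = U1 \<inter> \<phi>1 -` T" using T(2) c1.image_subset by auto
  with continuous_open_preimage[OF c1.continuous_param c1.open_U T(1)] show ?thesis by simp
qed

lemma continuous_trans: "continuous_on (U1 \<inter> \<phi>1 -` (\<phi>2 ` U2)) trans"
  unfolding trans_def
  by (rule continuous_on_compose2[OF c2.continuous_coord continuous_on_subset[OF c1.continuous_param]]) auto

lemma trans_derivative:
  assumes u: "u \<in> U1" "\<phi>1 u \<in> \<phi>2 ` U2"
  shows "\<exists>\<tau>'. (trans has_derivative \<tau>') (at u) \<and>
    frechet_derivative \<phi>2 (at (trans u)) \<circ> \<tau>' = frechet_derivative \<phi>1 (at u)"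
proof (rule has_derivative_transition[where h = \<phi>2])
  have v: "trans u \<in> U2" unfolding trans_def by (rule c2.coord_in[OF u(2)])
  show "(\<phi>1 has_derivative frechet_derivative \<phi>1 (at u)) (at u)" by (rule c1.param_derivative[OF u(1)])
  show "(\<phi>2 has_derivative frechet_derivative \<phi>2 (at (trans u))) (at (trans u))" by (rule c2.param_derivative[OF v])
  show "inj (frechet_derivative \<phi>2 (at (trans u)))" by (rule c2.inj_deriv[OF v])
  show "isCont trans u"
    using continuous_trans overlap_open u by (simp add: continuous_on_eq_continuous_at)
  have "\<forall>\<^sub>F w in nhds u. w \<in> U1 \<inter> \<phi>1 -` (\<phi>2 ` U2)"
    using overlap_open u by (intro eventually_nhds_in_open) auto
  then show "\<forall>\<^sub>F w in nhds u. \<phi>2 (trans w) = \<phi>1 w"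
    by eventually_elim (simp add: trans_def)
qed

definition jac :: "(real, 'k) vec \<Rightarrow> (real, 'k) vec \<Rightarrow> (real, 'k) vec" where
  "jac u = (SOME \<tau>'. (trans has_derivative \<tau>') (at u) \<and>
    frechet_derivative \<phi>2 (at (trans u)) \<circ> \<tau>' = frechet_derivative \<phi>1 (at u))"

context
  fixes u assumes u: "u \<in> U1" "\<phi>1 u \<in> \<phi>2 ` U2"
begin

lemma jac: "(trans has_derivative jac u) (at u)"
    "frechet_derivative \<phi>2 (at (trans u)) (jac u v) = frechet_derivative \<phi>1 (at u) v"
proof -
  have "(trans has_derivative jac u) (at u) \<and>
      frechet_derivative \<phi>2 (at (trans u)) \<circ> jac u = frechet_derivative \<phi>1 (at u)"
    unfolding jac_def by (rule someI_ex[OF trans_derivative[OF u]])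
  then show "(trans has_derivative jac u) (at u)"
    "frechet_derivative \<phi>2 (at (trans u)) (jac u v) = frechet_derivative \<phi>1 (at u) v"
    by (auto simp: fun_eq_iff)
qed

lemma trans_in: "trans u \<in> U2"
  unfolding trans_def by (rule c2.coord_in[OF u(2)])

lemma param_trans: "\<phi>2 (trans u) = \<phi>1 u"
  using u(2) by (simp add: trans_def)

lemma gram_trans: "gram \<phi>1 u = transpose (matrix (jac u)) ** gram \<phi>2 (trans u) ** matrix (jac u)"
proof -
  have "partial i \<phi>1 u = (\<Sum>a\<in>UNIV. matrix (jac u) $ a $ i *\<^sub>R partial a \<phi>2 (trans u))" for i
  proof -
    have "partial i \<phi>1 u = frechet_derivative \<phi>2 (at (trans u)) (jac u (axis i 1))"
      by (simp add: jac(2) partial_def)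
    then show ?thesis by (simp add: c2.frechet_derivative_expand[OF trans_in] matrix_def)
  qed
  then have "gram \<phi>1 u $ i $ j = (\<Sum>a\<in>UNIV. \<Sum>b\<in>UNIV. matrix (jac u) $ a $ i * gram \<phi>2 (trans u) $ a $ b * matrix (jac u) $ b $ j)" for i j
    by (simp add: c1.gram_nth c2.gram_nth inner_sum_left inner_sum_right sum_divide_distrib sum_distrib_left param_trans mult_ac)
      (subst sum.swap, simp add: mult_ac)
  moreover have "(transpose (matrix (jac u)) ** gram \<phi>2 (trans u) ** matrix (jac u)) $ i $ j
      = (\<Sum>a\<in>UNIV. \<Sum>b\<in>UNIV. matrix (jac u) $ a $ i * gram \<phi>2 (trans u) $ a $ b * matrix (jac u) $ b $ j)" for i j
    by (subst sum.swap) (simp add: matrix_matrix_mult_def transpose_def sum_distrib_right)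
  ultimately show ?thesis by (simp add: vec_eq_iff)
qed

lemma density_trans: "c1.density u = \<bar>det (matrix (jac u))\<bar> * c2.density (trans u)"
proof -
  have "det (gram \<phi>1 u) = (det (matrix (jac u)))\<^sup>2 * det (gram \<phi>2 (trans u))"
    by (simp add: gram_trans det_mul det_transpose power2_eq_square)
  then show ?thesis by (simp add: c1.density_def c2.density_def real_sqrt_mult)
qed

lemma tangent_space_eq: "range (frechet_derivative \<phi>1 (at u)) = range (frechet_derivative \<phi>2 (at (trans u)))"
proof -
  have lin: "linear (jac u)" using has_derivative_linear[OF jac(1)] .
  have "inj (jac u)"
    by (rule injI) (metis c1.inj_deriv[OF u(1)] injD jac(2))
  then have "surj (jac u)" using linear_injective_imp_surjective[OF lin] by simp
  then have "range (\<lambda>v. frechet_derivative \<phi>2 (at (trans u)) (jac u v)) = range (frechet_derivative \<phi>2 (at (trans u)))"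
    by (metis image_image)
  then show ?thesis by (simp add: jac(2))
qed

text \<open>The two vectors lie in the same tangent space and have the same products with it, so
  their difference is tangent and orthogonal to itself.\<close>

lemma vertical_tangent_trans: "vertical_tangent \<phi>1 u = vertical_tangent \<phi>2 (trans u)"
proof -
  let ?t1 = "vertical_tangent \<phi>1 u" and ?t2 = "vertical_tangent \<phi>2 (trans u)"
  let ?D = "frechet_derivative \<phi>1 (at u)"
  obtain v1 v2 where v: "?t1 = ?D v1" "?t2 = ?D v2"
    using c1.vertical_tangent_in[OF u(1)] c2.vertical_tangent_in[OF trans_in] tangent_space_eq by blast
  have diff: "?t1 - ?t2 = ?D (v1 - v2)" by (simp add: v linear_diff[OF c1.tangent_space_linear[OF u(1)]])
  have "?t1 \<bullet> ?D w = fst (?D w)" for w by (rule c1.vertical_tangent_orthogonal[OF u(1)])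
  moreover have "?t2 \<bullet> ?D w = fst (?D w)" for w
    using c2.vertical_tangent_orthogonal[OF trans_in, of "jac u w"] by (simp add: jac(2))
  ultimately have "(?t1 - ?t2) \<bullet> ?D (v1 - v2) = 0" by (simp add: inner_diff_left)
  then have "(?t1 - ?t2) \<bullet> (?t1 - ?t2) = 0" by (simp only: diff)
  then show ?thesis by simp
qed

end

lemma chart_volume_eq:
  assumes \<Sigma>: "\<Sigma> \<in> sets borel" and W1: "W1 \<in> sets borel" "W1 \<subseteq> U1" and W2: "W2 \<in> sets borel" "W2 \<subseteq> U2"
    and eq: "\<phi>1 ` W1 = \<phi>2 ` W2"
  shows "(\<integral>\<^sup>+u. ennreal (c1.density u) * indicator W1 u \<partial>lborel) = (\<integral>\<^sup>+v. ennreal (c2.density v) * indicator W2 v \<partial>lborel)"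
proof -
  have ov: "u \<in> U1" "\<phi>1 u \<in> \<phi>2 ` U2" if "u \<in> W1" for u
    using that W1(2) W2(2) eq imageI[OF that, of \<phi>1] by auto
  have sub: "W1 \<subseteq> U1 \<inter> \<phi>1 -` (\<phi>2 ` U2)" using ov by auto
  have img: "trans ` A = U2 \<inter> \<phi>2 -` (\<phi>1 ` A)" if "A \<subseteq> W1" for A
  proof (intro equalityI subsetI)
    fix v assume v: "v \<in> U2 \<inter> \<phi>2 -` (\<phi>1 ` A)"
    then obtain u where u: "u \<in> A" "\<phi>2 v = \<phi>1 u" by auto
    then have "trans u = v" using v by (simp add: trans_def flip: u(2))
    then show "v \<in> trans ` A" using u by blast
  qed (use ov that trans_in param_trans in force)
  have imW: "trans ` W1 = W2"
  proof -
    have "U2 \<inter> \<phi>2 -` (\<phi>2 ` W2) = W2"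
      using W2(2) inj_onD[OF c2.inj_on_param] by blast
    then show ?thesis by (simp only: img[OF subset_refl] eq)
  qed
  have cont: "continuous_on W1 trans" by (rule continuous_on_subset[OF continuous_trans sub])
  have meas: "trans \<in> borel_measurable (restrict_space borel W1)"
    by (rule borel_measurable_continuous_on_restrict[OF cont])
  have borel_img: "trans ` A \<in> sets borel" if "A \<in> sets borel" "A \<subseteq> W1" for A
    unfolding img[OF that(2)] using that W1(2) by (intro c2.preimage_borel c1.image_borel[OF \<Sigma>]) auto
  have inj: "inj_on trans W1"
  proof (rule inj_onI)
    fix u w assume uw: "u \<in> W1" "w \<in> W1" "trans u = trans w"
    then have "\<phi>1 u = \<phi>1 w"
      using param_trans[OF ov[OF uw(1)]] param_trans[OF ov[OF uw(2)]] by simp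
    then show "u = w" using inj_onD[OF c1.inj_on_param] ov(1) uw by blast
  qed
  \<comment> \<open>\<open>jac\<close> is chosen pointwise, so the measurability of its determinant
    is taken from the quotient of the two densities, which is continuous on
    \<open>W1\<close>.\<close>
  have d: "(\<lambda>u. indicator W1 u * \<bar>det (matrix (jac u))\<bar>) \<in> borel_measurable borel"
  proof -
    have "trans u \<in> U2" "c2.density (trans u) \<noteq> 0" if "u \<in> W1" for u
      using trans_in[OF ov[OF that]] c2.density_pos[of "trans u"] by auto
    then have "continuous_on W1 (\<lambda>u. c1.density u / c2.density (trans u))"
      by (intro continuous_on_divide continuous_on_subset[OF c1.continuous_on_density W1(2)]
          continuous_on_compose2[OF c2.continuous_on_density cont]) auto
    then have "(\<lambda>u. indicator W1 u * (c1.density u / c2.density (trans u))) \<in> borel_measurable borel"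
      using borel_measurable_continuous_on_restrict[of W1 "\<lambda>u. c1.density u / c2.density (trans u)"] W1(1)
      by (simp add: borel_measurable_restrict_space_iff)
    moreover have "indicator W1 u * (c1.density u / c2.density (trans u)) = indicator W1 u * \<bar>det (matrix (jac u))\<bar>" for u
    proof (cases "u \<in> W1")
      case True
      show ?thesis
        using density_trans[OF ov[OF True]] c2.density_pos[OF trans_in[OF ov[OF True]]] by simp
    qed simp
    ultimately show ?thesis by simp
  qed
  let ?h = "\<lambda>v. ennreal (indicator U2 v * c2.density v)"
  have h: "?h \<in> borel_measurable borel" using c2.density_borel by simp
  have "(\<integral>\<^sup>+u. ennreal (c1.density u) * indicator W1 u \<partial>lborel)
      = (\<integral>\<^sup>+u. ennreal (indicator W1 u * \<bar>det (matrix (jac u))\<bar>) * ?h (trans u) \<partial>lborel)"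
  proof (intro nn_integral_cong)
    fix u
    show "ennreal (c1.density u) * indicator W1 u = ennreal (indicator W1 u * \<bar>det (matrix (jac u))\<bar>) * ?h (trans u)"
    proof (cases "u \<in> W1")
      case True
      show ?thesis
        using density_trans[OF ov[OF True]] trans_in[OF ov[OF True]] c2.density_pos[OF trans_in[OF ov[OF True]]] True
        by (simp add: ennreal_mult)
    qed simp
  qed
  also have "\<dots> = (\<integral>\<^sup>+v. indicator (trans ` W1) v * ?h v \<partial>lborel)"
    by (rule nn_integral_change_of_variables[OF W1(1) _ inj meas borel_img d h])
      (use ov jac(1) in \<open>auto intro: has_derivative_at_withinI\<close>)
  also have "\<dots> = (\<integral>\<^sup>+v. ennreal (c2.density v) * indicator W2 v \<partial>lborel)"
    unfolding imW using W2 by (intro nn_integral_cong) (auto simp: indicator_def)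
  finally show ?thesis .
qed

end

section \<open>The volume measure of a compact piece\<close>

text \<open>The two radii leave room for cut-offs: balls of radius \<open>r j\<close> already cover
  \<open>K\<close>, while functions supported in balls of radius \<open>2 * r j\<close> stay inside
  one chart.\<close>

locale atlas =
  fixes \<Sigma> K :: "(real \<times> 'y::euclidean_space) set"
    and N :: nat and c :: "nat \<Rightarrow> real \<times> 'y" and r :: "nat \<Rightarrow> real"
    and U :: "nat \<Rightarrow> (real ^ 'k::{finite,wellorder}) set" and \<phi> :: "nat \<Rightarrow> real ^ 'k::_ \<Rightarrow> real \<times> 'y"
  assumes chart: "\<And>j. j < N \<Longrightarrow> chart \<Sigma> (U j) (\<phi> j)"
    and \<Sigma>_borel: "\<Sigma> \<in> sets borel"
    and K: "compact K" "K \<subseteq> \<Sigma>"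
    and r_pos: "\<And>j. j < N \<Longrightarrow> 0 < r j"
    and cover: "K \<subseteq> (\<Union>j<N. ball (c j) (r j))"
    and inside: "\<And>j. j < N \<Longrightarrow> \<Sigma> \<inter> cball (c j) (2 * r j) \<subseteq> \<phi> j ` U j"
begin

definition piece :: "nat \<Rightarrow> (real \<times> 'y) set" where
  "piece j = K \<inter> ball (c j) (r j) - (\<Union>l<j. ball (c l) (r l))"

definition dom :: "nat \<Rightarrow> (real, 'k) vec set" where
  "dom j = U j \<inter> \<phi> j -` piece j"

definition chart_measure :: "nat \<Rightarrow> (real, 'k) vec measure" where
  "chart_measure j = density lborel (\<lambda>u. ennreal (indicator (U j) u * sqrt (det (gram (\<phi> j) u))))"

text \<open>Each piece is measured in its own chart only; that any other chart gives the same value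
  is \<open>emeasure_\<nu>_chart\<close>.\<close>

definition \<nu> :: "(real \<times> 'y) measure" where
  "\<nu> = measure_of UNIV (sets borel) (\<lambda>A. \<Sum>j<N. emeasure (chart_measure j) (dom j \<inter> \<phi> j -` A))"

lemma K_borel: "K \<in> sets borel"
  using K(1) by (rule borel_compact)

lemma piece_borel: "piece j \<in> sets borel"
  unfolding piece_def using K_borel by (intro sets.Diff sets.Int sets.finite_UN) auto

lemma piece_subset: "j < N \<Longrightarrow> piece j \<subseteq> \<phi> j ` U j"
proof -
  assume j: "j < N"
  have "ball (c j) (r j) \<subseteq> cball (c j) (2 * r j)" using r_pos[OF j] by (auto simp: subset_iff)
  then show ?thesis unfolding piece_def using inside[OF j] K(2) by blast
qed

lemma piece_disjoint: "disjoint_family piece"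
proof -
  have "piece i \<inter> piece j = {}" if "i < j" for i j using that by (auto simp: piece_def)
  then show ?thesis unfolding disjoint_family_on_def by (metis inf_commute nat_neq_iff)
qed

lemma piece_Union: "(\<Union>j<N. piece j) = K"
proof (intro equalityI subsetI)
  fix p assume p: "p \<in> K"
  define j where "j = (LEAST j. p \<in> ball (c j) (r j))"
  obtain i where i: "i < N" "p \<in> ball (c i) (r i)" using cover p by blast
  have j: "p \<in> ball (c j) (r j)" "j \<le> i"
    unfolding j_def using i by (auto intro: LeastI Least_le simp del: mem_ball)
  have "p \<notin> ball (c l) (r l)" if "l < j" for l
    using not_less_Least that unfolding j_def by blast
  then show "p \<in> (\<Union>j<N. piece j)" using p i j unfolding piece_def by force
qed (auto simp: piece_def)

lemma dom_borel: "j < N \<Longrightarrow> dom j \<in> sets borel"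
  unfolding dom_def by (rule chart.preimage_borel[OF chart piece_borel])

lemma dom_preimage_borel:
  assumes "j < N" "A \<in> sets borel"
  shows "dom j \<inter> \<phi> j -` A \<in> sets borel"
proof -
  have "dom j \<inter> \<phi> j -` A = dom j \<inter> (U j \<inter> \<phi> j -` A)" by (auto simp: dom_def)
  then show ?thesis using dom_borel chart.preimage_borel[OF chart] assms by auto
qed

lemma sets_\<nu> [simp, measurable_cong]: "sets \<nu> = sets borel"
  and space_\<nu> [simp]: "space \<nu> = UNIV"
  using sets.sigma_sets_eq[of borel] by (simp_all add: \<nu>_def)

lemma emeasure_\<nu>:
  assumes "A \<in> sets borel"
  shows "emeasure \<nu> A = (\<Sum>j<N. emeasure (chart_measure j) (dom j \<inter> \<phi> j -` A))"
proof (rule emeasure_measure_of[OF \<nu>_def])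
  show "countably_additive (sets \<nu>) (\<lambda>A. \<Sum>j<N. emeasure (chart_measure j) (dom j \<inter> \<phi> j -` A))"
  proof (rule countably_additiveI)
    fix A :: "nat \<Rightarrow> (real \<times> 'y) set"
    assume A: "range A \<subseteq> sets \<nu>" "disjoint_family A"
    have "(\<Sum>i. \<Sum>j<N. emeasure (chart_measure j) (dom j \<inter> \<phi> j -` A i))
        = (\<Sum>j<N. \<Sum>i. emeasure (chart_measure j) (dom j \<inter> \<phi> j -` A i))"
      by (rule suminf_sum) (rule summableI)
    also have "\<dots> = (\<Sum>j<N. emeasure (chart_measure j) (\<Union>i. dom j \<inter> \<phi> j -` A i))"
    proof (intro sum.cong refl suminf_emeasure)
      fix j assume "j \<in> {..<N}"
      then show "range (\<lambda>i. dom j \<inter> \<phi> j -` A i) \<subseteq> sets (chart_measure j)"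
        using A(1) dom_preimage_borel by (auto simp: chart_measure_def)
      show "disjoint_family (\<lambda>i. dom j \<inter> \<phi> j -` A i)"
        using A(2) unfolding disjoint_family_on_def by blast
    qed
    also have "\<dots> = (\<Sum>j<N. emeasure (chart_measure j) (dom j \<inter> \<phi> j -` (\<Union> (range A))))"
      by (intro sum.cong refl arg_cong2[where f = emeasure]) auto
    finally show "(\<Sum>i. \<Sum>j<N. emeasure (chart_measure j) (dom j \<inter> \<phi> j -` A i))
        = (\<Sum>j<N. emeasure (chart_measure j) (dom j \<inter> \<phi> j -` (\<Union> (range A))))" .
  qed
qed (use assms in \<open>auto simp: positive_def\<close>)

lemma emeasure_chart_measure:
  assumes "j < N" "W \<in> sets borel" "W \<subseteq> U j"
  shows "emeasure (chart_measure j) W = (\<integral>\<^sup>+u. ennreal (sqrt (det (gram (\<phi> j) u))) * indicator W u \<partial>lborel)"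
proof -
  interpret chart \<Sigma> "U j" "\<phi> j" by (rule chart[OF assms(1)])
  show ?thesis
    unfolding chart_measure_def using assms density_borel
    by (subst emeasure_density) (auto simp: density_def[abs_def] indicator_def intro!: nn_integral_cong)
qed

text \<open>\<open>W\<close> is cut along the pieces, and on each part the given chart is compared
  with the one assigned to the piece by \<open>chart_volume_eq\<close>.\<close>

lemma emeasure_\<nu>_chart:
  fixes V :: "(real, 'k) vec set"
  assumes ch: "chart \<Sigma> V \<psi>" and W: "W \<in> sets borel" "W \<subseteq> V" and WK: "\<psi> ` W \<subseteq> K"
  shows "emeasure \<nu> (\<psi> ` W) = (\<integral>\<^sup>+u. ennreal (sqrt (det (gram \<psi> u))) * indicator W u \<partial>lborel)"
proof -
  interpret a: chart \<Sigma> V \<psi> by (rule ch)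
  define Wj where "Wj j = W \<inter> (V \<inter> \<psi> -` piece j)" for j
  have Wj: "Wj j \<in> sets borel" "Wj j \<subseteq> V" for j
    unfolding Wj_def using W(1) a.preimage_borel[OF piece_borel] by auto
  have disj: "disjoint_family_on Wj {..<N}"
    using piece_disjoint unfolding Wj_def disjoint_family_on_def by blast
  have UN: "(\<Union>j<N. Wj j) = W"
  proof -
    have "(\<Union>j<N. Wj j) = W \<inter> (V \<inter> \<psi> -` (\<Union>j<N. piece j))" by (auto simp: Wj_def)
    then show ?thesis unfolding piece_Union using WK W(2) by auto
  qed
  have img: "\<psi> ` W \<in> sets borel" by (rule a.image_borel[OF \<Sigma>_borel W])
  let ?M = "density lborel (\<lambda>u. ennreal (indicator V u * a.density u))"
  have M: "emeasure ?M S = (\<integral>\<^sup>+u. ennreal (a.density u) * indicator S u \<partial>lborel)" if "S \<in> sets borel" "S \<subseteq> V" for S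
    using that a.density_borel by (subst emeasure_density) (auto simp: indicator_def intro!: nn_integral_cong)
  have "(\<integral>\<^sup>+u. ennreal (a.density u) * indicator W u \<partial>lborel) = emeasure ?M (\<Union>j<N. Wj j)"
    using M[OF W] by (simp add: UN)
  also have "\<dots> = (\<Sum>j<N. emeasure ?M (Wj j))"
    using disj Wj by (intro sum_emeasure[symmetric]) auto
  also have "\<dots> = (\<Sum>j<N. emeasure (chart_measure j) (dom j \<inter> \<phi> j -` (\<psi> ` W)))"
  proof (intro sum.cong refl)
    fix j assume "j \<in> {..<N}"
    then have j: "j < N" by simp
    interpret b: chart \<Sigma> "U j" "\<phi> j" by (rule chart[OF j])
    interpret two_charts \<Sigma> V "U j" \<psi> "\<phi> j" by unfold_locales
    have "\<psi> ` Wj j = \<phi> j ` (dom j \<inter> \<phi> j -` (\<psi> ` W))"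
    proof (intro equalityI subsetI)
      fix p assume "p \<in> \<psi> ` Wj j"
      then obtain u where u: "u \<in> W" "p = \<psi> u" "p \<in> piece j" by (auto simp: Wj_def)
      with piece_subset[OF j] obtain v where "v \<in> U j" "p = \<phi> j v" by blast
      with u have "v \<in> dom j \<inter> \<phi> j -` (\<psi> ` W)" by (auto simp: dom_def)
      with \<open>p = \<phi> j v\<close> show "p \<in> \<phi> j ` (dom j \<inter> \<phi> j -` (\<psi> ` W))" by blast
    next
      fix p assume "p \<in> \<phi> j ` (dom j \<inter> \<phi> j -` (\<psi> ` W))"
      then have "p \<in> piece j" "p \<in> \<psi> ` W" by (auto simp: dom_def)
      then show "p \<in> \<psi> ` Wj j" using W(2) by (auto simp: Wj_def)
    qed
    then have "(\<integral>\<^sup>+u. ennreal (a.density u) * indicator (Wj j) u \<partial>lborel)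
        = (\<integral>\<^sup>+v. ennreal (b.density v) * indicator (dom j \<inter> \<phi> j -` (\<psi> ` W)) v \<partial>lborel)"
      using Wj dom_preimage_borel[OF j img] by (intro chart_volume_eq[OF \<Sigma>_borel]) (auto simp: dom_def)
    then show "emeasure ?M (Wj j) = emeasure (chart_measure j) (dom j \<inter> \<phi> j -` (\<psi> ` W))"
      using M[OF Wj] emeasure_chart_measure[OF j dom_preimage_borel[OF j img]]
      by (simp add: b.density_def dom_def le_infI1)
  qed
  also have "\<dots> = emeasure \<nu> (\<psi> ` W)" by (rule emeasure_\<nu>[OF img, symmetric])
  finally show ?thesis by (simp add: a.density_def)
qed

text \<open>Any admissible family has as total volume the \<nu>-measure of a disjoint union inside
  \<open>B\<close>, which bounds the supremum; the pieces intersected with \<open>B\<close> form a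
  family attaining it.\<close>

lemma hyp_volume_eq:
  assumes B: "B \<in> sets borel" "B \<subseteq> K" and half: "\<Sigma> \<subseteq> half_space"
  shows "hyp_volume TYPE('k) \<Sigma> B = emeasure \<nu> B"
proof (rule antisym)
  show "hyp_volume TYPE('k) \<Sigma> B \<le> emeasure \<nu> B"
    unfolding hyp_volume_def
  proof (rule Sup_least, clarify)
    fix V :: "nat \<Rightarrow> (real, 'k) vec set" and \<psi> :: "nat \<Rightarrow> (real, 'k) vec \<Rightarrow> real \<times> 'y" and W
    assume *: "\<forall>i. local_param \<Sigma> (V i) (\<psi> i) \<and> W i \<in> sets borel \<and> W i \<subseteq> V i \<and> \<psi> i ` W i \<subseteq> B"
      and disj: "disjoint_family (\<lambda>i. \<psi> i ` W i)"
    have ch: "chart \<Sigma> (V i) (\<psi> i)" for i using * half by unfold_locales auto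
    have img: "\<psi> i ` W i \<in> sets borel" for i
      using * by (intro chart.image_borel[OF ch \<Sigma>_borel]) auto
    have "(\<Sum>i. \<integral>\<^sup>+u\<in>W i. ennreal (sqrt (det (gram (\<psi> i) u))) \<partial>lborel) = (\<Sum>i. emeasure \<nu> (\<psi> i ` W i))"
      using * B(2) by (intro suminf_cong emeasure_\<nu>_chart[OF ch, symmetric]) blast+
    also have "\<dots> = emeasure \<nu> (\<Union>i. \<psi> i ` W i)"
      using img disj by (intro suminf_emeasure) auto
    also have "\<dots> \<le> emeasure \<nu> B"
      using * B by (intro emeasure_mono) auto
    finally show "(\<Sum>i. \<integral>\<^sup>+u\<in>W i. ennreal (sqrt (det (gram (\<psi> i) u))) \<partial>lborel) \<le> emeasure \<nu> B" .
  qed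
  show "emeasure \<nu> B \<le> hyp_volume TYPE('k) \<Sigma> B"
  \<comment> \<open>The families are infinite sequences, so indices from \<open>N\<close> on are
    filled with chart 0 and the empty set. For \<open>N = 0\<close> there is no such chart, but then
    \<nu> vanishes.\<close>
  proof (cases "N = 0")
    case True
    then have "emeasure \<nu> B = 0" unfolding emeasure_\<nu>[OF B(1)] by simp
    then show ?thesis by simp
  next
    case False
    define V where "V i = (if i < N then U i else U 0)" for i
    define \<psi> where "\<psi> i = (if i < N then \<phi> i else \<phi> 0)" for i
    define W where "W i = (if i < N then dom i \<inter> \<phi> i -` B else {})" for i
    have W: "\<psi> i ` W i = (if i < N then piece i \<inter> B else {})" for i
      using piece_subset by (force simp: W_def \<psi>_def dom_def)
    have "emeasure \<nu> B = (\<Sum>i<N. emeasure (chart_measure i) (dom i \<inter> \<phi> i -` B))"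
      by (rule emeasure_\<nu>[OF B(1)])
    also have "\<dots> = (\<Sum>i<N. \<integral>\<^sup>+u\<in>W i. ennreal (sqrt (det (gram (\<psi> i) u))) \<partial>lborel)"
    proof (intro sum.cong refl)
      fix i assume "i \<in> {..<N}"
      then have i: "i < N" by simp
      have "dom i \<inter> \<phi> i -` B \<subseteq> U i" by (auto simp: dom_def)
      from emeasure_chart_measure[OF i dom_preimage_borel[OF i B(1)] this] i
      show "emeasure (chart_measure i) (dom i \<inter> \<phi> i -` B) = (\<integral>\<^sup>+u\<in>W i. ennreal (sqrt (det (gram (\<psi> i) u))) \<partial>lborel)"
        by (simp add: W_def \<psi>_def)
    qed
    also have "\<dots> = (\<Sum>i. \<integral>\<^sup>+u\<in>W i. ennreal (sqrt (det (gram (\<psi> i) u))) \<partial>lborel)"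
      by (rule suminf_finite[symmetric]) (auto simp: W_def)
    also have "\<dots> \<le> hyp_volume TYPE('k) \<Sigma> B"
      unfolding hyp_volume_def
    proof (rule Sup_upper, rule CollectI, rule exI[of _ V], rule exI[of _ \<psi>], rule exI[of _ W], intro conjI allI refl)
      fix i
      show "local_param \<Sigma> (V i) (\<psi> i)"
        using chart[of i] chart[of 0] False by (auto simp: V_def \<psi>_def chart_def)
      show "W i \<in> sets borel" "W i \<subseteq> V i"
        using dom_preimage_borel[OF _ B(1)] by (auto simp: W_def V_def dom_def)
      show "\<psi> i ` W i \<subseteq> B" by (simp add: W)
      show "disjoint_family (\<lambda>i. \<psi> i ` W i)"
        unfolding W using piece_disjoint by (auto simp: disjoint_family_on_def)
    qed
    finally show ?thesis .
  qed
qed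

text \<open>Each \<open>dom j\<close> lies in the coordinate image of \<open>K\<close> intersected
  with a closed ball inside the chart, a compact set on which the density is bounded.\<close>

lemma finite_measure_\<nu>: "finite_measure \<nu>"
proof
  have "emeasure (chart_measure j) (dom j \<inter> \<phi> j -` UNIV) < top" if j: "j < N" for j
  proof -
    interpret chart \<Sigma> "U j" "\<phi> j" by (rule chart[OF j])
    define C where "C = coord ` (K \<inter> cball (c j) (2 * r j))"
    have sub: "K \<inter> cball (c j) (2 * r j) \<subseteq> \<phi> j ` U j" using inside[OF j] K(2) by blast
    have "compact C" unfolding C_def
      using sub K(1) by (intro compact_continuous_image continuous_on_subset[OF continuous_coord] compact_Int_closed) auto
    have CU: "C \<subseteq> U j" unfolding C_def using sub coord_in by blast
    have domC: "dom j \<subseteq> C"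
      unfolding C_def coord_image_eq[OF sub] dom_def piece_def using r_pos[OF j] by auto
    have "compact (density ` C)"
      using \<open>compact C\<close> CU by (intro compact_continuous_image continuous_on_subset[OF continuous_on_density])
    then obtain B where B: "\<And>u. u \<in> C \<Longrightarrow> density u \<le> B"
      using compact_imp_bounded bounded_iff by (metis image_eqI abs_le_iff real_norm_def)
    have "emeasure (chart_measure j) (dom j) = (\<integral>\<^sup>+u. ennreal (density u) * indicator (dom j) u \<partial>lborel)"
      using emeasure_chart_measure[OF j dom_borel[OF j]] by (simp add: density_def dom_def)
    also have "\<dots> \<le> (\<integral>\<^sup>+u. ennreal B * indicator C u \<partial>lborel)"
      using B domC by (intro nn_integral_mono) (auto simp: indicator_def intro: ennreal_leI)
    also have "\<dots> = ennreal B * emeasure lborel C"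
      using borel_compact[OF \<open>compact C\<close>] by (intro nn_integral_cmult_indicator) auto
    also have "\<dots> < top"
      using emeasure_compact_finite[OF \<open>compact C\<close>] by (simp add: ennreal_mult_less_top)
    finally show ?thesis by simp
  qed
  then show "emeasure \<nu> (space \<nu>) \<noteq> \<infinity>"
    by (simp add: emeasure_\<nu> less_top[symmetric])
qed

text \<open>By \<open>emeasure_\<nu>_chart\<close>, the volume density on the preimage of
  \<open>C\<close> is pushed forward by \<open>\<psi>\<close> to \<nu> restricted to
  \<open>C\<close>; both sides integrate \<open>F\<close> against this measure.\<close>

lemma integral_\<nu>_chart:
  fixes F :: "real \<times> 'y \<Rightarrow> real" and V :: "(real, 'k) vec set"
  assumes ch: "chart \<Sigma> V \<psi>" and C: "C \<in> sets borel" "C \<subseteq> K" "C \<subseteq> \<psi> ` V"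
    and F: "F \<in> borel_measurable borel"
  shows "(\<integral>p. indicator C p * F p \<partial>\<nu>)
       = (\<integral>u. indicator (V \<inter> \<psi> -` C) u * (sqrt (det (gram \<psi> u)) * F (\<psi> u)) \<partial>lborel)"
proof -
  interpret a: chart \<Sigma> V \<psi> by (rule ch)
  define W where "W = V \<inter> \<psi> -` C"
  have W: "W \<in> sets borel" "W \<subseteq> V" unfolding W_def using a.preimage_borel[OF C(1)] by auto
  define \<psi>0 where "\<psi>0 u = (if u \<in> V then \<psi> u else 0)" for u
  have V: "V \<in> sets borel" using a.open_U by auto
  have \<psi>0: "\<psi>0 \<in> borel_measurable borel"
    using borel_measurable_continuous_on_restrict[OF a.continuous_param] V unfolding \<psi>0_def
    by (simp add: measurable_restrict_space_iff)
  let ?f = "\<lambda>u. indicator W u * a.density u"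
  have f: "?f \<in> borel_measurable borel"
  proof -
    have "(\<lambda>u. indicator W u * (indicator V u * a.density u)) \<in> borel_measurable borel"
      using W a.density_borel by measurable
    moreover have "(\<lambda>u. indicator W u * (indicator V u * a.density u)) = ?f"
      using W(2) by (auto simp: indicator_def fun_eq_iff)
    ultimately show ?thesis by simp
  qed
  have fpos: "0 \<le> ?f u" for u using a.density_pos[of u] W(2) by (auto simp: indicator_def less_imp_le)
  have eq: "distr (density lborel (\<lambda>u. ennreal (?f u))) borel \<psi>0 = density \<nu> (\<lambda>p. ennreal (indicator C p))"
  proof (rule measure_eqI)
    fix A assume "A \<in> sets (distr (density lborel (\<lambda>u. ennreal (?f u))) borel \<psi>0)"
    then have A: "A \<in> sets borel" by simp
    have WA: "W \<inter> (V \<inter> \<psi> -` A) \<in> sets borel" using W a.preimage_borel[OF A] by auto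
    have "emeasure (distr (density lborel (\<lambda>u. ennreal (?f u))) borel \<psi>0) A = emeasure (density lborel (\<lambda>u. ennreal (?f u))) (\<psi>0 -` A)"
      using A \<psi>0 by (subst emeasure_distr) (auto simp: measurable_def)
    also have "\<dots> = (\<integral>\<^sup>+u. ennreal (?f u) * indicator (\<psi>0 -` A) u \<partial>lborel)"
      using f measurable_sets[OF \<psi>0 A] by (subst emeasure_density) auto
    also have "\<dots> = (\<integral>\<^sup>+u. ennreal (sqrt (det (gram \<psi> u))) * indicator (W \<inter> (V \<inter> \<psi> -` A)) u \<partial>lborel)"
      using W(2) by (intro nn_integral_cong) (auto simp: indicator_def \<psi>0_def a.density_def)
    also have "\<dots> = emeasure \<nu> (\<psi> ` (W \<inter> (V \<inter> \<psi> -` A)))"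
      using C(2) by (intro emeasure_\<nu>_chart[OF ch WA, symmetric]) (auto simp: W_def)
    also have "\<psi> ` (W \<inter> (V \<inter> \<psi> -` A)) = C \<inter> A" using C(3) by (auto simp: W_def)
    also have "emeasure \<nu> (C \<inter> A) = emeasure (density \<nu> (indicator C)) A"
      using A C(1) by (simp add: emeasure_restricted)
    also have "density \<nu> (indicator C) = density \<nu> (\<lambda>p. ennreal (indicator C p))"
      by (intro arg_cong[where f = "density \<nu>"]) (auto simp: indicator_def fun_eq_iff)
    finally show "emeasure (distr (density lborel (\<lambda>u. ennreal (?f u))) borel \<psi>0) A = emeasure (density \<nu> (\<lambda>p. ennreal (indicator C p))) A" .
  qed simp
  have "(\<integral>p. indicator C p * F p \<partial>\<nu>) = (\<integral>p. F p \<partial>density \<nu> (\<lambda>p. ennreal (indicator C p)))"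
    using F C(1) by (subst integral_density) auto
  also have "\<dots> = (\<integral>u. F (\<psi>0 u) \<partial>density lborel (\<lambda>u. ennreal (?f u)))"
    unfolding eq[symmetric] using F \<psi>0 by (subst integral_distr) auto
  also have "\<dots> = (\<integral>u. ?f u *\<^sub>R F (\<psi>0 u) \<partial>lborel)"
    using f fpos F \<psi>0 by (subst integral_density) auto
  also have "\<dots> = (\<integral>u. indicator (V \<inter> \<psi> -` C) u * (sqrt (det (gram \<psi> u)) * F (\<psi> u)) \<partial>lborel)"
    by (intro Bochner_Integration.integral_cong) (auto simp: W_def \<psi>0_def indicator_def a.density_def)
  finally show ?thesis .
qed

end

section \<open>Tangential gradient field and partition of unity\<close>

lemma (in chart) image_neighbourhood:
  assumes "p \<in> \<phi> ` U"
  shows "\<exists>r>0. \<Sigma> \<inter> cball p (2 * r) \<subseteq> \<phi> ` U"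
proof -
  obtain T where T: "open T" "\<phi> ` U = \<Sigma> \<inter> T" using image_openin by (auto simp: openin_open)
  then obtain e where e: "e > 0" "cball p e \<subseteq> T" using assms open_contains_cball by blast
  then show ?thesis using T(2) by (intro exI[of _ "e / 2"]) auto
qed

lemma hyp_submanifold_borel:
  assumes "hyp_submanifold T (\<Sigma> :: (real \<times> 'y::euclidean_space) set)"
  shows "\<Sigma> \<in> sets borel"
proof -
  have "half_space = fst -` {0<..} \<inter> (UNIV :: (real \<times> 'y) set)" by (auto simp: half_space_def)
  then have "open (half_space :: (real \<times> 'y) set)"
    using open_vimage[OF open_greaterThan[of 0], of "fst :: real \<times> 'y \<Rightarrow> real"] by (simp add: continuous_on_fst)
  moreover obtain C where "closed C" "\<Sigma> = half_space \<inter> C"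
    using assms by (auto simp: hyp_submanifold_def closedin_closed)
  ultimately show ?thesis by auto
qed

lemma atlas_exists:
  fixes \<Sigma> :: "(real \<times> 'y::euclidean_space) set"
  assumes sub: "hyp_submanifold TYPE('k::{finite,wellorder}) \<Sigma>" and K: "compact K" "K \<subseteq> \<Sigma>"
  shows "\<exists>N c r U (\<phi> :: nat \<Rightarrow> real ^ 'k::_ \<Rightarrow> real \<times> 'y). atlas \<Sigma> K N c r U \<phi>"
proof -
  have "\<forall>p\<in>K. \<exists>x. case x of (U, \<phi> :: real ^ 'k::_ \<Rightarrow> real \<times> 'y, r) \<Rightarrow> chart \<Sigma> U \<phi> \<and> 0 < r \<and> \<Sigma> \<inter> cball p (2 * r) \<subseteq> \<phi> ` U"
  proof
    fix p assume p: "p \<in> K"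
    obtain U and \<phi> :: "real ^ 'k::_ \<Rightarrow> real \<times> 'y" where *: "local_param \<Sigma> U \<phi>" "p \<in> \<phi> ` U"
      using sub p K(2) unfolding hyp_submanifold_def by blast
    have ch: "chart \<Sigma> U \<phi>" using sub *(1) by unfold_locales (auto simp: hyp_submanifold_def)
    obtain r where "0 < r" "\<Sigma> \<inter> cball p (2 * r) \<subseteq> \<phi> ` U"
      using chart.image_neighbourhood[OF ch *(2)] by blast
    then show "\<exists>x. case x of (U, \<phi> :: real ^ 'k::_ \<Rightarrow> real \<times> 'y, r) \<Rightarrow> chart \<Sigma> U \<phi> \<and> 0 < r \<and> \<Sigma> \<inter> cball p (2 * r) \<subseteq> \<phi> ` U"
      using ch by (intro exI[of _ "(U, \<phi>, r)"]) simp
  qed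
  from bchoice[OF this] obtain X :: "real \<times> 'y \<Rightarrow> (real ^ 'k::_) set \<times> (real ^ 'k::_ \<Rightarrow> real \<times> 'y) \<times> real"
    where X: "\<forall>p\<in>K. case X p of (U, \<phi>, r) \<Rightarrow> chart \<Sigma> U \<phi> \<and> 0 < r \<and> \<Sigma> \<inter> cball p (2 * r) \<subseteq> \<phi> ` U"
    by blast
  let ?U = "\<lambda>p. fst (X p)" and ?\<phi> = "\<lambda>p. fst (snd (X p))" and ?r = "\<lambda>p. snd (snd (X p))"
  have X': "chart \<Sigma> (?U p) (?\<phi> p)" "0 < ?r p" "\<Sigma> \<inter> cball p (2 * ?r p) \<subseteq> ?\<phi> p ` ?U p" if "p \<in> K" for p
    using bspec[OF X that] by (auto simp: case_prod_unfold)
  have "K \<subseteq> (\<Union>p\<in>K. ball p (?r p))" using X'(2) by force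
  then obtain D where D: "D \<subseteq> K" "finite D" "K \<subseteq> (\<Union>p\<in>D. ball p (?r p))"
    by (rule compactE_image[OF K(1), rotated]) auto
  obtain h where h: "bij_betw h {0..<card D} D" using ex_bij_betw_nat_finite[OF D(2)] by blast
  have hK: "h j \<in> K" if "j < card D" for j using bij_betwE[OF h] that D(1) by auto
  have "atlas \<Sigma> K (card D) h (\<lambda>j. ?r (h j)) (\<lambda>j. ?U (h j)) (\<lambda>j. ?\<phi> (h j))"
  proof (rule atlas.intro)
    show "K \<subseteq> (\<Union>j<card D. ball (h j) (?r (h j)))"
    proof -
      have "h ` {..<card D} = D" using bij_betw_imp_surj_on[OF h] by (simp add: atLeast0LessThan)
      with D(3) have "K \<subseteq> (\<Union>p\<in>h ` {..<card D}. ball p (?r p))" by (simp only:)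
      then show ?thesis by (simp only: image_image)
    qed
  qed (use X' hK K hyp_submanifold_borel[OF sub] in auto)
  then show ?thesis by blast
qed

text \<open>\<open>vertical_tangent\<close> as a field on \<Sigma>, so that contributions of
  different charts can be added under one integral. The choice of the chart is immaterial by
  \<open>vertical_tangent_trans\<close>.\<close>

definition tangent_field ::
    "'k::{finite,wellorder} itself \<Rightarrow> (real \<times> 'y::euclidean_space) set \<Rightarrow> real \<times> 'y \<Rightarrow> real \<times> 'y" where
  "tangent_field _ \<Sigma> p = (SOME t. \<exists>V (\<phi> :: (real, 'k) vec \<Rightarrow> real \<times> 'y) u.
     chart \<Sigma> V \<phi> \<and> u \<in> V \<and> \<phi> u = p \<and> t = vertical_tangent \<phi> u)"

context chart
begin

lemma tangent_field_param:
  assumes "u \<in> U"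
  shows "tangent_field TYPE('k) \<Sigma> (\<phi> u) = vertical_tangent \<phi> u"
proof -
  let ?P = "\<lambda>t. \<exists>V (\<psi> :: (real, 'k) vec \<Rightarrow> real \<times> 'y) v. chart \<Sigma> V \<psi> \<and> v \<in> V \<and> \<psi> v = \<phi> u \<and> t = vertical_tangent \<psi> v"
  have "?P (vertical_tangent \<phi> u)" using chart_axioms assms by blast
  then have "?P (tangent_field TYPE('k) \<Sigma> (\<phi> u))"
    unfolding tangent_field_def by (rule someI)
  then obtain V and \<psi> :: "(real, 'k) vec \<Rightarrow> real \<times> 'y" and v where
    *: "chart \<Sigma> V \<psi>" "v \<in> V" "\<psi> v = \<phi> u" "tangent_field TYPE('k) \<Sigma> (\<phi> u) = vertical_tangent \<psi> v" by blast
  interpret c2: chart \<Sigma> V \<psi> by (rule *(1))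
  interpret two_charts \<Sigma> U V \<phi> \<psi> by unfold_locales
  have im: "\<phi> u \<in> \<psi> ` V" using * by force
  have "trans u = v" using * by (simp add: trans_def flip: *(3))
  with vertical_tangent_trans[OF assms im] * show ?thesis by simp
qed

lemma continuous_tangent_field:
  assumes "p \<in> \<phi> ` U"
  shows "continuous (at p within \<Sigma>) (tangent_field TYPE('k) \<Sigma>)"
proof -
  obtain T where T: "open T" "\<phi> ` U = \<Sigma> \<inter> T" using image_openin by (auto simp: openin_open)
  have "continuous_on (\<phi> ` U) (\<lambda>p. vertical_tangent \<phi> (coord p))"
    by (rule continuous_on_compose2[OF continuous_vertical_tangent continuous_coord]) (auto simp: coord_in)
  then have "continuous_on (\<phi> ` U) (tangent_field TYPE('k) \<Sigma>)"
    by (rule continuous_on_eq) (auto simp: tangent_field_param)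
  then have "continuous (at p within \<Sigma> \<inter> T) (tangent_field TYPE('k) \<Sigma>)"
    using assms T(2) by (simp add: continuous_on_eq_continuous_within)
  moreover have "at p within \<Sigma> \<inter> T = at p within \<Sigma>"
    using T assms by (intro at_within_nhd[of p T]) auto
  ultimately show ?thesis by simp
qed

end

section \<open>Continuously differentiable cut-offs and a partition of unity\<close>

definition C1_deriv :: "('a::real_normed_vector \<Rightarrow> real) \<Rightarrow> ('a \<Rightarrow> 'a \<Rightarrow> real) \<Rightarrow> bool" where
  "C1_deriv f f' \<longleftrightarrow> (\<forall>p. (f has_derivative f' p) (at p)) \<and> (\<forall>v. continuous_on UNIV (\<lambda>p. f' p v))"

lemma C1_deriv_has_derivative: "C1_deriv f f' \<Longrightarrow> (f has_derivative f' p) (at p)"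
  and C1_deriv_continuous_deriv: "C1_deriv f f' \<Longrightarrow> continuous_on UNIV (\<lambda>p. f' p v)"
  by (simp_all add: C1_deriv_def)

lemma C1_deriv_continuous: "C1_deriv f f' \<Longrightarrow> continuous_on UNIV f"
  unfolding C1_deriv_def by (intro continuous_at_imp_continuous_on ballI) (blast intro: has_derivative_continuous)

lemma C1_deriv_const: "C1_deriv (\<lambda>_. c) (\<lambda>_ _. 0)"
  by (simp add: C1_deriv_def)

lemma C1_deriv_diff:
  assumes "C1_deriv f f'" "C1_deriv g g'"
  shows "C1_deriv (\<lambda>p. f p - g p) (\<lambda>p v. f' p v - g' p v)"
  using assms unfolding C1_deriv_def by (auto intro!: has_derivative_diff continuous_intros)

lemma C1_deriv_mult:
  assumes "C1_deriv f f'" "C1_deriv g g'"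
  shows "C1_deriv (\<lambda>p. f p * g p) (\<lambda>p v. f p * g' p v + f' p v * g p)"
  using assms C1_deriv_continuous[OF assms(1)] C1_deriv_continuous[OF assms(2)]
  unfolding C1_deriv_def by (auto intro!: has_derivative_mult continuous_intros)

lemma C1_deriv_prod:
  assumes "finite I" "\<And>i. i \<in> I \<Longrightarrow> \<exists>f'. C1_deriv (f i) f'"
  shows "\<exists>f'. C1_deriv (\<lambda>p. \<Prod>i\<in>I. f i p) f'"
  using assms
proof (induction I rule: finite_induct)
  case empty
  then show ?case using C1_deriv_const[of 1] by auto
next
  case (insert i I)
  then obtain f1 f2 where "C1_deriv (f i) f1" "C1_deriv (\<lambda>p. \<Prod>i\<in>I. f i p) f2" by blast
  from C1_deriv_mult[OF this] insert show ?case by auto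
qed

lemma C1_deriv_compose:
  fixes g g' :: "real \<Rightarrow> real"
  assumes f: "C1_deriv f f'" and g: "\<And>y. (g has_real_derivative g' y) (at y)" and cont: "continuous_on UNIV g'"
  shows "C1_deriv (\<lambda>p. g (f p)) (\<lambda>p v. g' (f p) * f' p v)"
  unfolding C1_deriv_def
proof (intro conjI allI)
  fix p
  have "(f has_derivative f' p) (at p)" using f by (simp add: C1_deriv_def)
  from has_derivative_compose[OF this g[of "f p", unfolded has_field_derivative_def]]
  show "((\<lambda>p. g (f p)) has_derivative (\<lambda>v. g' (f p) * f' p v)) (at p)" .
next
  fix v
  show "continuous_on UNIV (\<lambda>p. g' (f p) * f' p v)"
    using f C1_deriv_continuous[OF f] unfolding C1_deriv_def
    by (intro continuous_on_mult continuous_on_compose2[OF cont]) auto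
qed

lemma C1_deriv_eq_0:
  assumes "C1_deriv f f'" "open S" "p \<in> S" "\<And>q. q \<in> S \<Longrightarrow> f q = c"
  shows "f' p v = 0"
proof -
  have "(f has_derivative f' p) (at p)" using assms(1) by (simp add: C1_deriv_def)
  moreover have "(f has_derivative (\<lambda>_. 0)) (at p)"
    by (rule has_derivative_transform_within_open[OF has_derivative_const[of c] assms(2,3)]) (simp add: assms(4))
  ultimately have "f' p = (\<lambda>_. 0)" by (rule has_derivative_unique)
  then show ?thesis by simp
qed

text \<open>The squared positive part is the building block of the cut-offs: it is C^1, and the
  first variation takes only one derivative of the test function. At 0 the slope function is
  \<open>max 0\<close> itself.\<close>

lemma DERIV_max_0_square: "((\<lambda>y. (max 0 y)\<^sup>2) has_real_derivative 2 * max 0 y) (at (y::real))"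
proof -
  consider "y < 0" | "y = 0" | "y > 0" by linarith
  then show ?thesis
  proof cases
    case 1
    have "((\<lambda>y. 0) has_real_derivative 2 * max 0 y) (at y)" using 1 by simp
    then show ?thesis
      by (rule has_field_derivative_transform_within_open[where S = "{..<0}"]) (use 1 in auto)
  next
    case 2
    have "isCont (\<lambda>z::real. max 0 z) 0" by (intro continuous_intros)
    moreover have "(max 0 z)\<^sup>2 - (max 0 0)\<^sup>2 = max 0 z * (z - 0)" for z :: real
      by (auto simp: max_def power2_eq_square)
    ultimately show ?thesis unfolding 2 CARAT_DERIV by (intro exI[of _ "\<lambda>z. max 0 z"]) auto
  next
    case 3
    have "((\<lambda>y. y\<^sup>2) has_real_derivative 2 * max 0 y) (at y)" using 3 by (auto intro!: derivative_eq_intros)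
    then show ?thesis
      by (rule has_field_derivative_transform_within_open[where S = "{0<..}"]) (use 3 in auto)
  qed
qed

text \<open>With \<open>q y = (max 0 y)^2\<close> the bump is
  \<open>q (1 - q (|p - c|^2 / r^2 - 1))\<close>. Inside radius \<open>r\<close> the inner argument
  is nonpositive, so the value is \<open>q 1 = 1\<close>; outside radius \<open>2 r\<close> it is at
  least 1, so the outer argument is nonpositive.\<close>

lemma C1_bump_exists:
  fixes c :: "'a::real_inner"
  assumes "0 < r"
  shows "\<exists>b b'. C1_deriv b b' \<and> (\<forall>p\<in>ball c r. b p = 1) \<and> (\<forall>p. p \<notin> cball c (2 * r) \<longrightarrow> b p = 0)"
proof -
  let ?f = "\<lambda>p. inverse (r\<^sup>2) * ((p - c) \<bullet> (p - c)) - 1"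
  have f: "C1_deriv ?f (\<lambda>p v. inverse (r\<^sup>2) * ((p - c) \<bullet> v + v \<bullet> (p - c)))"
    unfolding C1_deriv_def
    by (auto intro!: derivative_eq_intros continuous_intros)
  have cont: "continuous_on UNIV (\<lambda>y::real. 2 * max 0 y)" by (intro continuous_intros)
  let ?q = "\<lambda>y::real. (max 0 y)\<^sup>2"
  have "C1_deriv (\<lambda>p. ?q (1 - ?q (?f p)))
      (\<lambda>p v. 2 * max 0 (1 - ?q (?f p)) * (0 - 2 * max 0 (?f p) * (inverse (r\<^sup>2) * ((p - c) \<bullet> v + v \<bullet> (p - c)))))"
    by (rule C1_deriv_compose[OF C1_deriv_diff[OF C1_deriv_const C1_deriv_compose[OF f DERIV_max_0_square cont]]
        DERIV_max_0_square cont])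
  moreover have "?q (1 - ?q (?f p)) = 1" if "p \<in> ball c r" for p
  proof -
    have "norm (p - c) < r" using that by (simp add: dist_norm norm_minus_commute)
    then have "(norm (p - c))\<^sup>2 \<le> r\<^sup>2" by (intro power_mono) auto
    then have "?f p \<le> 0" using assms by (simp add: power2_norm_eq_inner inverse_eq_divide divide_le_eq)
    then show ?thesis by (simp add: max_def)
  qed
  moreover have "?q (1 - ?q (?f p)) = 0" if "p \<notin> cball c (2 * r)" for p
  proof -
    have "2 * r \<le> norm (p - c)" using that by (simp add: dist_norm norm_minus_commute)
    then have "(2 * r)\<^sup>2 \<le> (norm (p - c))\<^sup>2" using assms by (intro power_mono) auto
    then have "4 * r\<^sup>2 \<le> (p - c) \<bullet> (p - c)" by (simp add: power_mult_distrib power2_norm_eq_inner)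
    moreover have "0 < r\<^sup>2" using assms by simp
    ultimately have "2 * r\<^sup>2 \<le> (p - c) \<bullet> (p - c)" by linarith
    then have "1 \<le> ?f p" using assms by (simp add: inverse_eq_divide le_divide_eq)
    then have "1 \<le> ?q (?f p)" by (simp add: max_def)
    then show ?thesis by (simp add: max_def)
  qed
  ultimately show ?thesis by blast
qed

text \<open>Instead of dividing by a sum, each bump is multiplied by the factors
  \<open>1 - b l\<close> of its predecessors. The sum telescopes to 1 minus the product of all
  factors, which is 1 wherever some bump is 1. This holds on an open set, so the derivatives sum to
  0 there.\<close>

lemma C1_partition_of_unity:
  fixes c :: "nat \<Rightarrow> 'a::real_inner"
  assumes r: "\<And>j. j < N \<Longrightarrow> 0 < r j"
  shows "\<exists>\<rho> \<rho>'. (\<forall>j<N. C1_deriv (\<rho> j) (\<rho>' j)) \<and>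
     (\<forall>j<N. \<forall>p. p \<notin> cball (c j) (2 * r j) \<longrightarrow> \<rho> j p = 0 \<and> (\<forall>v. \<rho>' j p v = 0)) \<and>
     (\<forall>p \<in> (\<Union>j<N. ball (c j) (r j)). (\<Sum>j<N. \<rho> j p) = 1 \<and> (\<forall>v. (\<Sum>j<N. \<rho>' j p v) = 0))"
proof -
  have "\<exists>b. j < N \<longrightarrow> (\<exists>b'. C1_deriv b b') \<and> (\<forall>p\<in>ball (c j) (r j). b p = 1) \<and> (\<forall>p. p \<notin> cball (c j) (2 * r j) \<longrightarrow> b p = 0)" for j
    using C1_bump_exists[OF r, of j "c j"] by blast
  then obtain b where b: "\<And>j. j < N \<Longrightarrow> \<exists>b'. C1_deriv (b j) b'" "\<And>j p. j < N \<Longrightarrow> p \<in> ball (c j) (r j) \<Longrightarrow> b j p = (1::real)"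
    "\<And>j p. j < N \<Longrightarrow> p \<notin> cball (c j) (2 * r j) \<Longrightarrow> b j p = 0" by metis
  define \<rho> where "\<rho> j p = b j p * (\<Prod>l<j. 1 - b l p)" for j p
  have "\<exists>\<rho>'. C1_deriv (\<rho> j) \<rho>'" if j: "j < N" for j
  proof -
    have "\<exists>f'. C1_deriv (\<lambda>p. 1 - b l p) f'" if l: "l < j" for l
    proof -
      obtain b' where "C1_deriv (b l) b'" using b(1)[of l] l j by auto
      from C1_deriv_diff[OF C1_deriv_const[of 1] this] show ?thesis by blast
    qed
    then obtain g' where "C1_deriv (\<lambda>p. \<Prod>l<j. 1 - b l p) g'"
      using C1_deriv_prod[of "{..<j}" "\<lambda>l p. 1 - b l p"] by auto
    moreover obtain b' where "C1_deriv (b j) b'" using b(1)[OF j] by blast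
    ultimately show ?thesis unfolding \<rho>_def[abs_def] using C1_deriv_mult by blast
  qed
  then obtain \<rho>' where \<rho>': "\<And>j. j < N \<Longrightarrow> C1_deriv (\<rho> j) (\<rho>' j)" by metis
  have supp: "\<rho> j p = 0" if "j < N" "p \<notin> cball (c j) (2 * r j)" for j p
    using b(3)[OF that] by (simp add: \<rho>_def)
  have supp': "\<rho>' j p v = 0" if "j < N" "p \<notin> cball (c j) (2 * r j)" for j p v
    using C1_deriv_eq_0[OF \<rho>'[OF that(1)], of "- cball (c j) (2 * r j)" p 0 v] supp[OF that(1)] that(2)
    by (auto simp: open_Compl)
  have telescope: "(\<Sum>j<n. \<rho> j p) = 1 - (\<Prod>l<n. 1 - b l p)" for n p
    by (induction n) (simp_all add: \<rho>_def algebra_simps)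
  have sum1: "(\<Sum>j<N. \<rho> j p) = 1" if p: "p \<in> (\<Union>j<N. ball (c j) (r j))" for p
  proof -
    obtain j where "j < N" "p \<in> ball (c j) (r j)" using p by blast
    then have "(\<Prod>l<N. 1 - b l p) = 0" using b(2) by (intro prod_zero) (auto simp del: mem_ball)
    then show ?thesis by (simp add: telescope)
  qed
  have sum0: "(\<Sum>j<N. \<rho>' j p v) = 0" if "p \<in> (\<Union>j<N. ball (c j) (r j))" for p v
  proof -
    have "((\<lambda>p. \<Sum>j<N. \<rho> j p) has_derivative (\<lambda>v. \<Sum>j<N. \<rho>' j p v)) (at p)"
      using \<rho>' by (intro has_derivative_sum) (auto simp: C1_deriv_def)
    moreover have "((\<lambda>p. \<Sum>j<N. \<rho> j p) has_derivative (\<lambda>_. 0)) (at p)"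
      by (rule has_derivative_transform_within_open[OF has_derivative_const[of 1], where s = "\<Union>j<N. ball (c j) (r j)"])
        (use that sum1 in auto)
    ultimately have "(\<lambda>v. \<Sum>j<N. \<rho>' j p v) = (\<lambda>_. 0)" by (rule has_derivative_unique)
    then show ?thesis by (rule fun_cong)
  qed
  show ?thesis
    by (rule exI[of _ \<rho>], rule exI[of _ \<rho>'], intro conjI allI impI ballI)
      (fact \<rho>' supp supp' sum1 sum0)+
qed

section \<open>First variation formula on the compact piece\<close>

context atlas
begin

lemma K_chart:
  assumes "p \<in> K"
  shows "\<exists>j<N. p \<in> \<phi> j ` U j"
proof -
  obtain j where "j < N" "p \<in> piece j" using assms piece_Union by blast
  then show ?thesis using piece_subset by blast
qed

lemma integrable_on_K:
  fixes F :: "real \<times> 'y \<Rightarrow> real"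
  assumes cont: "continuous_on K F" and C: "C \<in> sets borel" "C \<subseteq> K"
  shows "integrable \<nu> (\<lambda>p. indicator C p * F p)"
proof -
  interpret finite_measure \<nu> by (rule finite_measure_\<nu>)
  have "bounded (F ` K)" by (rule compact_imp_bounded[OF compact_continuous_image[OF cont K(1)]])
  then obtain B where "\<forall>y\<in>F ` K. norm y \<le> B" unfolding bounded_iff by blast
  then have B: "\<bar>F p\<bar> \<le> B" if "p \<in> K" for p using that by simp
  have KF: "(\<lambda>p. indicator K p * F p) \<in> borel_measurable borel"
    using borel_measurable_continuous_on_restrict[OF cont] K_borel by (simp add: borel_measurable_restrict_space_iff)
  have "(\<lambda>p. indicator C p * (indicator K p * F p)) \<in> borel_measurable borel"
    using KF C(1) by measurable
  moreover have "indicator C p * (indicator K p * F p) = indicator C p * F p" for p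
    using C(2) by (auto simp: indicator_def)
  ultimately have "(\<lambda>p. indicator C p * F p) \<in> borel_measurable \<nu>" by (simp add: measurable_def)
  moreover have "\<bar>indicator C p * F p\<bar> \<le> max B 0" for p
    using B[of p] C(2) by (auto simp: indicator_def le_max_iff_disj)
  ultimately show ?thesis by (intro integrable_const_bound[of _ "max B 0"]) auto
qed

lemma continuous_on_tangent_field: "continuous_on K (tangent_field TYPE('k) \<Sigma>)"
  unfolding continuous_on_eq_continuous_within
proof
  fix p assume p: "p \<in> K"
  obtain j where j: "j < N" "p \<in> \<phi> j ` U j" using K_chart[OF p] by blast
  then have "continuous (at p within \<Sigma>) (tangent_field TYPE('k) \<Sigma>)"
    by (intro chart.continuous_tangent_field[OF chart])
  then show "continuous (at p within K) (tangent_field TYPE('k) \<Sigma>)"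
    using K(2) continuous_within_subset by blast
qed

lemma tangent_field_bounds:
  assumes "p \<in> K"
  shows "0 \<le> fst (tangent_field TYPE('k) \<Sigma> p)" "fst (tangent_field TYPE('k) \<Sigma> p) \<le> 1"
proof -
  obtain j u where j: "j < N" "u \<in> U j" "p = \<phi> j u" using K_chart[OF assms] by blast
  interpret chart \<Sigma> "U j" "\<phi> j" by (rule chart[OF j(1)])
  show "0 \<le> fst (tangent_field TYPE('k) \<Sigma> p)" "fst (tangent_field TYPE('k) \<Sigma> p) \<le> 1"
    using vertical_tangent_bounds[OF j(2)] by (simp_all add: j(3) tangent_field_param[OF j(2)])
qed

text \<open>\<open>integral_divergence\<close> transported to \<nu>: since \<open>C\<close> is
  compact and lies in one chart, its coordinate image is a compact support for the
  integrand.\<close>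

lemma first_variation_chart:
  fixes \<omega> :: "real \<times> 'y \<Rightarrow> real"
  assumes H: "\<And>u. u \<in> U j \<Longrightarrow> mean_curvature (\<phi> j) u = 0" and j: "j < N"
    and \<omega>: "\<And>p. p \<in> \<Sigma> \<Longrightarrow> (\<omega> has_derivative \<omega>' p) (at p)"
    and cont: "\<And>v. continuous_on \<Sigma> (\<lambda>p. \<omega>' p v)"
    and C: "compact C" "C \<subseteq> K" "C \<subseteq> \<phi> j ` U j"
    and supp: "\<And>p. p \<in> \<Sigma> - C \<Longrightarrow> \<omega> p = 0" "\<And>p v. p \<in> \<Sigma> - C \<Longrightarrow> \<omega>' p v = 0"
  defines "F \<equiv> \<lambda>p. - real CARD('k) * \<omega> p / fst p + \<omega>' p (tangent_field TYPE('k) \<Sigma> p)"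
  shows "continuous_on K F" "(\<integral>p. indicator C p * F p \<partial>\<nu>) = 0"
proof -
  interpret chart \<Sigma> "U j" "\<phi> j" by (rule chart[OF j])
  have cont\<omega>: "continuous_on \<Sigma> \<omega>"
    using \<omega> by (intro continuous_at_imp_continuous_on ballI) (blast intro: has_derivative_continuous)
  have fst_pos: "fst p > 0" if "p \<in> \<Sigma>" for p using half_space that by (auto simp: half_space_def)
  show contF: "continuous_on K F"
    unfolding F_def
  proof (intro continuous_on_add continuous_on_divide continuous_on_mult continuous_on_const)
    show "continuous_on K \<omega>" by (rule continuous_on_subset[OF cont\<omega> K(2)])
    show "continuous_on K (\<lambda>p. \<omega>' p (tangent_field TYPE('k) \<Sigma> p))"
    proof (rule continuous_on_linear_family[OF _ continuous_on_tangent_field])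
      show "continuous_on K (\<lambda>p. \<omega>' p b)" for b by (rule continuous_on_subset[OF cont K(2)])
      show "linear (\<omega>' p)" if "p \<in> K" for p by (rule has_derivative_linear[OF \<omega>]) (use that K(2) in blast)
    qed
  qed (use fst_pos K(2) in \<open>force intro: continuous_on_fst continuous_on_id\<close>)+
  have C_borel: "C \<in> sets borel" by (rule borel_compact[OF C(1)])
  \<comment> \<open>\<open>F\<close> is controlled only on \<open>K\<close>; cutting it off there
    gives the Borel function required by \<open>integral_\<nu>_chart\<close>.\<close>
  define F0 where "F0 p = indicator K p * F p" for p
  have F0: "F0 \<in> borel_measurable borel"
    using borel_measurable_continuous_on_restrict[OF contF] K_borel
    unfolding F0_def[abs_def] by (simp add: borel_measurable_restrict_space_iff)
  define D where "D = coord ` C"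
  have D: "compact D" "D \<subseteq> U j"
    unfolding D_def using C coord_in
    by (auto intro!: compact_continuous_image continuous_on_subset[OF continuous_coord])
  have D_eq: "D = U j \<inter> \<phi> j -` C" unfolding D_def by (rule coord_image_eq[OF C(3)])
  have "(\<integral>p. indicator C p * F p \<partial>\<nu>) = (\<integral>p. indicator C p * F0 p \<partial>\<nu>)"
    using C(2) by (intro Bochner_Integration.integral_cong) (auto simp: F0_def indicator_def)
  also have "\<dots> = (\<integral>u. indicator (U j \<inter> \<phi> j -` C) u * (sqrt (det (gram (\<phi> j) u)) * F0 (\<phi> j u)) \<partial>lborel)"
    by (rule integral_\<nu>_chart[OF chart[OF j] C_borel C(2,3) F0])
  also have "\<dots> = (\<integral>u. indicator (U j) u * (density u *
      (- real CARD('k) * \<omega> (\<phi> j u) / fst (\<phi> j u) + \<omega>' (\<phi> j u) (vertical_tangent (\<phi> j) u))) \<partial>lborel)"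
  proof (intro Bochner_Integration.integral_cong refl)
    fix u
    show "indicator (U j \<inter> \<phi> j -` C) u * (sqrt (det (gram (\<phi> j) u)) * F0 (\<phi> j u))
        = indicator (U j) u * (density u * (- real CARD('k) * \<omega> (\<phi> j u) / fst (\<phi> j u) + \<omega>' (\<phi> j u) (vertical_tangent (\<phi> j) u)))"
    proof (cases "u \<in> U j")
      case True
      then have S: "\<phi> j u \<in> \<Sigma>" using image_subset by blast
      show ?thesis
      proof (cases "\<phi> j u \<in> C")
        case False
        then show ?thesis using supp[of "\<phi> j u"] S True by simp
      next
        case C': True
        then have "\<phi> j u \<in> K" using C(2) by blast
        then show ?thesis using True C' by (simp add: F0_def F_def density_def tangent_field_param)
      qed
    qed simp
  qed
  also have "\<dots> = 0"
  proof (rule integral_divergence[OF H _ _ D])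
    show "(\<omega> has_derivative \<omega>' p) (at p)" if "p \<in> \<phi> j ` U j" for p using \<omega> that image_subset by blast
    show "continuous_on (\<phi> j ` U j) (\<lambda>p. \<omega>' p v)" for v by (rule continuous_on_subset[OF cont image_subset])
    show "\<omega> (\<phi> j u) = 0" "\<omega>' (\<phi> j u) v = 0" if "u \<in> U j - D" for u v
      using supp[of "\<phi> j u"] that image_subset unfolding D_eq by blast+
  qed
  finally show "(\<integral>p. indicator C p * F p \<partial>\<nu>) = 0" .
qed

text \<open>The weak form of \<open>Delta (1/x) = k / x\<close>. The chart formula is applied to
  each \<open>\<rho> j * \<omega>\<close>; in the sum, the terms with derivatives of
  \<open>\<rho> j\<close> cancel on \<open>K\<close>, where these derivatives add up to 0.\<close>

lemma first_variation:
  fixes \<omega> :: "real \<times> 'y \<Rightarrow> real"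
  assumes H: "\<And>j u. j < N \<Longrightarrow> u \<in> U j \<Longrightarrow> mean_curvature (\<phi> j) u = 0"
    and \<omega>: "\<And>p. p \<in> \<Sigma> \<Longrightarrow> (\<omega> has_derivative \<omega>' p) (at p)"
    and cont: "\<And>v. continuous_on \<Sigma> (\<lambda>p. \<omega>' p v)"
    and supp: "\<And>p. p \<in> \<Sigma> - K \<Longrightarrow> \<omega> p = 0" "\<And>p v. p \<in> \<Sigma> - K \<Longrightarrow> \<omega>' p v = 0"
  shows "integrable \<nu> (\<lambda>p. indicator K p * (- real CARD('k) * \<omega> p / fst p + \<omega>' p (tangent_field TYPE('k) \<Sigma> p)))"
    "(\<integral>p. indicator K p * (- real CARD('k) * \<omega> p / fst p + \<omega>' p (tangent_field TYPE('k) \<Sigma> p)) \<partial>\<nu>) = 0"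
proof -
  obtain \<rho> \<rho>' where \<rho>: "\<And>j. j < N \<Longrightarrow> C1_deriv (\<rho> j) (\<rho>' j)"
    and \<rho>_supp: "\<And>j p. j < N \<Longrightarrow> p \<notin> cball (c j) (2 * r j) \<Longrightarrow> \<rho> j p = 0"
      "\<And>j p v. j < N \<Longrightarrow> p \<notin> cball (c j) (2 * r j) \<Longrightarrow> \<rho>' j p v = 0"
    and \<rho>_sum: "\<And>p. p \<in> (\<Union>j<N. ball (c j) (r j)) \<Longrightarrow> (\<Sum>j<N. \<rho> j p) = 1"
      "\<And>p v. p \<in> (\<Union>j<N. ball (c j) (r j)) \<Longrightarrow> (\<Sum>j<N. \<rho>' j p v) = 0"
    using C1_partition_of_unity[of N r c] r_pos by blast
  define C where "C j = K \<inter> cball (c j) (2 * r j)" for j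
  define \<omega>\<rho> where "\<omega>\<rho> j p = \<rho> j p * \<omega> p" for j p
  define \<omega>\<rho>' where "\<omega>\<rho>' j p v = \<rho> j p * \<omega>' p v + \<rho>' j p v * \<omega> p" for j p v
  define F where "F j p = - real CARD('k) * \<omega>\<rho> j p / fst p + \<omega>\<rho>' j p (tangent_field TYPE('k) \<Sigma> p)" for j p
  have cont\<omega>: "continuous_on \<Sigma> \<omega>"
    using \<omega> by (intro continuous_at_imp_continuous_on ballI) (blast intro: has_derivative_continuous)
  have C: "compact (C j)" "C j \<subseteq> K" "C j \<in> sets borel" for j
    using K(1) by (auto simp: C_def compact_Int_closed intro!: borel_compact)
  have C_sub: "C j \<subseteq> \<phi> j ` U j" if "j < N" for j
    using inside[OF that] K(2) by (auto simp: C_def)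
  have F: "continuous_on K (F j)" "(\<integral>p. indicator (C j) p * F j p \<partial>\<nu>) = 0" if j: "j < N" for j
  proof -
    have 1: "(\<omega>\<rho> j has_derivative \<omega>\<rho>' j p) (at p)" if "p \<in> \<Sigma>" for p
      unfolding \<omega>\<rho>_def[abs_def] \<omega>\<rho>'_def[abs_def]
      by (rule has_derivative_mult[OF C1_deriv_has_derivative[OF \<rho>[OF j]] \<omega>[OF that]])
    have 2: "continuous_on \<Sigma> (\<lambda>p. \<omega>\<rho>' j p v)" for v
      unfolding \<omega>\<rho>'_def
      by (intro continuous_on_add continuous_on_mult cont cont\<omega>
          continuous_on_subset[OF C1_deriv_continuous[OF \<rho>[OF j]]]
          continuous_on_subset[OF C1_deriv_continuous_deriv[OF \<rho>[OF j]]] subset_UNIV)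
    have 3: "\<omega>\<rho> j p = 0" "\<omega>\<rho>' j p v = 0" if p: "p \<in> \<Sigma> - C j" for p v
    proof -
      have "p \<in> \<Sigma> - K \<or> p \<notin> cball (c j) (2 * r j)" using p by (simp add: C_def)
      then have "(\<omega> p = 0 \<and> \<omega>' p v = 0) \<or> (\<rho> j p = 0 \<and> \<rho>' j p v = 0)"
        using supp[of p] \<rho>_supp[OF j, of p] by blast
      then show "\<omega>\<rho> j p = 0" "\<omega>\<rho>' j p v = 0" by (auto simp: \<omega>\<rho>_def \<omega>\<rho>'_def)
    qed
    show "continuous_on K (F j)" "(\<integral>p. indicator (C j) p * F j p \<partial>\<nu>) = 0"
      unfolding F_def[abs_def]
      by (rule first_variation_chart[OF H[OF j] j 1 2 C(1,2) C_sub[OF j] 3]; assumption)+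
  qed
  have eq: "(\<Sum>j<N. indicator (C j) p * F j p)
      = indicator K p * (- real CARD('k) * \<omega> p / fst p + \<omega>' p (tangent_field TYPE('k) \<Sigma> p))" for p
  proof (cases "p \<in> K")
    case True
    let ?t = "tangent_field TYPE('k) \<Sigma> p"
    have "indicator (C j) p * F j p = F j p" if "j < N" for j
      using True \<rho>_supp(1)[OF that, of p] \<rho>_supp(2)[OF that, of p ?t] by (auto simp: C_def F_def \<omega>\<rho>_def \<omega>\<rho>'_def indicator_def)
    then have "(\<Sum>j<N. indicator (C j) p * F j p) = (\<Sum>j<N. F j p)" by (intro sum.cong refl) blast
    also have "\<dots> = (\<Sum>j<N. \<rho> j p) * (- real CARD('k) * \<omega> p / fst p + \<omega>' p ?t) + (\<Sum>j<N. \<rho>' j p ?t) * \<omega> p"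
      unfolding F_def \<omega>\<rho>_def \<omega>\<rho>'_def sum_distrib_right sum.distrib[symmetric]
      by (intro sum.cong refl) (simp add: algebra_simps)
    also have "\<dots> = - real CARD('k) * \<omega> p / fst p + \<omega>' p ?t"
    proof -
      have "p \<in> (\<Union>j<N. ball (c j) (r j))" using cover True by blast
      from \<rho>_sum[OF this] show ?thesis by simp
    qed
    finally show ?thesis using True by simp
  next
    case False
    then show ?thesis using C(2) by (auto simp: indicator_def intro!: sum.neutral)
  qed
  have "(\<integral>p. (\<Sum>j<N. indicator (C j) p * F j p) \<partial>\<nu>) = (\<Sum>j<N. \<integral>p. indicator (C j) p * F j p \<partial>\<nu>)"
    using F(1) C by (intro Bochner_Integration.integral_sum integrable_on_K) auto
  also have "\<dots> = 0" using F(2) by simp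
  finally show "(\<integral>p. indicator K p * (- real CARD('k) * \<omega> p / fst p + \<omega>' p (tangent_field TYPE('k) \<Sigma> p)) \<partial>\<nu>) = 0"
    unfolding eq .
  have "integrable \<nu> (\<lambda>p. \<Sum>j<N. indicator (C j) p * F j p)"
    using F(1) C by (intro Bochner_Integration.integrable_sum integrable_on_K) auto
  then show "integrable \<nu> (\<lambda>p. indicator K p * (- real CARD('k) * \<omega> p / fst p + \<omega>' p (tangent_field TYPE('k) \<Sigma> p)))"
    unfolding eq .
qed

end

section \<open>Test functions of the height\<close>

lemma antiderivative_exists:
  fixes g :: "real \<Rightarrow> real"
  assumes "continuous_on {c..} g"
  shows "\<exists>G. \<forall>s>c. (G has_real_derivative g s) (at s)"
proof (intro exI allI impI)
  fix s assume s: "c < s"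
  have "continuous_on {c..s + 1} g" by (rule continuous_on_subset[OF assms]) auto
  from integral_has_real_derivative[OF this, of s] s
  have "((\<lambda>x. integral {c..x} g) has_real_derivative g s) (at s within {c..s + 1})" by simp
  then show "((\<lambda>x. integral {c..x} g) has_real_derivative g s) (at s)"
    using s by (simp add: at_within_Icc_at)
qed

lemma DERIV_le_imp_le:
  fixes f g :: "real \<Rightarrow> real"
  assumes "a \<le> b" and f: "\<And>x. a \<le> x \<Longrightarrow> x \<le> b \<Longrightarrow> (f has_real_derivative f' x) (at x)"
    and g: "\<And>x. a \<le> x \<Longrightarrow> x \<le> b \<Longrightarrow> (g has_real_derivative g' x) (at x)"
    and le: "\<And>x. a \<le> x \<Longrightarrow> x \<le> b \<Longrightarrow> f' x \<le> g' x"
  shows "f b - f a \<le> g b - g a"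
proof -
  have "(\<lambda>x. g x - f x) a \<le> (\<lambda>x. g x - f x) b"
  proof (rule DERIV_nonneg_imp_nondecreasing[OF assms(1)])
    fix x assume "a \<le> x" "x \<le> b"
    then show "\<exists>y. ((\<lambda>x. g x - f x) has_real_derivative y) (at x) \<and> 0 \<le> y"
      using DERIV_diff[OF g f] le by (intro exI[of _ "g' x - f' x"]) simp
  qed
  then show ?thesis by simp
qed

section \<open>The weight s^(k-2) and its primitive Q0\<close>

locale power_weight =
  fixes k :: nat and m :: "real \<Rightarrow> real"
  assumes k: "1 \<le> k"
  defines "m \<equiv> \<lambda>s. s powi (int k - 2)"
begin

lemma m_pos: "0 < s \<Longrightarrow> 0 < m s"
  by (simp add: m_def)

lemma m_mult:
  assumes "0 < s"
  shows "s * m s = s ^ (k - 1)" "s\<^sup>2 * m s = s ^ k"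
proof -
  have "s * m s = s powi (1 + (int k - 2))"
    unfolding m_def using assms by (subst power_int_add) auto
  also have "1 + (int k - 2) = int (k - 1)" using k by simp
  finally show 1: "s * m s = s ^ (k - 1)" by (simp only: power_int_of_nat)
  have "s ^ k = s * s ^ (k - 1)" using k by (metis Suc_diff_1 Suc_le_lessD One_nat_def power_Suc)
  then show "s\<^sup>2 * m s = s ^ k" by (simp only: power2_eq_square mult.assoc 1)
qed

lemma continuous_m: "0 < c \<Longrightarrow> continuous_on {c..} m"
  unfolding m_def by (intro continuous_intros) auto

lemma power_deriv:
  assumes "0 < s"
  shows "((\<lambda>r. r ^ (k - 1)) has_real_derivative real (k - 1) * m s) (at s)"
proof (cases "k = 1")
  case False
  have "s * (s ^ (k - 1 - Suc 0)) = s ^ (k - 1)"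
    using False k by (metis Suc_diff_Suc One_nat_def diff_Suc_1 le_neq_implies_less minus_nat.diff_0 power_Suc)
  then have "s ^ (k - 1 - Suc 0) = m s" using m_mult(1)[OF assms] assms by (metis mult_left_cancel less_irrefl)
  then show ?thesis using DERIV_pow[of "k - 1" s] by simp
qed simp

lemma Q0_at_start: "Q0 k a a = a ^ (k - 1) / real k"
  by (simp add: Q0_def)

text \<open>The margin from \<open>a / 2\<close> to \<open>a\<close> gives two-sided derivatives at
  \<open>a\<close> as well; the integral in \<open>Q0\<close> is oriented, so the fundamental
  theorem applies on both sides of \<open>a\<close>.\<close>

lemma Q0_deriv:
  assumes "0 < a" "a / 2 < s"
  shows "(Q0 k a has_real_derivative m s) (at s)"
proof -
  have cont: "continuous_on {a / 2..} m" using continuous_m assms(1) by simp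
  obtain P where P: "\<And>s. a / 2 < s \<Longrightarrow> (P has_real_derivative m s) (at s)"
    using antiderivative_exists[OF cont] by blast
  have eq: "Q0 k a t = P t - P a + a ^ (k - 1) / real k" if "a / 2 < t" for t
  proof -
    have "(LBINT s=a..t. m s) = P t - P a"
    proof (rule interval_integral_FTC_finite)
      show "continuous_on {min a t..max a t} m"
        by (rule continuous_on_subset[OF cont]) (use that assms(1) in auto)
      show "(P has_vector_derivative m x) (at x within {min a t..max a t})"
        if "min a t \<le> x" "x \<le> max a t" for x
        using P[of x] that \<open>a / 2 < t\<close> assms(1)
        by (auto simp: has_real_derivative_iff_has_vector_derivative[symmetric] min_def split: if_splits
            intro: has_field_derivative_at_within)
    qed
    then show ?thesis by (simp add: Q0_def m_def)
  qed
  have "((\<lambda>t. P t - P a + a ^ (k - 1) / real k) has_real_derivative m s) (at s)"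
    using P[OF assms(2)] by (auto intro!: derivative_eq_intros)
  then show ?thesis
    by (rule has_field_derivative_transform_within_open[where S = "{a / 2<..}"]) (use assms(2) eq in auto)
qed

text \<open>Equality holds at \<open>s = a\<close>, and the derivatives compare as
  \<open>(k-1) s^(k-2) \<le> k s^(k-2)\<close>. This is the inequality that makes the test function
  nonincreasing.\<close>

lemma Q0_ge:
  assumes "0 < a" "a \<le> s"
  shows "s ^ (k - 1) \<le> real k * Q0 k a s"
proof -
  have "s ^ (k - 1) - a ^ (k - 1) \<le> real k * Q0 k a s - real k * Q0 k a a"
  proof (rule DERIV_le_imp_le[OF assms(2), where f' = "\<lambda>s. real (k - 1) * m s" and g' = "\<lambda>s. real k * m s"])
    fix x assume x: "a \<le> x"
    then have "x > 0" "a / 2 < x" using assms(1) by auto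
    then show "((\<lambda>r. r ^ (k - 1)) has_real_derivative real (k - 1) * m x) (at x)"
      "((\<lambda>s. real k * Q0 k a s) has_real_derivative real k * m x) (at x)"
      "real (k - 1) * m x \<le> real k * m x"
      using power_deriv DERIV_cmult[OF Q0_deriv[OF assms(1)]] m_pos[of x] by (auto intro!: mult_right_mono)
  qed
  then show ?thesis using k by (simp add: Q0_at_start)
qed

lemma Q0_pos: "0 < a \<Longrightarrow> a \<le> s \<Longrightarrow> 0 < Q0 k a s"
  using Q0_ge[of a s] k by (metis less_le_trans zero_less_power zero_less_mult_pos of_nat_0_less_iff One_nat_def Suc_le_lessD)

end

text \<open>A cut-off that is 1 up to \<open>l\<close>, 0 from \<open>u\<close> on and linear in
  between. Continuity is enough, because the test function contains its integral.\<close>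

definition ramp :: "real \<Rightarrow> real \<Rightarrow> real \<Rightarrow> real" where
  "ramp l u s = max 0 (min 1 ((u - s) / (u - l)))"

lemma ramp_bounds: "0 \<le> ramp l u s" "ramp l u s \<le> 1"
  by (auto simp: ramp_def)

lemma ramp_eq_1: "l < u \<Longrightarrow> s \<le> l \<Longrightarrow> ramp l u s = 1"
  by (simp add: ramp_def min_def max_def field_simps)

lemma ramp_eq_0: "l < u \<Longrightarrow> u \<le> s \<Longrightarrow> ramp l u s = 0"
  using divide_nonpos_pos[of "u - s" "u - l"] by (simp add: ramp_def max_def min_def)

lemma ramp_antimono: "l < u \<Longrightarrow> s \<le> t \<Longrightarrow> ramp l u t \<le> ramp l u s"
  unfolding ramp_def by (intro max.mono min.mono divide_right_mono) auto

lemma continuous_ramp: "l < u \<Longrightarrow> continuous_on S (ramp l u)"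
  unfolding ramp_def by (intro continuous_intros) auto

section \<open>The test function\<close>

context power_weight
begin

text \<open>The numerator \<open>F\<close> solves \<open>F' = s^{k-2} \<chi>\<close> with the initial value of \<open>Q0\<close> at \<open>a\<close>,
  so it is \<open>Q0\<close> truncated at the cut-off.\<close>

lemma truncated_Q0_exists:
  assumes a: "0 < a" "a \<le> l" "l < u"
  obtains F where "\<And>s. a / 2 < s \<Longrightarrow> (F has_real_derivative m s * ramp l u s) (at s)"
    "\<And>s. a \<le> s \<Longrightarrow> s \<le> l \<Longrightarrow> F s = Q0 k a s"
    "\<And>s. a \<le> s \<Longrightarrow> F s \<le> Q0 k a s"
    "\<And>s. a \<le> s \<Longrightarrow> ramp l u s * Q0 k a s \<le> F s"
    "\<And>s t. a \<le> s \<Longrightarrow> s \<le> t \<Longrightarrow> F s \<le> F t"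
    "\<And>s. u \<le> s \<Longrightarrow> F s = F u"
proof -
  have "continuous_on {a / 2..} (\<lambda>s. m s * ramp l u s)"
    using a by (intro continuous_intros continuous_m continuous_ramp) auto
  then obtain G where G: "\<And>s. a / 2 < s \<Longrightarrow> (G has_real_derivative m s * ramp l u s) (at s)"
    using antiderivative_exists by blast
  define F where "F s = G s - G a + Q0 k a a" for s
  have F: "(F has_real_derivative m s * ramp l u s) (at s)" if "a / 2 < s" for s
    unfolding F_def[abs_def] using G[OF that] by (auto intro!: derivative_eq_intros)
  have Fa: "F a = Q0 k a a" by (simp add: F_def)
  have half: "a / 2 < x" "0 < m x" if "a \<le> x" for x using that a m_pos[of x] by auto
  have upper: "F s \<le> Q0 k a s" if "a \<le> s" for s
  proof -
    have "F s - F a \<le> Q0 k a s - Q0 k a a"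
      by (rule DERIV_le_imp_le[OF that F Q0_deriv[OF a(1)]])
        (use half ramp_bounds[of l u] in \<open>auto intro: mult_left_le less_imp_le\<close>)
    then show ?thesis using Fa by simp
  qed
  \<comment> \<open>The ramp is held at its value at the right end \<open>s\<close>, which is its
    minimum up to \<open>s\<close>, so the derivative of the left side is below that of
    \<open>F\<close>.\<close>
  have lower: "ramp l u s * Q0 k a s \<le> F s" if s: "a \<le> s" for s
  proof -
    have "ramp l u s * Q0 k a s - ramp l u s * Q0 k a a \<le> F s - F a"
      by (rule DERIV_le_imp_le[OF s DERIV_cmult[OF Q0_deriv[OF a(1)]] F])
        (use half ramp_antimono[OF a(3)] in \<open>auto simp: mult.commute[of "m _"] intro!: mult_right_mono less_imp_le\<close>)
    moreover have "ramp l u s * Q0 k a a \<le> Q0 k a a"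
      using ramp_bounds[of l u s] Q0_pos[of a a] a by (simp add: mult_left_le_one_le)
    ultimately show ?thesis using Fa by linarith
  qed
  have eq: "F s = Q0 k a s" if "a \<le> s" "s \<le> l" for s
    using upper[OF that(1)] lower[OF that(1)] ramp_eq_1[OF a(3) that(2)] by simp
  have mono: "F s \<le> F t" if "a \<le> s" "s \<le> t" for s t
  proof (rule DERIV_nonneg_imp_nondecreasing[OF that(2)])
    fix x assume "s \<le> x"
    then have "a \<le> x" using that by simp
    then show "\<exists>y. (F has_real_derivative y) (at x) \<and> 0 \<le> y"
      using F[OF half(1)] less_imp_le[OF half(2)] ramp_bounds(1)[of l u x]
      by (intro exI[of _ "m x * ramp l u x"] conjI mult_nonneg_nonneg) auto
  qed
  have const: "F s = F u" if "u \<le> s" for s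
  proof -
    have "F s - F u \<le> 0 - 0"
      by (rule DERIV_le_imp_le[OF that F, where g = "\<lambda>_. 0" and g' = "\<lambda>_. 0"])
        (use half ramp_eq_0[OF a(3)] a in auto)
    with mono[of u s] that a show ?thesis by simp
  qed
  show ?thesis by (rule that[of F]) (fact F eq upper lower mono const)+
qed

text \<open>\<open>\<theta>\<close> solves \<open>(s^k \<theta>)' = s^{k-2} (\<chi>1/q1 - \<chi>2/q2)\<close> with cut-offs \<open>\<chi>1, \<chi>2\<close> of width \<open>e\<close> and \<open>\<theta> = 0\<close>
  from \<open>t2\<close> on.\<close>

lemma test_function_exists:
  assumes a: "0 < a" "a \<le> t1" and e: "0 < e" "t1 + e \<le> t2 - e"
  shows "\<exists>\<theta> \<theta>'. (\<forall>s>a / 2. (\<theta> has_real_derivative \<theta>' s) (at s)) \<and> continuous_on {a / 2<..} \<theta>' \<and>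
     (\<forall>s\<ge>a. \<theta>' s \<le> 0) \<and> (\<forall>s\<ge>t2. \<theta> s = 0 \<and> \<theta>' s = 0) \<and>
     (\<forall>s\<ge>a. of_bool (s \<le> t1) / Q0 k a (t1 + e) - of_bool (s \<le> t2) / Q0 k a (t2 - e)
        \<le> real k * s * \<theta> s + s\<^sup>2 * \<theta>' s)"
proof -
  let ?Q = "Q0 k a"
  let ?c1 = "ramp t1 (t1 + e)" and ?c2 = "ramp (t2 - e) t2"
  obtain F1 where F1: "\<And>s. a / 2 < s \<Longrightarrow> (F1 has_real_derivative m s * ?c1 s) (at s)"
    "\<And>s. a \<le> s \<Longrightarrow> s \<le> t1 \<Longrightarrow> F1 s = ?Q s"
    "\<And>s. a \<le> s \<Longrightarrow> F1 s \<le> ?Q s"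
    "\<And>s. a \<le> s \<Longrightarrow> ?c1 s * ?Q s \<le> F1 s"
    "\<And>s t. a \<le> s \<Longrightarrow> s \<le> t \<Longrightarrow> F1 s \<le> F1 t"
    "\<And>s. t1 + e \<le> s \<Longrightarrow> F1 s = F1 (t1 + e)"
    by (rule truncated_Q0_exists[of a t1 "t1 + e"]) (use a e in auto)
  obtain F2 where F2: "\<And>s. a / 2 < s \<Longrightarrow> (F2 has_real_derivative m s * ?c2 s) (at s)"
    "\<And>s. a \<le> s \<Longrightarrow> s \<le> t2 - e \<Longrightarrow> F2 s = ?Q s"
    "\<And>s. a \<le> s \<Longrightarrow> F2 s \<le> ?Q s"
    "\<And>s. a \<le> s \<Longrightarrow> ?c2 s * ?Q s \<le> F2 s"
    "\<And>s t. a \<le> s \<Longrightarrow> s \<le> t \<Longrightarrow> F2 s \<le> F2 t"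
    "\<And>s. t2 \<le> s \<Longrightarrow> F2 s = F2 t2"
    by (rule truncated_Q0_exists[of a "t2 - e" t2]) (use a e in auto)
  \<comment> \<open>The final values of the truncated primitives. Dividing by them makes the
    difference \<open>N\<close> vanish from \<open>t2\<close> on, so that \<theta> does too; they
    differ from \<open>?Q (t1 + e)\<close> and \<open>?Q (t2 - e)\<close> in the direction needed at
    the end.\<close>
  define q1 where "q1 = F1 (t1 + e)"
  define q2 where "q2 = F2 t2"
  have q1: "0 < q1" "q1 \<le> ?Q (t1 + e)"
    using F1(2)[of t1] F1(3)[of "t1 + e"] F1(5)[of t1 "t1 + e"] Q0_pos[of a t1] a e by (auto simp: q1_def)
  have q2: "?Q (t2 - e) \<le> q2" "0 < ?Q (t2 - e)"
    using F2(2)[of "t2 - e"] F2(5)[of "t2 - e" t2] Q0_pos[of a "t2 - e"] a e by (auto simp: q2_def)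
  then have q2_pos: "0 < q2" by simp
  have F2_le: "F2 s \<le> q2" if "a \<le> s" for s
    using F2(5)[OF that, of t2] F2(6)[of s] unfolding q2_def by (cases "s \<le> t2") auto
  define N where "N s = F1 s / q1 - F2 s / q2" for s
  define d where "d s = ?c1 s / q1 - ?c2 s / q2" for s
  have N': "(N has_real_derivative m s * d s) (at s)" if "a / 2 < s" for s
    unfolding N_def[abs_def] d_def
    by (rule DERIV_cong[OF DERIV_diff[OF DERIV_cdivide[OF F1(1)[OF that]] DERIV_cdivide[OF F2(1)[OF that]]]])
      (simp add: right_diff_distrib)
  \<comment> \<open>For \<open>\<theta> = N / s^k\<close> this says that its derivative is
    nonpositive. If \<open>d s \<ge> 0\<close> before \<open>t1 + e\<close>, it follows from
    \<open>Q0_ge\<close> and \<open>?Q s * d s \<le> N s\<close>; otherwise the left side is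
    nonpositive and \<open>0 \<le> N s\<close> suffices.\<close>
  have key: "s ^ (k - 1) * d s \<le> real k * N s" if s: "a \<le> s" for s
  proof (cases "t1 + e \<le> s")
    case True
    have "d s \<le> 0" using ramp_eq_0[of t1 "t1 + e" s] ramp_bounds(1)[of "t2 - e" t2 s] e True q2_pos by (simp add: d_def)
    then have "s ^ (k - 1) * d s \<le> 0" using s a by (intro mult_nonneg_nonpos) auto
    moreover have "N s = 1 - F2 s / q2" using F1(6)[OF True] q1(1) by (simp add: N_def q1_def)
    then have "0 \<le> N s" using F2_le[OF s] q2_pos by simp
    ultimately show ?thesis by (meson mult_nonneg_nonneg of_nat_0_le_iff order_trans)
  next
    case False
    then have s2: "s \<le> t2 - e" using e by simp
    have ds: "d s = ?c1 s / q1 - 1 / q2" using ramp_eq_1[of "t2 - e" t2 s] e s2 by (simp add: d_def)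
    have Ns: "N s = F1 s / q1 - ?Q s / q2" using F2(2)[OF s s2] by (simp add: N_def)
    show ?thesis
    proof (cases "0 \<le> d s")
      case True
      have "s ^ (k - 1) * d s \<le> real k * ?Q s * d s"
        using Q0_ge[OF a(1) s] True by (intro mult_right_mono)
      also have "?Q s * d s \<le> N s"
        using divide_right_mono[OF F1(4)[OF s], of q1] q1(1) unfolding ds Ns by (simp add: right_diff_distrib mult.commute)
      then have "real k * ?Q s * d s \<le> real k * N s" by (simp add: mult.assoc mult_left_mono)
      finally show ?thesis .
    next
      case neg: False
      then have "s ^ (k - 1) * d s \<le> 0" using s a by (intro mult_nonneg_nonpos) auto
      \<comment> \<open>Once negative, \<open>d\<close> stays nonpositive up to
        \<open>t1 + e\<close>, because the first ramp decreases while the second is still 1. Hence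
        \<open>N\<close> decreases to its value at \<open>t1 + e\<close>, which is
        nonnegative.\<close>
      have "N (t1 + e) \<le> N s"
      proof (rule DERIV_nonpos_imp_nonincreasing[of s "t1 + e" N])
        show "s \<le> t1 + e" using False by simp
        fix x assume x: "s \<le> x" "x \<le> t1 + e"
        have "?c2 x = 1" using ramp_eq_1[of "t2 - e" t2 x] e x by simp
        moreover have "?c1 x / q1 \<le> ?c1 s / q1"
          using ramp_antimono[of t1 "t1 + e" s x] x e q1(1) by (intro divide_right_mono) auto
        ultimately have "d x \<le> 0" using neg unfolding ds by (simp add: d_def)
        moreover have "0 < m x" "a / 2 < x" using x s a m_pos[of x] by auto
        ultimately show "\<exists>y. (N has_real_derivative y) (at x) \<and> y \<le> 0"
          using N'[of x] by (intro exI[of _ "m x * d x"]) (auto intro: mult_nonneg_nonpos)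
      qed
      moreover have "N (t1 + e) = 1 - F2 (t1 + e) / q2" using q1(1) by (simp add: N_def q1_def)
      moreover have "F2 (t1 + e) \<le> q2" using F2_le[of "t1 + e"] a e by simp
      moreover from this have "F2 (t1 + e) / q2 \<le> 1" using q2_pos by simp
      ultimately have "0 \<le> N s" by linarith
      with \<open>s ^ (k - 1) * d s \<le> 0\<close> show ?thesis by (meson mult_nonneg_nonneg of_nat_0_le_iff order_trans)
    qed
  qed
  define \<theta> where "\<theta> s = N s / s ^ k" for s
  define \<theta>' where "\<theta>' s = (s ^ (k - 1) * d s - real k * N s) / (s * s ^ k)" for s
  have pow: "s ^ k = s * s ^ (k - 1)" for s :: real
    using k by (metis Suc_diff_1 Suc_le_lessD One_nat_def power_Suc)
  have deriv: "(\<theta> has_real_derivative \<theta>' s) (at s)" if s: "a / 2 < s" for s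
  proof -
    have s0: "0 < s" using s a by simp
    have "((\<lambda>s. s ^ k) has_real_derivative real k * s ^ (k - 1)) (at s)"
      using DERIV_pow[of k s] by simp
    from DERIV_divide[OF N'[OF s] this] s0
    have 1: "((\<lambda>s. N s / s ^ k) has_real_derivative (m s * d s * s ^ k - N s * (real k * s ^ (k - 1))) / (s ^ k * s ^ k)) (at s)" by simp
    have "m s = s ^ (k - 1) / s" using m_mult(1)[OF s0] s0 by (simp add: field_simps)
    then have "(m s * d s * s ^ k - N s * (real k * s ^ (k - 1))) / (s ^ k * s ^ k) = \<theta>' s"
      using s0 by (simp add: \<theta>'_def pow field_simps)
    with 1 show ?thesis by (simp add: \<theta>_def[abs_def])
  qed
  moreover have "continuous_on {a / 2<..} \<theta>'"
  proof -
    have "continuous_on {a / 2<..} N"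
      by (intro continuous_at_imp_continuous_on ballI, rule DERIV_isCont, rule N') simp
    then show ?thesis
      unfolding \<theta>'_def[abs_def] d_def using a e q1(1) q2_pos
      by (intro continuous_intros continuous_ramp) auto
  qed
  moreover have "\<theta>' s \<le> 0" if "a \<le> s" for s
    using key[OF that] that a unfolding \<theta>'_def by (intro divide_nonpos_nonneg) auto
  moreover have "\<theta> s = 0" "\<theta>' s = 0" if "t2 \<le> s" for s
  proof -
    have "t1 + e \<le> s" using that e by simp
    then have "N s = 0" using F1(6)[of s] F2(6)[OF that] q1(1) q2_pos by (simp add: N_def q1_def q2_def)
    moreover have "d s = 0"
      using ramp_eq_0[of t1 "t1 + e" s] ramp_eq_0[of "t2 - e" t2 s] that e \<open>t1 + e \<le> s\<close> by (simp add: d_def)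
    ultimately show "\<theta> s = 0" "\<theta>' s = 0" by (simp_all add: \<theta>_def \<theta>'_def)
  qed
  moreover have "of_bool (s \<le> t1) / ?Q (t1 + e) - of_bool (s \<le> t2) / ?Q (t2 - e) \<le> real k * s * \<theta> s + s\<^sup>2 * \<theta>' s"
    if s: "a \<le> s" for s
  proof -
    have s0: "s > 0" using s a by simp
    have "real k * s * \<theta> s + s\<^sup>2 * \<theta>' s = d s"
      using s0 by (simp add: \<theta>_def \<theta>'_def pow power2_eq_square field_simps)
    \<comment> \<open>The first ramp falls to the right of \<open>t1\<close>, the second to the left
      of \<open>t2\<close>, so each cut-off errs in the direction of the inequality, as do
      \<open>q1\<close> and \<open>q2\<close>.\<close>
    moreover have "of_bool (s \<le> t1) / ?Q (t1 + e) \<le> ?c1 s / q1"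
    proof (cases "s \<le> t1")
      case True
      then show ?thesis using ramp_eq_1[of t1 "t1 + e" s] e q1 by (simp add: frac_le)
    qed (use ramp_bounds(1) q1(1) in simp)
    moreover have "?c2 s / q2 \<le> of_bool (s \<le> t2) / ?Q (t2 - e)"
    proof (cases "s \<le> t2")
      case True
      then show ?thesis using ramp_bounds[of "t2 - e" t2 s] q2 by (simp add: frac_le)
    qed (use ramp_eq_0[of "t2 - e" t2 s] e in simp)
    ultimately show ?thesis by (simp add: d_def)
  qed
  ultimately show ?thesis by blast
qed

end

section \<open>Comparison of volumes\<close>

text \<open>Near infinity \<open>to_ball\<close> takes values in any neighbourhood of
  \<open>ideal_point\<close>, in particular in the complement of the closure, so \<Sigma> has no
  points of large norm.\<close>

lemma bounded_if_ideal_point_notin_closure: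
  fixes \<Sigma> :: "(real \<times> 'y::euclidean_space) set"
  assumes "ideal_point \<notin> closure (to_ball ` \<Sigma>)"
  shows "bounded \<Sigma>"
proof -
  have "open (- closure (to_ball ` \<Sigma>))" "ideal_point \<in> - closure (to_ball ` \<Sigma>)"
    using assms by auto
  from topological_tendstoD[OF to_ball_tendsto_ideal_point this]
  obtain b where b: "\<And>p. b \<le> norm p \<Longrightarrow> to_ball p \<in> - closure (to_ball ` \<Sigma>)"
    unfolding eventually_at_infinity by blast
  have "norm p \<le> b" if "p \<in> \<Sigma>" for p
  proof (rule ccontr)
    assume "\<not> norm p \<le> b"
    then have "to_ball p \<notin> closure (to_ball ` \<Sigma>)" using b[of p] by simp
    moreover have "to_ball p \<in> closure (to_ball ` \<Sigma>)" using closure_subset[of "to_ball ` \<Sigma>"] imageI[OF that, of to_ball] by (rule subsetD)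
    ultimately show False by blast
  qed
  then show ?thesis unfolding bounded_iff by blast
qed

text \<open>\<Sigma> is closed only relative to the half-space; a positive lower bound on the height
  keeps limits away from its boundary.\<close>

lemma closed_superlevel:
  assumes "hyp_submanifold T (\<Sigma> :: (real \<times> 'y::euclidean_space) set)" "0 < h"
  shows "closed {p \<in> \<Sigma>. h \<le> fst p}"
proof -
  obtain C where C: "closed C" "\<Sigma> = half_space \<inter> C"
    using assms(1) by (auto simp: hyp_submanifold_def closedin_closed)
  have "closed {p :: real \<times> 'y. h \<le> fst p}" by (intro closed_Collect_le continuous_intros)
  moreover have "{p \<in> \<Sigma>. h \<le> fst p} = C \<inter> {p. h \<le> fst p}"
    using assms(2) C(2) by (auto simp: half_space_def)
  ultimately show ?thesis using C(1) by auto
qed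

lemma hyp_volume_empty: "hyp_volume T \<Sigma> {} = 0"
proof -
  have "hyp_volume T \<Sigma> {} \<le> 0"
    unfolding hyp_volume_def by (rule Sup_least) auto
  then show ?thesis by simp
qed

context atlas
begin

text \<open>The monotonicity with cut-offs of width \<open>e\<close>. For
  \<open>\<omega> p = \<theta> (1 / fst p)\<close>, supported in \<open>K\<close>, the integrand of
  \<open>first_variation\<close> is \<open>- (k s \<theta> + s^2 \<theta>' T)\<close> with
  \<open>s = 1 / fst p\<close> and \<open>T\<close> the height of the tangent field; it is bounded
  above by a difference of normalised indicators and integrated.\<close>

lemma volume_comparison:
  assumes min: "minimal_submanifold TYPE('k) \<Sigma>" and half: "\<Sigma> \<subseteq> half_space"
    and K_eq: "K = {p \<in> \<Sigma>. 1 / t2 \<le> fst p}"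
    and a: "0 < a" "\<And>p. p \<in> \<Sigma> \<Longrightarrow> a \<le> 1 / fst p" "a \<le> t1"
    and e: "0 < e" "t1 + e \<le> t2 - e"
  shows "measure \<nu> {p \<in> \<Sigma>. 1 / t1 \<le> fst p} / Q0 CARD('k) a (t1 + e)
       \<le> measure \<nu> K / Q0 CARD('k) a (t2 - e)"
proof -
  interpret finite_measure \<nu> by (rule finite_measure_\<nu>)
  interpret power_weight "CARD('k)" "\<lambda>s. s powi (int CARD('k) - 2)"
    by unfold_locales (auto simp: Suc_leI)
  have t: "0 < t1" "0 < t2" using a e by auto
  obtain \<theta> \<theta>' where \<theta>: "\<And>s. a / 2 < s \<Longrightarrow> (\<theta> has_real_derivative \<theta>' s) (at s)"
    and cont_\<theta>': "continuous_on {a / 2<..} \<theta>'"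
    and \<theta>'_nonpos: "\<And>s. a \<le> s \<Longrightarrow> \<theta>' s \<le> 0"
    and \<theta>_0: "\<And>s. t2 \<le> s \<Longrightarrow> \<theta> s = 0" "\<And>s. t2 \<le> s \<Longrightarrow> \<theta>' s = 0"
    and \<theta>_ge: "\<And>s. a \<le> s \<Longrightarrow> of_bool (s \<le> t1) / Q0 CARD('k) a (t1 + e) - of_bool (s \<le> t2) / Q0 CARD('k) a (t2 - e)
        \<le> real CARD('k) * s * \<theta> s + s\<^sup>2 * \<theta>' s"
    using test_function_exists[OF a(1,3) e] by blast
  have fst_pos: "0 < fst p" if "p \<in> \<Sigma>" for p using half that by (auto simp: half_space_def)
  have s_gt: "a / 2 < 1 / fst p" if "p \<in> \<Sigma>" for p using a(1) a(2)[OF that] by linarith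
  define \<omega> where "\<omega> p = \<theta> (1 / fst p)" for p :: "real \<times> 'y"
  define \<omega>' where "\<omega>' p v = \<theta>' (1 / fst p) * (- fst v / (fst p)\<^sup>2)" for p v :: "real \<times> 'y"
  have deriv: "(\<omega> has_derivative \<omega>' p) (at p)" if p: "p \<in> \<Sigma>" for p
  proof -
    have x: "fst p \<noteq> 0" using fst_pos[OF p] by simp
    have "((\<lambda>x. 1 / x) has_real_derivative - 1 / (fst p)\<^sup>2) (at (fst p))"
      using x by (auto intro!: derivative_eq_intros simp: power2_eq_square)
    from DERIV_chain2[OF \<theta>[OF s_gt[OF p]] this]
    have "((\<lambda>x. \<theta> (1 / x)) has_derivative (*) (\<theta>' (1 / fst p) * (- 1 / (fst p)\<^sup>2))) (at (fst p))"
      by (simp add: has_field_derivative_def)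
    from has_derivative_compose[OF has_derivative_fst[OF has_derivative_ident] this]
    show ?thesis by (simp add: \<omega>_def[abs_def] \<omega>'_def[abs_def])
  qed
  have cont: "continuous_on \<Sigma> (\<lambda>p. \<omega>' p v)" for v
  proof -
    have "continuous_on \<Sigma> (\<lambda>p. 1 / fst p)"
      by (intro continuous_intros) (use fst_pos in force)
    then have "continuous_on \<Sigma> (\<lambda>p. \<theta>' (1 / fst p))"
      by (rule continuous_on_compose2[OF cont_\<theta>']) (use s_gt in auto)
    then show ?thesis
      unfolding \<omega>'_def by (intro continuous_intros) (use fst_pos in force)+
  qed
  have inK: "p \<in> K \<longleftrightarrow> 1 / fst p \<le> t2" if "p \<in> \<Sigma>" for p
    using that fst_pos[OF that] t by (simp add: K_eq field_simps)
  have supp: "\<omega> p = 0" "\<omega>' p v = 0" if "p \<in> \<Sigma> - K" for p v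
    using inK[of p] that \<theta>_0[of "1 / fst p"] by (auto simp: \<omega>_def \<omega>'_def)
  have H: "mean_curvature (\<phi> j) u = 0" if "j < N" "u \<in> U j" for j u
    using min chart[OF that(1)] that(2) unfolding minimal_submanifold_def chart_def by blast
  let ?I = "\<lambda>p. indicator K p * (- real CARD('k) * \<omega> p / fst p + \<omega>' p (tangent_field TYPE('k) \<Sigma> p))"
  have var: "integrable \<nu> ?I" "(\<integral>p. ?I p \<partial>\<nu>) = 0"
    by (rule first_variation[OF H deriv cont supp]; assumption)+
  define B where "B = {p \<in> \<Sigma>. 1 / t1 \<le> fst p}"
  let ?q1 = "Q0 CARD('k) a (t1 + e)" and ?q2 = "Q0 CARD('k) a (t2 - e)"
  have inB: "p \<in> B \<longleftrightarrow> 1 / fst p \<le> t1" if "p \<in> \<Sigma>" for p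
    using that fst_pos[OF that] t by (simp add: B_def field_simps)
  have BK: "B \<subseteq> K"
  proof
    fix p assume p: "p \<in> B"
    then have "p \<in> \<Sigma>" by (simp add: B_def)
    then show "p \<in> K" using p inB inK e by simp
  qed
  have B_eq: "B = \<Sigma> \<inter> {p. 1 / t1 \<le> fst p}" by (auto simp: B_def)
  have "closed {p :: real \<times> 'y. 1 / t1 \<le> fst p}" by (intro closed_Collect_le continuous_intros)
  then have B: "B \<in> sets borel" unfolding B_eq using \<Sigma>_borel by auto
  have le: "?I p \<le> indicator K p / ?q2 - indicator B p / ?q1" for p
  proof (cases "p \<in> K")
    case True
    then have p: "p \<in> \<Sigma>" using K(2) by blast
    let ?s = "1 / fst p" and ?T = "fst (tangent_field TYPE('k) \<Sigma> p)"
    \<comment> \<open>The gradient bound \<open>?T \<le> 1\<close> enters here; since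
      \<open>\<theta>'\<close> is nonpositive, replacing \<open>?T\<close> by 1 can only lower the
      value.\<close>
    have "?s\<^sup>2 * \<theta>' ?s * 1 \<le> ?s\<^sup>2 * \<theta>' ?s * ?T"
      by (rule mult_left_mono_neg[OF tangent_field_bounds(2)[OF True]])
        (rule mult_nonneg_nonpos[OF zero_le_power2 \<theta>'_nonpos[OF a(2)[OF p]]])
    then have ge: "of_bool (?s \<le> t1) / ?q1 - of_bool (?s \<le> t2) / ?q2 \<le> real CARD('k) * ?s * \<theta> ?s + ?s\<^sup>2 * \<theta>' ?s * ?T"
      using \<theta>_ge[OF a(2)[OF p]] by linarith
    have Ieq: "?I p = - (real CARD('k) * ?s * \<theta> ?s + ?s\<^sup>2 * \<theta>' ?s * ?T)"
      using True by (simp add: \<omega>_def \<omega>'_def power_divide)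
    have ind: "indicator B p = (of_bool (?s \<le> t1) :: real)" "indicator K p = (of_bool (?s \<le> t2) :: real)"
      using inB[OF p] inK[OF p] by (simp_all add: indicator_def)
    show ?thesis unfolding Ieq unfolding ind using ge by linarith
  next
    case False
    with BK have "p \<notin> B" by blast
    with False show ?thesis by simp
  qed
  have "0 \<le> (\<integral>p. indicator K p / ?q2 - indicator B p / ?q1 \<partial>\<nu>)"
    unfolding var(2)[symmetric]
    by (rule integral_mono[OF var(1) _ le])
      (use K_borel B in \<open>auto intro!: Bochner_Integration.integrable_diff integrable_divide integrable_real_indicator simp: emeasure_eq_measure\<close>)
  also have "\<dots> = measure \<nu> K / ?q2 - measure \<nu> B / ?q1"
    using K_borel B by (subst Bochner_Integration.integral_diff)
      (auto intro!: integrable_divide integrable_real_indicator simp: emeasure_eq_measure)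
  finally show ?thesis by (simp add: B_def)
qed

end

theorem theorem1p3:
  fixes \<Sigma> :: "(real \<times> 'y::euclidean_space) set" and a :: real
  assumes "minimal_submanifold TYPE('k::{finite,wellorder}) \<Sigma>"
    and "\<Sigma> \<noteq> {}"
    and "ideal_point \<notin> closure (to_ball ` \<Sigma>)"
    and "0 < a" and "a \<le> 1 / max_height \<Sigma>"
  shows "mono_on {0<..}
    (\<lambda>t. hyp_volume TYPE('k) \<Sigma> {p \<in> \<Sigma>. fst p \<ge> 1 / t} / ennreal (Q0 CARD('k) a t))"
proof (rule mono_onI)
  fix t1 t2 :: real
  assume t: "t1 \<in> {0<..}" "t2 \<in> {0<..}" "t1 \<le> t2"
  have sub: "hyp_submanifold TYPE('k) \<Sigma>" using assms(1) by (simp add: minimal_submanifold_def)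
  then have half: "\<Sigma> \<subseteq> half_space" by (simp add: hyp_submanifold_def)
  have bdd: "bounded \<Sigma>" by (rule bounded_if_ideal_point_notin_closure[OF assms(3)])
  have height: "a \<le> 1 / fst p" if p: "p \<in> \<Sigma>" for p
  proof -
    have "bdd_above (fst ` \<Sigma>)"
      by (rule bounded_imp_bdd_above[OF bounded_fst[OF bdd]])
    then have "fst p \<le> max_height \<Sigma>" unfolding max_height_def using p by (intro cSUP_upper)
    moreover have "0 < fst p" using half p by (auto simp: half_space_def)
    ultimately have "1 / max_height \<Sigma> \<le> 1 / fst p" by (intro divide_left_mono) auto
    then show ?thesis using assms(5) by simp
  qed
  let ?B = "\<lambda>t. {p \<in> \<Sigma>. fst p \<ge> 1 / t}"
  show "hyp_volume TYPE('k) \<Sigma> (?B t1) / ennreal (Q0 CARD('k) a t1)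
      \<le> hyp_volume TYPE('k) \<Sigma> (?B t2) / ennreal (Q0 CARD('k) a t2)"
  \<comment> \<open>Below \<open>a\<close> the region is empty, and 0 divided by anything is 0 in
    \<open>ennreal\<close>, whatever the sign of \<open>Q0\<close> there. The case
    \<open>t1 = t2\<close> is separated because the cut-offs need
    \<open>2 * e \<le> t2 - t1\<close>.\<close>
  proof (cases "t1 < a \<or> t1 = t2")
    case True
    have "?B t1 = {}" if "t1 < a"
    proof -
      have "\<not> fst p \<ge> 1 / t1" if p: "p \<in> \<Sigma>" for p
      proof -
        have "0 < fst p" using half p by (auto simp: half_space_def)
        moreover have "t1 < 1 / fst p" using height[OF p] \<open>t1 < a\<close> by simp
        ultimately show ?thesis using t by (simp add: field_simps)
      qed
      then show ?thesis by blast
    qed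
    then have "hyp_volume TYPE('k) \<Sigma> (?B t1) = 0" if "t1 < a"
      using that by (simp only: hyp_volume_empty)
    then show ?thesis using True by (cases "t1 = t2") auto
  next
    case False
    then have t12: "a \<le> t1" "t1 < t2" using t by auto
    \<comment> \<open>The region at \<open>t1\<close> is contained in the one at \<open>t2\<close>,
      so one atlas and one measure \<nu> compute both volumes.\<close>
    define K where "K = ?B t2"
    have K: "compact K" "K \<subseteq> \<Sigma>"
      unfolding K_def compact_eq_bounded_closed
      using closed_superlevel[OF sub, of "1 / t2"] t bounded_subset[OF bdd] by auto
    obtain N c r U and \<phi> :: "nat \<Rightarrow> real ^ 'k::_ \<Rightarrow> real \<times> 'y" where "atlas \<Sigma> K N c r U \<phi>"
      using atlas_exists[OF sub K] by blast
    then interpret atlas \<Sigma> K N c r U \<phi> .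
    interpret finite_measure \<nu> by (rule finite_measure_\<nu>)
    interpret power_weight "CARD('k)" "\<lambda>s. s powi (int CARD('k) - 2)"
      by unfold_locales (auto simp: Suc_leI)
    let ?Q = "Q0 CARD('k) a"
    have "1 / t2 \<le> 1 / t1" using t by (intro divide_left_mono) auto
    then have B1: "?B t1 \<subseteq> K" unfolding K_def by auto
    have B_borel: "?B t1 \<in> sets borel"
      using closed_superlevel[OF sub, of "1 / t1"] t by auto
    have vol: "hyp_volume TYPE('k) \<Sigma> (?B t1) = ennreal (measure \<nu> (?B t1))"
      "hyp_volume TYPE('k) \<Sigma> (?B t2) = ennreal (measure \<nu> K)"
      unfolding K_def[symmetric] hyp_volume_eq[OF B_borel B1 half] hyp_volume_eq[OF K_borel subset_refl half]
      by (simp_all only: emeasure_eq_measure)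
    have Q_pos: "0 < ?Q t1" "0 < ?Q t2" using Q0_pos assms(4) t12 by auto
    have Q_cont: "isCont ?Q s" if "a \<le> s" for s
      using DERIV_isCont[OF Q0_deriv[OF assms(4)]] that assms(4) by simp
    have "measure \<nu> (?B t1) / ?Q t1 \<le> measure \<nu> K / ?Q t2"
    proof (rule tendsto_le)
      show "((\<lambda>e. measure \<nu> (?B t1) / ?Q (t1 + e)) \<longlongrightarrow> measure \<nu> (?B t1) / ?Q t1) (at_right 0)"
        using Q_pos t12
        by (intro tendsto_intros isCont_tendsto_compose[OF Q_cont]) (auto intro!: tendsto_eq_intros)
      show "((\<lambda>e. measure \<nu> K / ?Q (t2 - e)) \<longlongrightarrow> measure \<nu> K / ?Q t2) (at_right 0)"
        using Q_pos t12
        by (intro tendsto_intros isCont_tendsto_compose[OF Q_cont]) (auto intro!: tendsto_eq_intros)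
      have "\<forall>\<^sub>F e in at_right 0. e \<in> {0<..<(t2 - t1) / 2}"
        using t12 by (intro eventually_at_right_real) auto
      then show "\<forall>\<^sub>F e in at_right 0. measure \<nu> (?B t1) / ?Q (t1 + e) \<le> measure \<nu> K / ?Q (t2 - e)"
      proof eventually_elim
        case (elim e)
        then have "0 < e" "t1 + e \<le> t2 - e" by (auto simp: field_simps)
        then show ?case
          using volume_comparison[OF assms(1) half K_def assms(4) height t12(1)] by simp
      qed
    qed simp
    then show ?thesis
      unfolding vol using Q_pos by (simp add: divide_ennreal ennreal_leI)
  qed
qed

end
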